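(* Let $P$ be a partially ordered set with a smallest element, let $H_1,H_2$ be Hilbert spaces, and let $\{M_u\}_{u\in P}$ be a family of ternary rings of operators $M_u\subset\mathbb B(H_1,H_2)$ compatible with the partial order on $P$ (i.e. $u\le w$ implies $M_u\subset M_w$). Let $\gamma P$, $M$, $\{M_v\}_{v\in\gamma P}$, $\{\pi_v\}_{v\in\gamma P}$ and the continuous fields of $C^*$-algebras $\mathcal A=(\gamma P,A,\{A_v\}_{v\in\gamma P},\{p_v\}_{v\in\gamma P})$, $\mathcal B=(\gamma P,B,\{B_v\}_{v\in\gamma P},\{q_v\}_{v\in\gamma P})$ be as constructed in the context. Then $\mathcal M=(\gamma P,M,\{M_v\}_{v\in\gamma P},\{\pi_v\}_{v\in\gamma P})$ is a continuous field of Hilbert $\mathcal A$-$\mathcal B$-$C^*$-bimodules.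
   Context: Notation: for a family of normed spaces $\{A_t\}_{t\in T}$, $\prod_{t\in T}A_t$ is the set of families $\{a_t\}$ with $\sup_t\|a_t\|<\infty$. $C_b(P,E)$ is the space of bounded continuous maps from $P$ to $E$, and $C_b(P)=C_b(P,\mathbb C)$. Continuous field of $C^*$-algebras: let $T$ be compact Hausdorff, $A$, $A_t$ ($t\in T$) $C^*$-algebras with $A\subset\prod_{t\in T}A_t$ and $p_t:A\to A_t$ the canonical projections. The quadruple $(T,A,\{A_t\},\{p_t\})$ is a continuous field of $C^*$-algebras if each $p_t$ is surjective, $C(T)$ acts on $A$ with $p_t(fa)=f(t)p_t(a)$ for all $f\in C(T)$, $a\in A$, $t\in T$, and $t\mapsto\|p_t(a)\|$ is continuous for every $a\in A$. Continuous field of Hilbert $C^*$-bimodules: given continuous fields of $C^*$-algebras $\mathcal A=(T,A,\{A_t\},\{p_t\})$ and $\mathcal B=(T,B,\{B_t\},\{q_t\})$, a continuous field of Hilbert $\mathcal A$-$\mathcal B$-$C^*$-bimodules over $T$ is a quadruple $(T,M,\{M_t\},\{\pi_t\})$ where $M$ is a Hilbert $A$-$B$-$C^*$-bimodule with inner products ${}_A\langle\cdot,\cdot\rangle$, $\langle\cdot,\cdot\rangle_B$; each $M_t$ is a Hilbert $A_t$-$B_t$-$C^*$-bimodule with inner products ${}_{A_t}\langle\cdot,\cdot\rangle$, $\langle\cdot,\cdot\rangle_{B_t}$; $M\subset\prod_{t\in T}M_t$; $C(T)$ acts on $M$ with $\pi_t(fm)=f(t)\pi_t(m)$; the canonical projections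 $\pi_t:M\to M_t$ are surjective; $\pi_t(am)=p_t(a)\pi_t(m)$ and $\pi_t(mb)=\pi_t(m)q_t(b)$ for $a\in A$, $b\in B$, $m\in M$, $t\in T$; and $p_t({}_A\langle m,n\rangle)={}_{A_t}\langle\pi_t(m),\pi_t(n)\rangle$, $q_t(\langle m,n\rangle_B)=\langle\pi_t(m),\pi_t(n)\rangle_{B_t}$ for $m,n\in M$, $t\in T$. Topology and compactification: for $a\in P$ put $U_a=\{b\in P:a\le b\}$, $V_a=P\setminus U_a$; $P$ carries the topology with subbase $\{U_a,V_a:a\in P\}$. Let $\chi_a$, $\chi'_a$ be the characteristic functions of $U_a$, $V_a$, and let $C$ be the $C^*$-subalgebra of $C_b(P)$ generated by all $\chi_a,\chi'_a$. Then $C=C(\gamma P)$ for a compact Hausdorff space $\gamma P$ (its Gelfand spectrum), in which $P$ embeds as a dense subset by point evaluations. Ternary rings of operators (TROs): a closed linear subspace $N\subset\mathbb B(H_1,H_2)$ with $NN^*N\subset N$. Its ternary product is $(m,n,r)\mapsto mn^*r$. The space $M$: for $a\in P$, $s\in M_a$, let $\chi_{s,a}:P\to\mathbb B(H_1,H_2)$ be $\chi_{s,a}(b)=s$ if $a\le b$ and $0$ otherwise. $M$ is the smallest norm closed linear subspace of $C_b(P,\mathbb B(H_1,H_2))$ that contains all $\chi_{s,a}$ ($a\in P$, $s\in M_a$) and is closed under (pointwise) ternary products and under multiplication by bounded continuous functions on $P$. Each $m\in M$ extends by continuity to a map $\widetilde m$ on $\gamma P$. For $v\in\gamma P$, $\pi_v(m)=\widetilde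 m(v)$, and $M_v$ is the range of $\pi_v$ (for $v\in P$ this is the given $M_v$); $M_v$ is a TRO. The fields $\mathcal A,\mathcal B$: for $v\in\gamma P$ let $A_v=\overline{M_vM_v^*}\subset\mathbb B(H_2)$ and $B_v=\overline{M_v^*M_v}\subset\mathbb B(H_1)$. The families $\{A_u\}_{u\in P}$ and $\{B_u\}_{u\in P}$ of $C^*$-algebras are compatible with the order on $P$ and determine $\mathcal A$, $\mathcal B$ as follows. Similarly to the construction of $M$, $A$ is the $C^*$-subalgebra of $C_b(P,\mathbb B(H_2))$ generated by the maps $\chi_u\otimes a:b\mapsto\chi_u(b)a$, $u\in P$, $a\in A_u$; its elements extend continuously to $\gamma P$, so $A$ embeds into $C(\gamma P,\mathbb B(H_2))$, $p_v$ is evaluation at $v\in\gamma P$, and the fibre over $v$ is the range of $p_v$. $B$ and $q_v$ are obtained in the same way from $\{B_u\}_{u\in P}$. The inner products are ${}_A\langle m,n\rangle=mn^*$, $\langle m,n\rangle_B=m^*n$, and likewise on the fibres.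
   Formalization: That A and B are continuous fields of C*-algebras with fibres A_v, B_v is an explicit hypothesis, since it can fail for general P; and M is closed under multiplication by functions in C = C(γP) rather than all of C_b(P), since otherwise its elements need not extend to γP. *)

theory Defs
  imports "HOL-Analysis.Analysis"
begin

section \<open>Complex normed spaces and Hilbert spaces\<close>

class complex_normed_vector = real_normed_vector +
  fixes scaleC :: "complex \<Rightarrow> 'a \<Rightarrow> 'a" (infixr "*\<^sub>C" 75)
  assumes scaleC_add_right: "c *\<^sub>C (x + y) = c *\<^sub>C x + c *\<^sub>C y"
    and scaleC_add_left: "(c + d) *\<^sub>C x = c *\<^sub>C x + d *\<^sub>C x"
    and scaleC_scaleC: "c *\<^sub>C d *\<^sub>C x = (c * d) *\<^sub>C x"
    and scaleR_scaleC: "r *\<^sub>R x = complex_of_real r *\<^sub>C x"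
    and norm_scaleC: "norm (c *\<^sub>C x) = cmod c * norm x"

lemma bounded_bilinear_scaleC:
  "bounded_bilinear (scaleC :: complex \<Rightarrow> 'a::complex_normed_vector \<Rightarrow> 'a)"
proof
  fix r :: real and c :: complex and x :: 'a
  show "(r *\<^sub>R c) *\<^sub>C x = r *\<^sub>R (c *\<^sub>C x)"
    by (simp add: scaleR_scaleC scaleC_scaleC scaleR_conv_of_real)
  show "c *\<^sub>C (r *\<^sub>R x) = r *\<^sub>R (c *\<^sub>C x)"
    by (simp add: scaleR_scaleC scaleC_scaleC mult.commute)
  show "\<exists>K. \<forall>(c::complex) (x::'a). norm (c *\<^sub>C x) \<le> norm c * norm x * K"
    by (rule exI[of _ 1]) (simp add: norm_scaleC)
qed (simp_all add: scaleC_add_left scaleC_add_right)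

lemmas bounded_linear_scaleC_right =
  bounded_bilinear.bounded_linear_right[OF bounded_bilinear_scaleC]

instantiation complex :: complex_normed_vector
begin

definition scaleC_complex :: "complex \<Rightarrow> complex \<Rightarrow> complex"
  where "scaleC_complex c x = c * x"

instance
  by standard (auto simp: scaleC_complex_def algebra_simps norm_mult scaleR_conv_of_real)

end

instantiation blinfun :: (real_normed_vector, complex_normed_vector) complex_normed_vector
begin

lift_definition scaleC_blinfun :: "complex \<Rightarrow> ('a \<Rightarrow>\<^sub>L 'b) \<Rightarrow> ('a \<Rightarrow>\<^sub>L 'b)"
  is "\<lambda>c f x. c *\<^sub>C f x"
  by (rule bounded_linear_compose[OF bounded_linear_scaleC_right])

instance
proof
  fix c d :: complex and r :: real and x y :: "'a \<Rightarrow>\<^sub>L 'b"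
  show "c *\<^sub>C (x + y) = c *\<^sub>C x + c *\<^sub>C y"
    by transfer (simp add: scaleC_add_right)
  show "(c + d) *\<^sub>C x = c *\<^sub>C x + d *\<^sub>C x"
    by transfer (simp add: scaleC_add_left)
  show "c *\<^sub>C d *\<^sub>C x = (c * d) *\<^sub>C x"
    by transfer (simp add: scaleC_scaleC)
  show "r *\<^sub>R x = complex_of_real r *\<^sub>C x"
    by transfer (simp add: scaleR_scaleC)
  show "norm (c *\<^sub>C x) = cmod c * norm x"
  proof -
    have "onorm (\<lambda>v. c *\<^sub>C f v) = cmod c * onorm f" if "bounded_linear f" for f :: "'a \<Rightarrow> 'b"
    proof -
      have "onorm (\<lambda>v. c *\<^sub>C f v) = onorm (\<lambda>v. cmod c *\<^sub>R f v)"
        by (simp add: onorm_def norm_scaleC)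
      also have "\<dots> = cmod c * onorm f"
        by (simp add: onorm_scaleR that)
      finally show ?thesis .
    qed
    then show ?thesis by transfer simp
  qed
qed

end

unbundle bcontfun.lifting

instantiation bcontfun :: (topological_space, complex_normed_vector) complex_normed_vector
begin

lift_definition scaleC_bcontfun :: "complex \<Rightarrow> ('a \<Rightarrow>\<^sub>C 'b) \<Rightarrow> ('a \<Rightarrow>\<^sub>C 'b)"
  is "\<lambda>c f x. c *\<^sub>C f x"
  unfolding bcontfun_def
  by (auto intro!: bounded_linear.continuous_on[OF bounded_linear_scaleC_right]
      bounded_linear_image[OF _ bounded_linear_scaleC_right, of "range f" for f, unfolded image_image])

instance
proof
  fix c d :: complex and r :: real and x y :: "'a \<Rightarrow>\<^sub>C 'b"
  show "c *\<^sub>C (x + y) = c *\<^sub>C x + c *\<^sub>C y"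
    by (rule bcontfun_eqI) (simp add: scaleC_bcontfun.rep_eq plus_bcontfun.rep_eq scaleC_add_right)
  show "(c + d) *\<^sub>C x = c *\<^sub>C x + d *\<^sub>C x"
    by (rule bcontfun_eqI) (simp add: scaleC_bcontfun.rep_eq plus_bcontfun.rep_eq scaleC_add_left)
  show "c *\<^sub>C d *\<^sub>C x = (c * d) *\<^sub>C x"
    by (rule bcontfun_eqI) (simp add: scaleC_bcontfun.rep_eq scaleC_scaleC)
  show "r *\<^sub>R x = complex_of_real r *\<^sub>C x"
    by (rule bcontfun_eqI) (simp add: scaleC_bcontfun.rep_eq scaleR_bcontfun.rep_eq scaleR_scaleC)
  have le: "norm (c *\<^sub>C x) \<le> cmod c * norm x" for c and x :: "'a \<Rightarrow>\<^sub>C 'b"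
    by (rule norm_bound) (simp add: scaleC_bcontfun.rep_eq norm_scaleC mult_left_mono norm_bounded)
  show "norm (c *\<^sub>C x) = cmod c * norm x"
  proof (cases "c = 0")
    case True
    then show ?thesis using le[of c x] by simp
  next
    case False
    have "inverse c *\<^sub>C c *\<^sub>C x = x"
      using False scaleR_scaleC[of 1 "apply_bcontfun x _", symmetric]
      by (intro bcontfun_eqI) (simp add: scaleC_bcontfun.rep_eq scaleC_scaleC)
    then have "norm x \<le> cmod (inverse c) * norm (c *\<^sub>C x)"
      using le[of "inverse c" "c *\<^sub>C x"] by simp
    then have "cmod c * norm x \<le> norm (c *\<^sub>C x)"
      using False by (simp add: norm_divide field_simps)
    with le[of c x] show ?thesis by simp
  qed
qed

end

definition csubspace :: "'a::complex_normed_vector set \<Rightarrow> bool"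
  where "csubspace S \<longleftrightarrow> 0 \<in> S \<and> (\<forall>x\<in>S. \<forall>y\<in>S. x + y \<in> S) \<and> (\<forall>c. \<forall>x\<in>S. c *\<^sub>C x \<in> S)"

definition closed_cspan :: "'a::complex_normed_vector set \<Rightarrow> 'a set"
  where "closed_cspan X = \<Inter>{S. X \<subseteq> S \<and> csubspace S \<and> closed S}"

text \<open>The inner product is linear in the first argument.\<close>

class chilbert_space = complex_normed_vector + banach +
  fixes cinner :: "'a \<Rightarrow> 'a \<Rightarrow> complex"
  assumes cinner_commute: "cinner x y = cnj (cinner y x)"
    and cinner_add_left: "cinner (x + y) z = cinner x z + cinner y z"
    and cinner_scaleC_left: "cinner (c *\<^sub>C x) y = c * cinner x y"
    and cinner_self: "cinner x x = complex_of_real ((norm x)\<^sup>2)"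

text \<open>The type \<open>'a \<Rightarrow>\<^sub>L 'b\<close> consists of the bounded real-linear maps; the space
  \<open>\<bool>(H\<^sub>1, H\<^sub>2)\<close> is its closed subspace \<open>bounded_ops\<close>. The adjoint is only
  meaningful on that subspace.\<close>

definition bounded_ops :: "('a::complex_normed_vector \<Rightarrow>\<^sub>L 'b::complex_normed_vector) set"
  where "bounded_ops = {T. \<forall>c x. blinfun_apply T (c *\<^sub>C x) = c *\<^sub>C blinfun_apply T x}"

definition adj :: "('a::chilbert_space \<Rightarrow>\<^sub>L 'b::chilbert_space) \<Rightarrow> ('b \<Rightarrow>\<^sub>L 'a)"
  where "adj T = (THE S. \<forall>x y. cinner (blinfun_apply T x) y = cinner x (blinfun_apply S y))"

definition TRO :: "('a::chilbert_space \<Rightarrow>\<^sub>L 'b::chilbert_space) set \<Rightarrow> bool"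
  where "TRO N \<longleftrightarrow> N \<subseteq> bounded_ops \<and> csubspace N \<and> closed N \<and>
    (\<forall>m\<in>N. \<forall>n\<in>N. \<forall>r\<in>N. m o\<^sub>L adj n o\<^sub>L r \<in> N)"


section \<open>C*-algebras, Hilbert C*-bimodules and continuous fields\<close>

text \<open>The linear structure and the norm are those of the ambient type.\<close>

record 'a star_alg =
  alg_carrier :: "'a set"
  alg_mult :: "'a \<Rightarrow> 'a \<Rightarrow> 'a"
  alg_star :: "'a \<Rightarrow> 'a"

locale cstar_algebra =
  fixes A :: "'a::complex_normed_vector star_alg"
  assumes alg_csubspace: "csubspace (alg_carrier A)"
    and alg_complete: "complete (alg_carrier A)"
    and alg_mult_closed: "\<lbrakk>x \<in> alg_carrier A; y \<in> alg_carrier A\<rbrakk> \<Longrightarrow> alg_mult A x y \<in> alg_carrier A"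
    and alg_star_closed: "x \<in> alg_carrier A \<Longrightarrow> alg_star A x \<in> alg_carrier A"
    and alg_mult_assoc: "\<lbrakk>x \<in> alg_carrier A; y \<in> alg_carrier A; z \<in> alg_carrier A\<rbrakk> \<Longrightarrow>
      alg_mult A (alg_mult A x y) z = alg_mult A x (alg_mult A y z)"
    and alg_mult_add_left: "\<lbrakk>x \<in> alg_carrier A; y \<in> alg_carrier A; z \<in> alg_carrier A\<rbrakk> \<Longrightarrow>
      alg_mult A (x + y) z = alg_mult A x z + alg_mult A y z"
    and alg_mult_add_right: "\<lbrakk>x \<in> alg_carrier A; y \<in> alg_carrier A; z \<in> alg_carrier A\<rbrakk> \<Longrightarrow>
      alg_mult A x (y + z) = alg_mult A x y + alg_mult A x z"
    and alg_mult_scale_left: "\<lbrakk>x \<in> alg_carrier A; y \<in> alg_carrier A\<rbrakk> \<Longrightarrow>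
      alg_mult A (c *\<^sub>C x) y = c *\<^sub>C alg_mult A x y"
    and alg_mult_scale_right: "\<lbrakk>x \<in> alg_carrier A; y \<in> alg_carrier A\<rbrakk> \<Longrightarrow>
      alg_mult A x (c *\<^sub>C y) = c *\<^sub>C alg_mult A x y"
    and alg_star_star: "x \<in> alg_carrier A \<Longrightarrow> alg_star A (alg_star A x) = x"
    and alg_star_add: "\<lbrakk>x \<in> alg_carrier A; y \<in> alg_carrier A\<rbrakk> \<Longrightarrow>
      alg_star A (x + y) = alg_star A x + alg_star A y"
    and alg_star_scale: "x \<in> alg_carrier A \<Longrightarrow> alg_star A (c *\<^sub>C x) = cnj c *\<^sub>C alg_star A x"
    and alg_star_mult: "\<lbrakk>x \<in> alg_carrier A; y \<in> alg_carrier A\<rbrakk> \<Longrightarrow>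
      alg_star A (alg_mult A x y) = alg_mult A (alg_star A y) (alg_star A x)"
    and alg_norm_mult: "\<lbrakk>x \<in> alg_carrier A; y \<in> alg_carrier A\<rbrakk> \<Longrightarrow>
      norm (alg_mult A x y) \<le> norm x * norm y"
    and alg_cstar_identity: "x \<in> alg_carrier A \<Longrightarrow> norm (alg_mult A (alg_star A x) x) = (norm x)\<^sup>2"

definition alg_positive :: "'a star_alg \<Rightarrow> 'a \<Rightarrow> bool"
  where "alg_positive A x \<longleftrightarrow> (\<exists>y\<in>alg_carrier A. x = alg_mult A (alg_star A y) y)"

definition cstar_subalgebra :: "'a::complex_normed_vector star_alg \<Rightarrow> 'a set \<Rightarrow> bool"
  where "cstar_subalgebra K S \<longleftrightarrow> S \<subseteq> alg_carrier K \<and> csubspace S \<and> closed S \<and>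
    (\<forall>x\<in>S. \<forall>y\<in>S. alg_mult K x y \<in> S) \<and> (\<forall>x\<in>S. alg_star K x \<in> S)"

definition generated_cstar :: "'a::complex_normed_vector star_alg \<Rightarrow> 'a set \<Rightarrow> 'a star_alg"
  where "generated_cstar K G = K\<lparr>alg_carrier := \<Inter>{S. G \<subseteq> S \<and> cstar_subalgebra K S}\<rparr>"

record ('a, 'b, 'm) bimod =
  bm_carrier :: "'m set"
  bm_lact :: "'a \<Rightarrow> 'm \<Rightarrow> 'm"
  bm_ract :: "'m \<Rightarrow> 'b \<Rightarrow> 'm"
  bm_lip :: "'m \<Rightarrow> 'm \<Rightarrow> 'a"
  bm_rip :: "'m \<Rightarrow> 'm \<Rightarrow> 'b"

text \<open>The assumptions \<open>lip_norm\<close> and \<open>rip_norm\<close> say that the norm of the module is the one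
  induced by either inner product; they include definiteness.\<close>

locale left_hilbert_module =
  cstar_algebra A
  for A :: "'a::complex_normed_vector star_alg"
    and M :: "('a, 'b, 'm::complex_normed_vector, 'z) bimod_scheme" +
  assumes left_csubspace: "csubspace (bm_carrier M)"
    and left_complete: "complete (bm_carrier M)"
    and lact_closed: "\<lbrakk>a \<in> alg_carrier A; m \<in> bm_carrier M\<rbrakk> \<Longrightarrow> bm_lact M a m \<in> bm_carrier M"
    and lact_add_left: "\<lbrakk>a \<in> alg_carrier A; a' \<in> alg_carrier A; m \<in> bm_carrier M\<rbrakk> \<Longrightarrow>
      bm_lact M (a + a') m = bm_lact M a m + bm_lact M a' m"
    and lact_add_right: "\<lbrakk>a \<in> alg_carrier A; m \<in> bm_carrier M; n \<in> bm_carrier M\<rbrakk> \<Longrightarrow>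
      bm_lact M a (m + n) = bm_lact M a m + bm_lact M a n"
    and lact_scale_left: "\<lbrakk>a \<in> alg_carrier A; m \<in> bm_carrier M\<rbrakk> \<Longrightarrow>
      bm_lact M (c *\<^sub>C a) m = c *\<^sub>C bm_lact M a m"
    and lact_scale_right: "\<lbrakk>a \<in> alg_carrier A; m \<in> bm_carrier M\<rbrakk> \<Longrightarrow>
      bm_lact M a (c *\<^sub>C m) = c *\<^sub>C bm_lact M a m"
    and lact_mult: "\<lbrakk>a \<in> alg_carrier A; a' \<in> alg_carrier A; m \<in> bm_carrier M\<rbrakk> \<Longrightarrow>
      bm_lact M (alg_mult A a a') m = bm_lact M a (bm_lact M a' m)"
    and lip_closed: "\<lbrakk>m \<in> bm_carrier M; n \<in> bm_carrier M\<rbrakk> \<Longrightarrow> bm_lip M m n \<in> alg_carrier A"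
    and lip_add: "\<lbrakk>m \<in> bm_carrier M; m' \<in> bm_carrier M; n \<in> bm_carrier M\<rbrakk> \<Longrightarrow>
      bm_lip M (m + m') n = bm_lip M m n + bm_lip M m' n"
    and lip_scale: "\<lbrakk>m \<in> bm_carrier M; n \<in> bm_carrier M\<rbrakk> \<Longrightarrow>
      bm_lip M (c *\<^sub>C m) n = c *\<^sub>C bm_lip M m n"
    and lip_lact: "\<lbrakk>a \<in> alg_carrier A; m \<in> bm_carrier M; n \<in> bm_carrier M\<rbrakk> \<Longrightarrow>
      bm_lip M (bm_lact M a m) n = alg_mult A a (bm_lip M m n)"
    and lip_star: "\<lbrakk>m \<in> bm_carrier M; n \<in> bm_carrier M\<rbrakk> \<Longrightarrow>
      alg_star A (bm_lip M m n) = bm_lip M n m"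
    and lip_positive: "m \<in> bm_carrier M \<Longrightarrow> alg_positive A (bm_lip M m m)"
    and lip_norm: "m \<in> bm_carrier M \<Longrightarrow> norm (bm_lip M m m) = (norm m)\<^sup>2"

locale right_hilbert_module =
  cstar_algebra B
  for B :: "'b::complex_normed_vector star_alg"
    and M :: "('a, 'b, 'm::complex_normed_vector, 'z) bimod_scheme" +
  assumes right_csubspace: "csubspace (bm_carrier M)"
    and right_complete: "complete (bm_carrier M)"
    and ract_closed: "\<lbrakk>b \<in> alg_carrier B; m \<in> bm_carrier M\<rbrakk> \<Longrightarrow> bm_ract M m b \<in> bm_carrier M"
    and ract_add_right: "\<lbrakk>b \<in> alg_carrier B; b' \<in> alg_carrier B; m \<in> bm_carrier M\<rbrakk> \<Longrightarrow>
      bm_ract M m (b + b') = bm_ract M m b + bm_ract M m b'"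
    and ract_add_left: "\<lbrakk>b \<in> alg_carrier B; m \<in> bm_carrier M; n \<in> bm_carrier M\<rbrakk> \<Longrightarrow>
      bm_ract M (m + n) b = bm_ract M m b + bm_ract M n b"
    and ract_scale_right: "\<lbrakk>b \<in> alg_carrier B; m \<in> bm_carrier M\<rbrakk> \<Longrightarrow>
      bm_ract M m (c *\<^sub>C b) = c *\<^sub>C bm_ract M m b"
    and ract_scale_left: "\<lbrakk>b \<in> alg_carrier B; m \<in> bm_carrier M\<rbrakk> \<Longrightarrow>
      bm_ract M (c *\<^sub>C m) b = c *\<^sub>C bm_ract M m b"
    and ract_mult: "\<lbrakk>b \<in> alg_carrier B; b' \<in> alg_carrier B; m \<in> bm_carrier M\<rbrakk> \<Longrightarrow>
      bm_ract M m (alg_mult B b b') = bm_ract M (bm_ract M m b) b'"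
    and rip_closed: "\<lbrakk>m \<in> bm_carrier M; n \<in> bm_carrier M\<rbrakk> \<Longrightarrow> bm_rip M m n \<in> alg_carrier B"
    and rip_add: "\<lbrakk>m \<in> bm_carrier M; n \<in> bm_carrier M; n' \<in> bm_carrier M\<rbrakk> \<Longrightarrow>
      bm_rip M m (n + n') = bm_rip M m n + bm_rip M m n'"
    and rip_scale: "\<lbrakk>m \<in> bm_carrier M; n \<in> bm_carrier M\<rbrakk> \<Longrightarrow>
      bm_rip M m (c *\<^sub>C n) = c *\<^sub>C bm_rip M m n"
    and rip_ract: "\<lbrakk>b \<in> alg_carrier B; m \<in> bm_carrier M; n \<in> bm_carrier M\<rbrakk> \<Longrightarrow>
      bm_rip M m (bm_ract M n b) = alg_mult B (bm_rip M m n) b"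
    and rip_star: "\<lbrakk>m \<in> bm_carrier M; n \<in> bm_carrier M\<rbrakk> \<Longrightarrow>
      alg_star B (bm_rip M m n) = bm_rip M n m"
    and rip_positive: "m \<in> bm_carrier M \<Longrightarrow> alg_positive B (bm_rip M m m)"
    and rip_norm: "m \<in> bm_carrier M \<Longrightarrow> norm (bm_rip M m m) = (norm m)\<^sup>2"

locale hilbert_bimodule =
  left_hilbert_module A M + right_hilbert_module B M
  for A :: "'a::complex_normed_vector star_alg"
    and B :: "'b::complex_normed_vector star_alg"
    and M :: "('a, 'b, 'm::complex_normed_vector, 'z) bimod_scheme" +
  assumes lact_ract: "\<lbrakk>a \<in> alg_carrier A; m \<in> bm_carrier M; b \<in> alg_carrier B\<rbrakk> \<Longrightarrow>
      bm_ract M (bm_lact M a m) b = bm_lact M a (bm_ract M m b)"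
    and lip_rip: "\<lbrakk>m \<in> bm_carrier M; n \<in> bm_carrier M; r \<in> bm_carrier M\<rbrakk> \<Longrightarrow>
      bm_lact M (bm_lip M m n) r = bm_ract M m (bm_rip M n r)"

text \<open>The predicate \<open>in_bounded_product\<close> says that \<open>a \<mapsto> (p t a)\<^sub>t\<close> identifies \<open>A\<close> with a linear
  subspace of the bounded product of the \<open>F t\<close>. Its last clause means
  \<open>norm a = (SUP t\<in>T. norm (p t a))\<close>, phrased so as to cover boundedness and empty \<open>T\<close>.\<close>

definition in_bounded_product ::
    "'t set \<Rightarrow> 'a::complex_normed_vector set \<Rightarrow> ('t \<Rightarrow> 'f::complex_normed_vector set) \<Rightarrow>
     ('t \<Rightarrow> 'a \<Rightarrow> 'f) \<Rightarrow> bool"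
  where "in_bounded_product T A F p \<longleftrightarrow>
    (\<forall>t\<in>T. \<forall>a\<in>A. p t a \<in> F t) \<and>
    (\<forall>t\<in>T. \<forall>a\<in>A. \<forall>b\<in>A. p t (a + b) = p t a + p t b) \<and>
    (\<forall>t\<in>T. \<forall>c. \<forall>a\<in>A. p t (c *\<^sub>C a) = c *\<^sub>C p t a) \<and>
    (\<forall>a\<in>A. \<forall>r\<ge>0. norm a \<le> r \<longleftrightarrow> (\<forall>t\<in>T. norm (p t a) \<le> r))"

definition continuous_functions_act ::
    "'t topology \<Rightarrow> 'a set \<Rightarrow> ('t \<Rightarrow> 'a \<Rightarrow> 'f::complex_normed_vector) \<Rightarrow> bool"
  where "continuous_functions_act T A p \<longleftrightarrow>
    (\<forall>f::'t \<Rightarrow> complex. continuous_map T euclidean f \<longrightarrow>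
      (\<forall>a\<in>A. \<exists>b\<in>A. \<forall>t\<in>topspace T. p t b = f t *\<^sub>C p t a))"

record ('t, 'a, 'f) alg_field =
  af_base :: "'t topology"
  af_total :: "'a star_alg"
  af_fibre :: "'t \<Rightarrow> 'f star_alg"
  af_proj :: "'t \<Rightarrow> 'a \<Rightarrow> 'f"

locale continuous_field_cstar =
  fixes \<A> :: "('t, 'a::complex_normed_vector, 'f::complex_normed_vector) alg_field"
  assumes base_compact: "compact_space (af_base \<A>)"
    and base_Hausdorff: "Hausdorff_space (af_base \<A>)"
    and total_cstar: "cstar_algebra (af_total \<A>)"
    and fibre_cstar: "t \<in> topspace (af_base \<A>) \<Longrightarrow> cstar_algebra (af_fibre \<A> t)"
    and total_product: "in_bounded_product (topspace (af_base \<A>)) (alg_carrier (af_total \<A>))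
      (\<lambda>t. alg_carrier (af_fibre \<A> t)) (af_proj \<A>)"
    and proj_mult: "\<lbrakk>t \<in> topspace (af_base \<A>); a \<in> alg_carrier (af_total \<A>);
      b \<in> alg_carrier (af_total \<A>)\<rbrakk> \<Longrightarrow>
      af_proj \<A> t (alg_mult (af_total \<A>) a b) =
        alg_mult (af_fibre \<A> t) (af_proj \<A> t a) (af_proj \<A> t b)"
    and proj_star: "\<lbrakk>t \<in> topspace (af_base \<A>); a \<in> alg_carrier (af_total \<A>)\<rbrakk> \<Longrightarrow>
      af_proj \<A> t (alg_star (af_total \<A>) a) = alg_star (af_fibre \<A> t) (af_proj \<A> t a)"
    and proj_surj: "t \<in> topspace (af_base \<A>) \<Longrightarrow>
      af_proj \<A> t ` alg_carrier (af_total \<A>) = alg_carrier (af_fibre \<A> t)"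
    and functions_act: "continuous_functions_act (af_base \<A>) (alg_carrier (af_total \<A>)) (af_proj \<A>)"
    and norm_continuous: "a \<in> alg_carrier (af_total \<A>) \<Longrightarrow>
      continuous_map (af_base \<A>) euclideanreal (\<lambda>t. norm (af_proj \<A> t a))"

record ('t, 'a, 'b, 'm, 'fa, 'fb, 'fm) bimod_field =
  bf_base :: "'t topology"
  bf_total :: "('a, 'b, 'm) bimod"
  bf_fibre :: "'t \<Rightarrow> ('fa, 'fb, 'fm) bimod"
  bf_proj :: "'t \<Rightarrow> 'm \<Rightarrow> 'fm"

locale continuous_field_bimodules =
  left: continuous_field_cstar \<A> + right: continuous_field_cstar \<B>
  for \<A> :: "('t, 'a::complex_normed_vector, 'fa::complex_normed_vector) alg_field"
    and \<B> :: "('t, 'b::complex_normed_vector, 'fb::complex_normed_vector) alg_field" +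
  fixes \<M> :: "('t, 'a, 'b, 'm::complex_normed_vector, 'fa, 'fb, 'fm::complex_normed_vector) bimod_field"
  assumes base_left: "af_base \<A> = bf_base \<M>"
    and base_right: "af_base \<B> = bf_base \<M>"
    and total_bimodule: "hilbert_bimodule (af_total \<A>) (af_total \<B>) (bf_total \<M>)"
    and fibre_bimodule: "t \<in> topspace (bf_base \<M>) \<Longrightarrow>
      hilbert_bimodule (af_fibre \<A> t) (af_fibre \<B> t) (bf_fibre \<M> t)"
    and bimodule_product: "in_bounded_product (topspace (bf_base \<M>)) (bm_carrier (bf_total \<M>))
      (\<lambda>t. bm_carrier (bf_fibre \<M> t)) (bf_proj \<M>)"
    and bimodule_functions_act:
      "continuous_functions_act (bf_base \<M>) (bm_carrier (bf_total \<M>)) (bf_proj \<M>)"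
    and bimodule_proj_surj: "t \<in> topspace (bf_base \<M>) \<Longrightarrow>
      bf_proj \<M> t ` bm_carrier (bf_total \<M>) = bm_carrier (bf_fibre \<M> t)"
    and proj_lact: "\<lbrakk>t \<in> topspace (bf_base \<M>); a \<in> alg_carrier (af_total \<A>);
      m \<in> bm_carrier (bf_total \<M>)\<rbrakk> \<Longrightarrow>
      bf_proj \<M> t (bm_lact (bf_total \<M>) a m) =
        bm_lact (bf_fibre \<M> t) (af_proj \<A> t a) (bf_proj \<M> t m)"
    and proj_ract: "\<lbrakk>t \<in> topspace (bf_base \<M>); b \<in> alg_carrier (af_total \<B>);
      m \<in> bm_carrier (bf_total \<M>)\<rbrakk> \<Longrightarrow>
      bf_proj \<M> t (bm_ract (bf_total \<M>) m b) =
        bm_ract (bf_fibre \<M> t) (bf_proj \<M> t m) (af_proj \<B> t b)"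
    and proj_lip: "\<lbrakk>t \<in> topspace (bf_base \<M>); m \<in> bm_carrier (bf_total \<M>);
      n \<in> bm_carrier (bf_total \<M>)\<rbrakk> \<Longrightarrow>
      af_proj \<A> t (bm_lip (bf_total \<M>) m n) =
        bm_lip (bf_fibre \<M> t) (bf_proj \<M> t m) (bf_proj \<M> t n)"
    and proj_rip: "\<lbrakk>t \<in> topspace (bf_base \<M>); m \<in> bm_carrier (bf_total \<M>);
      n \<in> bm_carrier (bf_total \<M>)\<rbrakk> \<Longrightarrow>
      af_proj \<B> t (bm_rip (bf_total \<M>) m n) =
        bm_rip (bf_fibre \<M> t) (bf_proj \<M> t m) (bf_proj \<M> t n)"


section \<open>The topology of a poset and its compactification\<close>

text \<open>As with \<open>order_topology\<close>, the class fixes the topology of an arbitrary partial order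
  with least element; the subbase consists of the sets \<open>U\<^sub>a = {a..}\<close> and their complements.\<close>

class poset_topology = order_bot + topological_space +
  assumes open_poset: "open = generate_topology (range (\<lambda>a. {b. a \<le> b}) \<union> range (\<lambda>a. - {b. a \<le> b}))"

lemma clopen_upset:
  fixes a :: "'p::poset_topology"
  shows "open {b. a \<le> b}" and "open (- {b. a \<le> b})"
  by (auto simp: open_poset intro!: generate_topology.Basis)

lemma bcontfun_two_step:
  fixes a :: "'p::poset_topology" and x y :: "'e::metric_space"
  shows "(\<lambda>b. if a \<le> b then x else y) \<in> bcontfun"
proof -
  have "continuous_on ({b. a \<le> b} \<union> - {b. a \<le> b}) (\<lambda>b. if a \<le> b then x else y)"
    using clopen_upset[of a]
    by (intro continuous_on_If) (auto simp: closed_def)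
  moreover have "bounded (range (\<lambda>b. if a \<le> b then x else y))"
    by (rule bounded_subset[of "{x, y}"]) auto
  ultimately show ?thesis
    by (simp add: bcontfun_def Un_def)
qed

text \<open>The function \<open>\<chi>\<^sub>a \<otimes> x\<close>: \<open>step_on a 1\<close> is \<open>\<chi>\<^sub>a\<close>, and \<open>step_on a s\<close> is \<open>\<chi>\<^bsub>s,a\<^esub>\<close>.\<close>

lift_definition step_on :: "'p::poset_topology \<Rightarrow> 'e::real_normed_vector \<Rightarrow> 'p \<Rightarrow>\<^sub>C 'e"
  is "\<lambda>a x b. if a \<le> b then x else 0"
  by (rule bcontfun_two_step)

lift_definition chi_compl :: "'p::poset_topology \<Rightarrow> 'p \<Rightarrow>\<^sub>C complex"
  is "\<lambda>a b. if a \<le> b then 0 else 1"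
  by (rule bcontfun_two_step)

lemma bcontfun_bilinear:
  assumes "bounded_bilinear h" "f \<in> bcontfun" "g \<in> bcontfun"
  shows "(\<lambda>x. h (f x) (g x)) \<in> bcontfun"
proof -
  interpret bounded_bilinear h by fact
  from assms(2) obtain F where F: "\<And>x. norm (f x) \<le> F"
    by (auto simp: bcontfun_def bounded_iff)
  from assms(3) obtain G where G: "\<And>x. norm (g x) \<le> G"
    by (auto simp: bcontfun_def bounded_iff)
  obtain K where K: "K \<ge> 0" "\<And>a b. norm (h a b) \<le> norm a * norm b * K"
    using nonneg_bounded by blast
  have "norm (h (f x) (g x)) \<le> F * G * K" for x
    using F[of x] G[of x] K
    by (intro order_trans[OF K(2)] mult_right_mono mult_mono) (auto intro: order_trans[OF norm_ge_zero])
  then have "bounded (range (\<lambda>x. h (f x) (g x)))"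
    by (auto simp: bounded_iff)
  then show ?thesis
    using assms(2,3) by (auto simp: bcontfun_def intro!: continuous_on)
qed

lift_definition bc_scale ::
    "('p::topological_space \<Rightarrow>\<^sub>C complex) \<Rightarrow> ('p \<Rightarrow>\<^sub>C 'e::complex_normed_vector) \<Rightarrow> ('p \<Rightarrow>\<^sub>C 'e)"
  is "\<lambda>f g b. f b *\<^sub>C g b"
  by (rule bcontfun_bilinear[OF bounded_bilinear_scaleC])

lift_definition bc_cnj :: "('p::topological_space \<Rightarrow>\<^sub>C complex) \<Rightarrow> ('p \<Rightarrow>\<^sub>C complex)"
  is "\<lambda>f b. cnj (f b)"
  by (auto simp: bcontfun_def bounded_iff intro: continuous_intros)

definition Cb_complex :: "('p::topological_space \<Rightarrow>\<^sub>C complex) star_alg"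
  where "Cb_complex = \<lparr>alg_carrier = UNIV, alg_mult = bc_scale, alg_star = bc_cnj\<rparr>"

definition C_P :: "('p::poset_topology \<Rightarrow>\<^sub>C complex) star_alg"
  where "C_P = generated_cstar Cb_complex (range (\<lambda>a. step_on a 1) \<union> range chi_compl)"

text \<open>Characters are normalised to be \<open>undefined\<close> off the algebra, so that
  \<open>product_topology\<close> over the algebra restricts to the weak-* topology.\<close>

definition characters :: "'a::complex_normed_vector star_alg \<Rightarrow> ('a \<Rightarrow> complex) set"
  where "characters A = {\<phi> \<in> extensional (alg_carrier A).
    (\<forall>x\<in>alg_carrier A. \<forall>y\<in>alg_carrier A. \<phi> (x + y) = \<phi> x + \<phi> y) \<and>
    (\<forall>c. \<forall>x\<in>alg_carrier A. \<phi> (c *\<^sub>C x) = c * \<phi> x) \<and>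
    (\<forall>x\<in>alg_carrier A. \<forall>y\<in>alg_carrier A. \<phi> (alg_mult A x y) = \<phi> x * \<phi> y) \<and>
    (\<exists>x\<in>alg_carrier A. \<phi> x \<noteq> 0)}"

definition gelfand_spectrum :: "'a::complex_normed_vector star_alg \<Rightarrow> ('a \<Rightarrow> complex) topology"
  where "gelfand_spectrum A =
    subtopology (product_topology (\<lambda>_. euclidean) (alg_carrier A)) (characters A)"

definition gammaP :: "(('p::poset_topology \<Rightarrow>\<^sub>C complex) \<Rightarrow> complex) topology"
  where "gammaP = gelfand_spectrum C_P"

definition point_eval :: "'p::poset_topology \<Rightarrow> ('p \<Rightarrow>\<^sub>C complex) \<Rightarrow> complex"
  where "point_eval u = (\<lambda>f\<in>alg_carrier C_P. apply_bcontfun f u)"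

text \<open>Since the point evaluations are dense in \<open>gammaP\<close>, the extension is unique on
  \<open>topspace gammaP\<close> whenever it exists.\<close>

definition extend_gammaP ::
    "('p::poset_topology \<Rightarrow>\<^sub>C 'e::real_normed_vector) \<Rightarrow> (('p \<Rightarrow>\<^sub>C complex) \<Rightarrow> complex) \<Rightarrow> 'e"
  where "extend_gammaP m = (SOME g. continuous_map gammaP euclidean g \<and>
    (\<forall>u. g (point_eval u) = apply_bcontfun m u))"


section \<open>The continuous fields determined by a family of ternary rings of operators\<close>

lift_definition bc_compose ::
    "('p::topological_space \<Rightarrow>\<^sub>C ('b::real_normed_vector \<Rightarrow>\<^sub>L 'c::real_normed_vector)) \<Rightarrow>
     ('p \<Rightarrow>\<^sub>C ('a::real_normed_vector \<Rightarrow>\<^sub>L 'b)) \<Rightarrow> ('p \<Rightarrow>\<^sub>C ('a \<Rightarrow>\<^sub>L 'c))" (infixl "o\<^sub>C" 67)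
  is "\<lambda>f g b. f b o\<^sub>L g b"
  by (rule bcontfun_bilinear[OF bounded_bilinear_blinfun_compose])

definition bc_adj ::
    "('p::topological_space \<Rightarrow>\<^sub>C ('a::chilbert_space \<Rightarrow>\<^sub>L 'b::chilbert_space)) \<Rightarrow> ('p \<Rightarrow>\<^sub>C ('b \<Rightarrow>\<^sub>L 'a))"
  where "bc_adj f = Bcontfun (\<lambda>b. adj (apply_bcontfun f b))"

definition Cb_ops ::
    "('p::topological_space \<Rightarrow>\<^sub>C ('a::complex_normed_vector \<Rightarrow>\<^sub>L 'b::complex_normed_vector)) set"
  where "Cb_ops = {f. \<forall>b. apply_bcontfun f b \<in> bounded_ops}"

text \<open>\<open>M\<close> is closed under multiplication by the functions in \<open>C = C(\<gamma>P)\<close>, not by all of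
  \<open>C\<^sub>b(P)\<close>: otherwise its elements would in general not extend to \<open>\<gamma>P\<close>. (For \<open>P = \<nat>\<close> and
  \<open>F u = \<complex>\<close> one would get all bounded sequences, whereas \<open>\<gamma>P = \<nat> \<union> {\<infinity>}\<close>.) If all elements
  do extend, the two versions of \<open>M\<close> coincide.\<close>

definition tro_total ::
    "('p::poset_topology \<Rightarrow> ('h1::chilbert_space \<Rightarrow>\<^sub>L 'h2::chilbert_space) set) \<Rightarrow>
     ('p \<Rightarrow>\<^sub>C ('h1 \<Rightarrow>\<^sub>L 'h2)) set"
  where "tro_total F = \<Inter>{S. S \<subseteq> Cb_ops \<and> csubspace S \<and> closed S \<and>
    (\<forall>a. \<forall>s\<in>F a. step_on a s \<in> S) \<and>
    (\<forall>m\<in>S. \<forall>n\<in>S. \<forall>r\<in>S. m o\<^sub>C bc_adj n o\<^sub>C r \<in> S) \<and>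
    (\<forall>f\<in>alg_carrier C_P. \<forall>m\<in>S. bc_scale f m \<in> S)}"

definition tro_fibre ::
    "('p::poset_topology \<Rightarrow> ('h1::chilbert_space \<Rightarrow>\<^sub>L 'h2::chilbert_space) set) \<Rightarrow>
     (('p \<Rightarrow>\<^sub>C complex) \<Rightarrow> complex) \<Rightarrow> ('h1 \<Rightarrow>\<^sub>L 'h2) set"
  where "tro_fibre F v = (\<lambda>m. extend_gammaP m v) ` tro_total F"

definition tro_bimod ::
    "('h1::chilbert_space \<Rightarrow>\<^sub>L 'h2::chilbert_space) set \<Rightarrow> ('h2 \<Rightarrow>\<^sub>L 'h2, 'h1 \<Rightarrow>\<^sub>L 'h1, 'h1 \<Rightarrow>\<^sub>L 'h2) bimod"
  where "tro_bimod N = \<lparr>bm_carrier = N, bm_lact = (\<lambda>a m. a o\<^sub>L m), bm_ract = (\<lambda>m b. m o\<^sub>L b),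
    bm_lip = (\<lambda>m n. m o\<^sub>L adj n), bm_rip = (\<lambda>m n. adj m o\<^sub>L n)\<rparr>"

definition tro_field ::
    "('p::poset_topology \<Rightarrow> ('h1::chilbert_space \<Rightarrow>\<^sub>L 'h2::chilbert_space) set) \<Rightarrow>
     (('p \<Rightarrow>\<^sub>C complex) \<Rightarrow> complex, 'p \<Rightarrow>\<^sub>C ('h2 \<Rightarrow>\<^sub>L 'h2), 'p \<Rightarrow>\<^sub>C ('h1 \<Rightarrow>\<^sub>L 'h1),
      'p \<Rightarrow>\<^sub>C ('h1 \<Rightarrow>\<^sub>L 'h2), 'h2 \<Rightarrow>\<^sub>L 'h2, 'h1 \<Rightarrow>\<^sub>L 'h1, 'h1 \<Rightarrow>\<^sub>L 'h2) bimod_field"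
  where "tro_field F = \<lparr>bf_base = gammaP,
    bf_total = \<lparr>bm_carrier = tro_total F, bm_lact = (\<lambda>a m. a o\<^sub>C m), bm_ract = (\<lambda>m b. m o\<^sub>C b),
      bm_lip = (\<lambda>m n. m o\<^sub>C bc_adj n), bm_rip = (\<lambda>m n. bc_adj m o\<^sub>C n)\<rparr>,
    bf_fibre = (\<lambda>v. tro_bimod (tro_fibre F v)),
    bf_proj = (\<lambda>v m. extend_gammaP m v)\<rparr>"

definition left_alg :: "('h1::chilbert_space \<Rightarrow>\<^sub>L 'h2::chilbert_space) set \<Rightarrow> ('h2 \<Rightarrow>\<^sub>L 'h2) set"
  where "left_alg N = closed_cspan {m o\<^sub>L adj n |m n. m \<in> N \<and> n \<in> N}"

definition right_alg :: "('h1::chilbert_space \<Rightarrow>\<^sub>L 'h2::chilbert_space) set \<Rightarrow> ('h1 \<Rightarrow>\<^sub>L 'h1) set"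
  where "right_alg N = closed_cspan {adj m o\<^sub>L n |m n. m \<in> N \<and> n \<in> N}"

text \<open>The algebra generated by the \<open>\<chi>\<^sub>u \<otimes> a\<close> with \<open>a \<in> D u\<close>, with fibres \<open>E v\<close> and evaluations
  as projections. That evaluation at \<open>v\<close> maps the algebra onto \<open>E v\<close>, and that the algebra is a
  module over the continuous functions on \<open>\<gamma>P\<close>, is not built in; it is part of
  \<open>continuous_field_cstar\<close>.\<close>

definition alg_field_of ::
    "('p::poset_topology \<Rightarrow> ('h::chilbert_space \<Rightarrow>\<^sub>L 'h) set) \<Rightarrow>
     ((('p \<Rightarrow>\<^sub>C complex) \<Rightarrow> complex) \<Rightarrow> ('h \<Rightarrow>\<^sub>L 'h) set) \<Rightarrow>
     (('p \<Rightarrow>\<^sub>C complex) \<Rightarrow> complex, 'p \<Rightarrow>\<^sub>C ('h \<Rightarrow>\<^sub>L 'h), 'h \<Rightarrow>\<^sub>L 'h) alg_field"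
  where "alg_field_of D E = \<lparr>af_base = gammaP,
    af_total = generated_cstar \<lparr>alg_carrier = Cb_ops, alg_mult = (o\<^sub>C), alg_star = bc_adj\<rparr>
      {step_on u a |u a. a \<in> D u},
    af_fibre = (\<lambda>v. \<lparr>alg_carrier = E v, alg_mult = (o\<^sub>L), alg_star = adj\<rparr>),
    af_proj = (\<lambda>v a. extend_gammaP a v)\<rparr>"

definition left_field ::
    "('p::poset_topology \<Rightarrow> ('h1::chilbert_space \<Rightarrow>\<^sub>L 'h2::chilbert_space) set) \<Rightarrow>
     (('p \<Rightarrow>\<^sub>C complex) \<Rightarrow> complex, 'p \<Rightarrow>\<^sub>C ('h2 \<Rightarrow>\<^sub>L 'h2), 'h2 \<Rightarrow>\<^sub>L 'h2) alg_field"
  where "left_field F = alg_field_of (\<lambda>u. left_alg (F u)) (\<lambda>v. left_alg (tro_fibre F v))"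

definition right_field ::
    "('p::poset_topology \<Rightarrow> ('h1::chilbert_space \<Rightarrow>\<^sub>L 'h2::chilbert_space) set) \<Rightarrow>
     (('p \<Rightarrow>\<^sub>C complex) \<Rightarrow> complex, 'p \<Rightarrow>\<^sub>C ('h1 \<Rightarrow>\<^sub>L 'h1), 'h1 \<Rightarrow>\<^sub>L 'h1) alg_field"
  where "right_field F = alg_field_of (\<lambda>u. right_alg (F u)) (\<lambda>v. right_alg (tro_fibre F v))"

end

theory Submission
  imports Defs
begin

text \<open>The idempotents of \<open>C\<close> separate points of \<open>\<gamma>P\<close> from closed sets, so that \<open>P\<close> is dense in
  \<open>\<gamma>P\<close> and a closed \<open>C\<close>-module of extendable functions contains every extendable function
  whose values lie in its fibres: glue local approximants along a finite clopen cover. The same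
  idempotents lift points of a fibre to sections of almost the same norm, whence the fibres of
  \<open>M\<close> are closed, that is, they are ternary rings of operators. As the fibres of \<open>\<A>\<close> and \<open>\<B>\<close>
  are the algebras \<open>A\<^sub>v\<close> and \<open>B\<^sub>v\<close>, the inclusions \<open>A M \<subseteq> M\<close>, \<open>M M\<^sup>* \<subseteq> A\<close> and \<open>C(\<gamma>P) M \<subseteq> M\<close>
  can be checked pointwise. Positivity of \<open>m m\<^sup>*\<close> inside the algebras comes from a square root
  that is a norm limit of elements of the algebra.\<close>

text \<open>The elements of \<open>tro_total\<close> and of the generated algebras are known only
  through intersections of closed sets, so an inclusion such as A M in M has no general element to
  compute with; this forces the detour through fibres. The detour works because \<gamma>P is totally
  disconnected: cutting off by an idempotent never increases a norm, and gluing needs no partition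
  of unity. The Gelfand isomorphism is replaced by two estimates: a function in \<open>C_P\<close>
  is nearly equal to its value at a character on the set where some idempotent is 1
  (\<open>char_approx_ex\<close>), and a function nearly constant on such a set has nearly that
  value at the character (\<open>char_approx_le\<close>). The assumptions on
  \<open>left_field\<close> and \<open>right_field\<close> supply the compactness of \<gamma>P, the
  axioms of the C*-algebras, the action of C(\<gamma>P) on A and B, and the surjectivity that
  identifies their fibres. For positivity the obstacle is the unit: the algebras need not contain
  one, while the iteration for the square root starts from it.\<close>

lemmas scaleC_zero_left [simp] = bounded_bilinear.zero_left[OF bounded_bilinear_scaleC]
  and scaleC_zero_right [simp] = bounded_bilinear.zero_right[OF bounded_bilinear_scaleC]
  and scaleC_minus_left = bounded_bilinear.minus_left[OF bounded_bilinear_scaleC]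

lemma scaleC_one [simp]: "1 *\<^sub>C x = (x :: 'a::complex_normed_vector)"
  by (metis of_real_1 scaleR_one scaleR_scaleC)

lemma csubspace_imp_subspace: "csubspace S \<Longrightarrow> subspace S"
  by (auto simp: csubspace_def subspace_def scaleR_scaleC)

lemma csubspace_diff: "csubspace S \<Longrightarrow> x \<in> S \<Longrightarrow> y \<in> S \<Longrightarrow> x - y \<in> S"
  by (rule subspace_diff[OF csubspace_imp_subspace])

section \<open>Adjoints in complex Hilbert spaces\<close>

lemma cinner_add_right: "cinner x (y + z) = cinner x y + cinner x (z :: 'a::chilbert_space)"
  by (metis cinner_add_left cinner_commute complex_cnj_add)

lemma cinner_scaleC_right: "cinner x (c *\<^sub>C y) = cnj c * cinner x (y :: 'a::chilbert_space)"
  by (metis cinner_scaleC_left cinner_commute complex_cnj_mult)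

lemma cinner_scaleR_left: "cinner (r *\<^sub>R x) y = of_real r * cinner x (y :: 'a::chilbert_space)"
  by (simp add: scaleR_scaleC cinner_scaleC_left)

lemma cinner_scaleR_right: "cinner x (r *\<^sub>R y) = of_real r * cinner x (y :: 'a::chilbert_space)"
  by (simp add: scaleR_scaleC cinner_scaleC_right)

lemma cinner_minus_left: "cinner (- x) y = - cinner x (y :: 'a::chilbert_space)"
  using cinner_scaleR_left[of "-1" x y] by simp

lemma cinner_minus_right: "cinner x (- y) = - cinner x (y :: 'a::chilbert_space)"
  using cinner_scaleR_right[of x "-1" y] by simp

lemma cinner_diff_left: "cinner (x - y) z = cinner x z - cinner y (z :: 'a::chilbert_space)"
  using cinner_add_left[of x "- y" z] by (simp add: cinner_minus_left)

lemma cinner_diff_right: "cinner x (y - z) = cinner x y - cinner x (z :: 'a::chilbert_space)"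
  using cinner_add_right[of x y "- z"] by (simp add: cinner_minus_right)

lemma norm_add_sq:
  "(norm (x + y))\<^sup>2 = (norm x)\<^sup>2 + (norm y)\<^sup>2 + 2 * Re (cinner x (y :: 'a::chilbert_space))"
proof -
  have "complex_of_real ((norm (x + y))\<^sup>2) =
      of_real ((norm x)\<^sup>2) + of_real ((norm y)\<^sup>2) + (cinner x y + cnj (cinner x y))"
    unfolding cinner_self[symmetric]
    by (simp add: cinner_add_left cinner_add_right cinner_commute[of y x])
  then show ?thesis
    by (simp add: complex_add_cnj flip: of_real_add of_real_power del: of_real_mult)
qed

lemma norm_diff_sq:
  "(norm (x - y))\<^sup>2 = (norm x)\<^sup>2 + (norm y)\<^sup>2 - 2 * Re (cinner x (y :: 'a::chilbert_space))"
  using norm_add_sq[of x "- y"] by (simp add: cinner_minus_right)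

text \<open>The norm is given in advance, so its triangle inequality may be used: expanding the
  square of \<open>norm (x + y)\<close> bounds the real part, and a rotation of \<open>x\<close>
  turns the real part into the modulus.\<close>

lemma Cauchy_Schwarz_cinner: "cmod (cinner x y) \<le> norm x * norm (y :: 'a::chilbert_space)"
proof (cases "cinner x y = 0")
  case False
  have Re: "Re (cinner x y) \<le> norm x * norm y" for x y :: 'a
  proof -
    have "(norm (x + y))\<^sup>2 \<le> (norm x + norm y)\<^sup>2"
      by (intro power_mono norm_triangle_ineq) auto
    then show ?thesis
      by (simp add: norm_add_sq power2_sum)
  qed
  define z where "z = cinner x y"
  \<comment> \<open>The unimodular scalar that makes the inner product of
    \<open>c *\<^sub>C x\<close> and \<open>y\<close> real and nonnegative.\<close>
  define c where "c = cnj z / of_real (cmod z)"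
  have z: "z \<noteq> 0" using False by (simp add: z_def)
  have "cinner (c *\<^sub>C x) y = of_real (cmod z)"
    using z complex_norm_square[of z]
    by (simp add: cinner_scaleC_left c_def z_def[symmetric] mult.commute power2_eq_square field_simps)
  moreover have "cmod c = 1"
    using z by (simp add: c_def norm_divide)
  ultimately show ?thesis
    using Re[of "c *\<^sub>C x" y] by (simp add: norm_scaleC z_def)
qed simp

lemma cinner_right_eqI:
  assumes "\<And>x. cinner x y = cinner x z" shows "y = (z :: 'a::chilbert_space)"
proof -
  have "cinner (y - z) (y - z) = 0"
    using assms by (simp add: cinner_diff_right)
  then show ?thesis by (simp add: cinner_self)
qed

text \<open>The representing vector minimises \<open>norm x ^ 2 - 2 * Re (f x)\<close>.\<close>

lemma riesz_representation:
  fixes f :: "'a::chilbert_space \<Rightarrow> complex"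
  assumes f: "bounded_linear f" and fC: "\<And>c x. f (c *\<^sub>C x) = c * f x"
  shows "\<exists>z. \<forall>x. f x = cinner x z"
proof -
  interpret bounded_linear f by fact
  define J where "J x = (norm x)\<^sup>2 - 2 * Re (f x)" for x
  obtain K where K: "\<And>x. cmod (f x) \<le> norm x * K"
    using bounded by blast
  have below: "- K\<^sup>2 \<le> J x" for x
  proof -
    have "Re (f x) \<le> norm x * K"
      using K[of x] complex_Re_le_cmod[of "f x"] by linarith
    moreover have "0 \<le> (norm x - K)\<^sup>2" by simp
    ultimately show ?thesis
      unfolding J_def power2_diff by linarith
  qed
  define I where "I = Inf (range J)"
  have bdd: "bdd_below (range J)"
    using below by (auto simp: bdd_below_def)
  have I: "I \<le> J x" for x
    unfolding I_def using bdd by (rule cInf_lower[rotated]) auto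
  have "\<exists>x. J x < I + inverse (real (Suc n))" for n
    using cInf_lessD[of "range J" "I + inverse (real (Suc n))"] by (auto simp: I_def)
  then obtain X where X: "\<And>n. J (X n) < I + inverse (real (Suc n))" by metis
  \<comment> \<open>Parallelogram law for \<open>J\<close>: the linear terms cancel. Two almost
    minimal points are therefore close, because their midpoint cannot lie below the infimum
    \<open>I\<close>.\<close>
  have par: "(norm (x - y))\<^sup>2 = 2 * (J x + J y - 2 * J ((1/2) *\<^sub>R (x + y)))" for x y
  proof -
    have "(norm ((1/2) *\<^sub>R (x + y)))\<^sup>2 = (norm (x + y))\<^sup>2 / 4"
      unfolding norm_scaleR by (simp add: power_divide)
    moreover have "Re (f ((1/2) *\<^sub>R (x + y))) = (Re (f x) + Re (f y)) / 2"
      unfolding scaleR add by simp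
    ultimately show ?thesis
      unfolding J_def using norm_add_sq[of x y] norm_diff_sq[of x y] by argo
  qed
  have "Cauchy X"
  proof (rule metric_CauchyI)
    fix e :: real assume "e > 0"
    then obtain N where N: "inverse (real (Suc N)) < e\<^sup>2 / 4"
      using reals_Archimedean[of "e\<^sup>2 / 4"] by auto
    have "dist (X m) (X n) < e" if "m \<ge> N" "n \<ge> N" for m n
    proof -
      have "J (X k) < I + e\<^sup>2 / 4" if "k \<ge> N" for k
        using X[of k] N le_imp_inverse_le[of "real (Suc N)" "real (Suc k)"] that by linarith
      from this[OF that(1)] this[OF that(2)] have "(norm (X m - X n))\<^sup>2 < e\<^sup>2"
        using I[of "(1/2) *\<^sub>R (X m + X n)"] unfolding par by argo
      then show ?thesis
        using \<open>e > 0\<close> by (simp add: dist_norm power2_less_imp_less)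
    qed
    then show "\<exists>M. \<forall>m\<ge>M. \<forall>n\<ge>M. dist (X m) (X n) < e" by blast
  qed
  then obtain z where z: "X \<longlonglongrightarrow> z"
    using Cauchy_convergent convergentD by blast
  have "(\<lambda>n. J (X n)) \<longlonglongrightarrow> J z"
    unfolding J_def by (intro tendsto_intros z tendsto)
  moreover have "(\<lambda>n. I + inverse (real (Suc n))) \<longlonglongrightarrow> I + 0"
    by (intro tendsto_intros LIMSEQ_inverse_real_of_nat)
  ultimately have Jz: "J z \<le> I"
    using X by (intro LIMSEQ_le[where X = "\<lambda>n. J (X n)"]) (auto intro: less_imp_le)
  have Re: "Re (f h) = Re (cinner h z)" for h
  proof -
    define a where "a = (norm h)\<^sup>2"
    define b where "b = Re (cinner h z) - Re (f h)"
    have a: "a \<ge> 0" by (simp add: a_def)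
    have quad: "0 \<le> t\<^sup>2 * a + 2 * t * b" for t
    proof -
      have "J z \<le> J (z + t *\<^sub>R h)"
        using Jz I[of "z + t *\<^sub>R h"] by linarith
      then show ?thesis
        unfolding J_def norm_add_sq
        by (simp add: a_def b_def add scaleR power_mult_distrib cinner_scaleR_right
            cinner_commute[of z h] algebra_simps)
    qed
    \<comment> \<open>The minimum of the quadratic is at \<open>- b / a\<close>; the shift to
      \<open>a + 1\<close> avoids a division by zero for \<open>h = 0\<close> and still gives a
      negative value unless \<open>b = 0\<close>.\<close>
    have "0 \<le> (- b / (a + 1))\<^sup>2 * a + 2 * (- b / (a + 1)) * b" by (rule quad)
    also have "\<dots> = - (b\<^sup>2 * (a + 2)) / (a + 1)\<^sup>2"
      using a by (simp add: field_simps power2_eq_square add_nonneg_eq_0_iff)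
    finally have "b\<^sup>2 * (a + 2) \<le> 0"
      using a by (simp add: divide_le_0_iff zero_less_power)
    then have "b = 0"
      using a by (simp add: mult_le_0_iff) 
    then show ?thesis by (simp add: b_def)
  qed
  \<comment> \<open>The real part at \<open>\<i> *\<^sub>C h\<close> is minus the imaginary part at
    \<open>h\<close>.\<close>
  have "f h = cinner h z" for h
    using Re[of h] Re[of "\<i> *\<^sub>C h"] by (simp add: fC cinner_scaleC_left complex_eq_iff)
  then show ?thesis by blast
qed

lemma bounded_ops_apply: "T \<in> bounded_ops \<Longrightarrow> blinfun_apply T (c *\<^sub>C x) = c *\<^sub>C blinfun_apply T x"
  by (simp add: bounded_ops_def)

lemma scaleC_blinfun_apply [simp]: "blinfun_apply (c *\<^sub>C T) x = c *\<^sub>C blinfun_apply T x"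
  by (simp add: scaleC_blinfun.rep_eq)

lemma bounded_ops_compose: "S \<in> bounded_ops \<Longrightarrow> T \<in> bounded_ops \<Longrightarrow> S o\<^sub>L T \<in> bounded_ops"
  by (simp add: bounded_ops_def)

lemma csubspace_bounded_ops: "csubspace bounded_ops"
  by (auto simp: csubspace_def bounded_ops_def blinfun.add_left scaleC_add_right scaleC_scaleC
      mult.commute)

lemma closed_bounded_ops: "closed bounded_ops"
  unfolding bounded_ops_def
  by (intro closed_Collect_all closed_Collect_eq continuous_intros
      bounded_linear.continuous_on[OF bounded_linear_scaleC_right])

text \<open>Riesz representation of the functional that sends \<open>x\<close> to the inner product
  of \<open>T x\<close> with \<open>y\<close>. Additivity and homogeneity of \<open>S\<close> follow
  from uniqueness of the representing vector.\<close>

lemma adjoint_exists: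
  fixes T :: "'a::chilbert_space \<Rightarrow>\<^sub>L 'b::chilbert_space"
  assumes "T \<in> bounded_ops"
  shows "\<exists>S :: 'b \<Rightarrow>\<^sub>L 'a. \<forall>x y. cinner (T x) y = cinner x (S y)"
proof -
  have "\<exists>z. \<forall>x. cinner (T x) y = cinner x z" for y
  proof (rule riesz_representation)
    show "bounded_linear (\<lambda>x. cinner (T x) y)"
    proof (rule bounded_linear_intro[where K = "norm T * norm y"])
      fix x
      have "cmod (cinner (T x) y) \<le> norm (T x) * norm y" by (rule Cauchy_Schwarz_cinner)
      also have "\<dots> \<le> norm T * norm x * norm y" by (intro mult_right_mono norm_blinfun) auto
      finally show "cmod (cinner (T x) y) \<le> norm x * (norm T * norm y)" by (simp add: ac_simps)
    qed (simp_all add: blinfun.add_right blinfun.scaleR_right cinner_add_left cinner_scaleR_left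
        scaleR_conv_of_real)
  qed (simp add: bounded_ops_apply[OF assms] cinner_scaleC_left)
  then obtain S where S: "\<And>x y. cinner (T x) y = cinner x (S y)" by metis
  have "bounded_linear S"
  proof (rule bounded_linear_intro[where K = "norm T"])
    fix y z r
    show "S (y + z) = S y + S z"
      by (rule cinner_right_eqI) (simp add: cinner_add_right flip: S)
    show "S (r *\<^sub>R y) = r *\<^sub>R S y"
      by (rule cinner_right_eqI) (simp add: cinner_scaleR_right flip: S)
    \<comment> \<open>The defining identity at \<open>x = S y\<close>; one factor
      \<open>norm (S y)\<close> cancels afterwards.\<close>
    have "(norm (S y))\<^sup>2 = cmod (cinner (T (S y)) y)"
      by (simp add: S cinner_self norm_power del: of_real_power)
    also have "\<dots> \<le> norm (T (S y)) * norm y" by (rule Cauchy_Schwarz_cinner)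
    also have "\<dots> \<le> norm T * norm (S y) * norm y" by (intro mult_right_mono norm_blinfun) auto
    finally have "norm (S y) * norm (S y) \<le> norm (S y) * (norm y * norm T)"
      by (simp add: power2_eq_square ac_simps)
    then show "norm (S y) \<le> norm y * norm T"
      by (cases "S y = 0") auto
  qed
  then have "\<forall>x y. cinner (T x) y = cinner x (Blinfun S y)"
    by (simp add: bounded_linear_Blinfun_apply S)
  then show ?thesis by blast
qed

text \<open>The rules for \<open>adj\<close> rest on this: a candidate that satisfies the identity
  settles existence, and uniqueness needs no linearity over the complex numbers.\<close>

lemma adj_eqI:
  "(\<And>x y. cinner (blinfun_apply T x) y = cinner x (blinfun_apply S y)) \<Longrightarrow> adj T = S"
  unfolding adj_def by (rule the_equality) (blast, metis blinfun_eqI cinner_right_eqI)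

lemma cinner_adj: "T \<in> bounded_ops \<Longrightarrow> cinner (blinfun_apply T x) y = cinner x (blinfun_apply (adj T) y)"
proof -
  assume "T \<in> bounded_ops"
  then obtain S where S: "\<And>x y. cinner (blinfun_apply T x) y = cinner x (blinfun_apply S y)"
    using adjoint_exists by blast
  then show ?thesis using adj_eqI[of T S] by simp
qed

lemma cinner_adj': "T \<in> bounded_ops \<Longrightarrow> cinner x (blinfun_apply T y) = cinner (blinfun_apply (adj T) x) y"
  using cinner_adj[of T y x] cinner_commute[of x "T y"] cinner_commute[of "adj T x" y] by simp

lemma adj_bounded_ops [simp]: "T \<in> bounded_ops \<Longrightarrow> adj T \<in> bounded_ops"
  unfolding bounded_ops_def mem_Collect_eq
proof (intro allI cinner_right_eqI)
  fix c x z
  assume "\<forall>c x. blinfun_apply T (c *\<^sub>C x) = c *\<^sub>C blinfun_apply T x"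
  then have "T \<in> bounded_ops" by (simp add: bounded_ops_def)
  from cinner_adj[OF this] show "cinner z (adj T (c *\<^sub>C x)) = cinner z (c *\<^sub>C adj T x)"
    by (metis cinner_scaleC_right)
qed

lemma adj_adj: "T \<in> bounded_ops \<Longrightarrow> adj (adj T) = T"
  by (rule adj_eqI) (simp add: cinner_adj')

lemma adj_add: "S \<in> bounded_ops \<Longrightarrow> T \<in> bounded_ops \<Longrightarrow> adj (S + T) = adj S + adj T"
  by (rule adj_eqI) (simp add: blinfun.add_left cinner_add_left cinner_add_right cinner_adj)

lemma adj_diff: "S \<in> bounded_ops \<Longrightarrow> T \<in> bounded_ops \<Longrightarrow> adj (S - T) = adj S - adj T"
  by (rule adj_eqI) (simp add: blinfun.diff_left cinner_diff_left cinner_diff_right cinner_adj)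

lemma adj_scaleC: "T \<in> bounded_ops \<Longrightarrow> adj (c *\<^sub>C T) = cnj c *\<^sub>C adj T"
  by (rule adj_eqI) (simp add: cinner_scaleC_left cinner_scaleC_right cinner_adj)

lemma adj_compose:
  "S \<in> bounded_ops \<Longrightarrow> T \<in> bounded_ops \<Longrightarrow> adj (S o\<^sub>L T) = adj T o\<^sub>L adj S"
  by (rule adj_eqI) (simp add: cinner_adj)

lemma adj_zero [simp]: "adj 0 = 0"
  by (rule adj_eqI) (simp add: cinner_scaleR_left[of 0, simplified] cinner_scaleR_right[of _ 0, simplified])

lemma norm_sq_le_adj_compose:
  fixes T :: "'a::chilbert_space \<Rightarrow>\<^sub>L 'b::chilbert_space"
  assumes T: "T \<in> bounded_ops"
  shows "(norm T)\<^sup>2 \<le> norm (adj T o\<^sub>L T)"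
proof -
  have "norm T \<le> sqrt (norm (adj T o\<^sub>L T))"
  proof (rule norm_blinfun_bound)
    fix x
    have "(norm (T x))\<^sup>2 = cmod (cinner x ((adj T o\<^sub>L T) x))"
      by (simp add: cinner_self norm_power del: of_real_power flip: cinner_adj[OF T])
    also have "\<dots> \<le> norm x * norm ((adj T o\<^sub>L T) x)"
      by (rule Cauchy_Schwarz_cinner)
    also have "\<dots> \<le> norm x * (norm (adj T o\<^sub>L T) * norm x)"
      by (intro mult_left_mono norm_blinfun) auto
    finally have "sqrt ((norm (T x))\<^sup>2) \<le> sqrt (norm (adj T o\<^sub>L T) * (norm x)\<^sup>2)"
      by (intro real_sqrt_le_mono) (simp add: power2_eq_square ac_simps)
    then show "norm (T x) \<le> sqrt (norm (adj T o\<^sub>L T)) * norm x"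
      by (simp add: real_sqrt_mult)
  qed simp
  then have "(norm T)\<^sup>2 \<le> (sqrt (norm (adj T o\<^sub>L T)))\<^sup>2"
    by (intro power_mono) auto
  then show ?thesis by simp
qed

text \<open>Submultiplicativity turns the inequality \<open>norm_sq_le_adj_compose\<close> into one
  between the norms of \<open>T\<close> and \<open>adj T\<close>, after cancelling a factor;
  applying it to \<open>adj T\<close> gives the converse.\<close>

lemma norm_adj:
  fixes T :: "'a::chilbert_space \<Rightarrow>\<^sub>L 'b::chilbert_space"
  assumes "T \<in> bounded_ops" shows "norm (adj T) = norm T"
proof (rule antisym)
  show "norm T \<le> norm (adj T)"
    using order_trans[OF norm_sq_le_adj_compose[OF assms] norm_blinfun_compose]
    by (cases "T = 0") (auto simp: power2_eq_square)
  show "norm (adj T) \<le> norm T"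
    using order_trans[OF norm_sq_le_adj_compose[of "adj T"] norm_blinfun_compose] assms
    by (cases "adj T = 0") (auto simp: power2_eq_square adj_adj)
qed

lemma norm_adj_compose: "T \<in> bounded_ops \<Longrightarrow> norm (adj T o\<^sub>L T) = (norm T)\<^sup>2"
  using norm_sq_le_adj_compose[of T] norm_blinfun_compose[of "adj T" T]
  by (simp add: power2_eq_square norm_adj)

lemma norm_compose_adj: "T \<in> bounded_ops \<Longrightarrow> norm (T o\<^sub>L adj T) = (norm T)\<^sup>2"
  using norm_adj_compose[of "adj T"] by (simp add: adj_adj norm_adj)

lemma continuous_on_adj:
  "continuous_on bounded_ops (adj :: ('a::chilbert_space \<Rightarrow>\<^sub>L 'b::chilbert_space) \<Rightarrow> _)"
proof (rule continuous_onI)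
  fix S :: "'a \<Rightarrow>\<^sub>L 'b" and e :: real assume "S \<in> bounded_ops" "e > 0"
  then show "\<exists>d>0. \<forall>T\<in>bounded_ops. dist T S < d \<longrightarrow> dist (adj T) (adj S) \<le> e"
    by (intro exI[of _ e])
      (auto simp: dist_norm norm_adj csubspace_diff[OF csubspace_bounded_ops]
        simp flip: adj_diff)
qed

text \<open>Supplies the start condition of the square root iteration without spectral theory. With
  \<open>y = adj T x\<close>, the expanded square of \<open>norm (x - T y)\<close> contains minus
  twice the square of \<open>norm y\<close>, which outweighs the square of
  \<open>norm (T y)\<close>.\<close>

lemma norm_id_diff_compose_adj:
  fixes T :: "'a::chilbert_space \<Rightarrow>\<^sub>L 'b::chilbert_space"
  assumes T: "T \<in> bounded_ops" and "norm T \<le> 1"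
  shows "norm (id_blinfun - (T o\<^sub>L adj T)) \<le> 1"
proof (rule norm_blinfun_bound)
  fix x
  define y where "y = adj T x"
  have "norm (T y) \<le> norm T * norm y" by (rule norm_blinfun)
  also have "\<dots> \<le> 1 * norm y" using assms(2) by (intro mult_right_mono) auto
  finally have Ty: "(norm (T y))\<^sup>2 \<le> (norm y)\<^sup>2" by (intro power_mono) auto
  have "Re (cinner x (T y)) = (norm y)\<^sup>2"
    using cinner_adj'[OF T, of x y] by (simp add: y_def[symmetric] cinner_self)
  then have "(norm (x - T y))\<^sup>2 = (norm x)\<^sup>2 + (norm (T y))\<^sup>2 - 2 * (norm y)\<^sup>2"
    by (simp add: norm_diff_sq)
  also have "\<dots> \<le> (norm x)\<^sup>2" using Ty zero_le_power2[of "norm y"] by linarith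
  finally show "norm (blinfun_apply (id_blinfun - (T o\<^sub>L adj T)) x) \<le> 1 * norm x"
    using power2_le_imp_le[of "norm (x - T y)" "norm x"]
    by (simp only: blinfun.diff_left id_blinfun.rep_eq blinfun_apply_blinfun_compose y_def[symmetric]
        norm_ge_zero mult_1)
qed simp

section \<open>Square roots\<close>

text \<open>The bounds telescope. It serves both the square root iteration and the series of lifts
  in \<open>closed_fibre\<close>.\<close>

lemma Cauchy_dominated:
  fixes x :: "nat \<Rightarrow> 'a::real_normed_vector" and s :: "nat \<Rightarrow> real"
  assumes le: "\<And>n. norm (x (Suc n) - x n) \<le> s (Suc n) - s n" and "convergent s"
  shows "Cauchy x"
proof (rule metric_CauchyI)
  have diff: "norm (x (n + k) - x n) \<le> s (n + k) - s n" for n k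
  proof (induction k)
    case (Suc k)
    then show ?case
      using le[of "n + k"] norm_triangle_ineq[of "x (n + k) - x n" "x (Suc (n + k)) - x (n + k)"]
      by simp
  qed simp
  fix r :: real assume "r > 0"
  then obtain N where N: "\<And>m n. m \<ge> N \<Longrightarrow> n \<ge> N \<Longrightarrow> dist (s m) (s n) < r"
    using convergent_Cauchy[OF assms(2)] by (meson metric_CauchyD)
  have "dist (x m) (x n) < r" if "N \<le> n" "n \<le> m" for m n
    using diff[of n "m - n"] N[of m n] that by (simp add: dist_norm)
  then show "\<exists>N. \<forall>m\<ge>N. \<forall>n\<ge>N. dist (x m) (x n) < r"
    by (metis dist_commute nle_le)
qed

text \<open>Newton-like iteration \<open>S \<mapsto> S + (T - S\<^sup>2) / 2\<close> from \<open>S\<^sub>0 = e\<close>. In terms of \<open>y = e - S\<close> it is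
  \<open>y \<mapsto> ((e - T) + y\<^sup>2) / 2\<close>, whose increments are dominated by those of the scalar iteration
  \<open>s \<mapsto> (1 + s\<^sup>2) / 2\<close>. As \<open>s n \<longlonglongrightarrow> 1\<close>, the component of \<open>S\<close> along \<open>e\<close> vanishes in the limit, so that
  the root lies in every closed subspace containing \<open>T\<close> and closed under squares.\<close>

lemma square_root_exists:
  fixes mul :: "'a::real_normed_vector \<Rightarrow> 'a \<Rightarrow> 'a"
  assumes complete: "complete (UNIV :: 'a set)" and mul: "bounded_bilinear mul"
    and sub: "\<And>x y. norm (mul x y) \<le> norm x * norm y"
    and e: "\<And>x. mul e x = x" "\<And>x. mul x e = x"
    and A: "subspace A" "closed A" "\<And>x. x \<in> A \<Longrightarrow> mul x x \<in> A"
    and T: "T \<in> A" "norm (e - T) \<le> 1"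
  shows "\<exists>S\<in>A. mul S S = T"
proof -
  interpret bounded_bilinear mul by fact
  define s :: "nat \<Rightarrow> real" where "s = rec_nat 0 (\<lambda>_ s. (1 + s\<^sup>2) / 2)"
  have s0: "s 0 = 0" and sS: "s (Suc n) = (1 + (s n)\<^sup>2) / 2" for n
    by (simp_all add: s_def)
  define y where "y = rec_nat 0 (\<lambda>_ y. (1/2) *\<^sub>R ((e - T) + mul y y))"
  have y0: "y 0 = 0" and yS: "y (Suc n) = (1/2) *\<^sub>R ((e - T) + mul (y n) (y n))" for n
    by (simp_all add: y_def)
  have s01: "0 \<le> s n \<and> s n \<le> 1" for n
    by (induction n) (auto simp: s0 sS abs_square_le_1 intro: power_le_one)
  have s_inc: "s n \<le> s (Suc n)" for n
    using zero_le_power2[of "s n - 1"] by (simp add: sS power2_diff)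
  obtain l where l: "s \<longlonglongrightarrow> l"
    using incseq_convergent[of s 1] s01 s_inc by (metis incseq_SucI)
  \<comment> \<open>The scalar iteration has 1 as its only fixed point, a double root of the
    equation.\<close>
  have "l = (1 + l\<^sup>2) / 2"
  proof (rule LIMSEQ_unique)
    show "(\<lambda>n. s (Suc n)) \<longlonglongrightarrow> l" using l by (rule LIMSEQ_Suc)
    show "(\<lambda>n. s (Suc n)) \<longlonglongrightarrow> (1 + l\<^sup>2) / 2" unfolding sS by (intro tendsto_intros l) auto
  qed
  then have "(l - 1)\<^sup>2 = 0" by (simp add: power2_diff)
  then have l1: "s \<longlonglongrightarrow> 1" using l by simp
  have y_le: "norm (y n) \<le> s n \<and> norm (y (Suc n) - y n) \<le> s (Suc n) - s n" for n
  proof (induction n)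
    case 0
    show ?case using T(2) by (simp add: y0 yS s0 sS zero_left)
  next
    case (Suc n)
    have 1: "norm (y (Suc n)) \<le> s (Suc n)"
      using Suc norm_triangle_ineq[of "y n" "y (Suc n) - y n"] by simp
    have "y (Suc (Suc n)) - y (Suc n) =
        (1/2) *\<^sub>R (mul (y (Suc n)) (y (Suc n)) - mul (y n) (y n))"
      by (simp add: yS[of "Suc n"] yS[of n] scaleR_diff_right[symmetric] del: scaleR_diff_right)
    \<comment> \<open>\<open>mul\<close> need not be commutative, so the difference of squares is
      split asymmetrically.\<close>
    also have "\<dots> = (1/2) *\<^sub>R (mul (y (Suc n)) (y (Suc n) - y n) + mul (y (Suc n) - y n) (y n))"
      by (simp add: diff_left diff_right)
    finally have "norm (y (Suc (Suc n)) - y (Suc n)) \<le>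
        (1/2) * (norm (y (Suc n)) * norm (y (Suc n) - y n) + norm (y (Suc n) - y n) * norm (y n))"
      by (simp add: norm_triangle_le sub add_mono)
    also have "\<dots> \<le> (1/2) * (s (Suc n) * (s (Suc n) - s n) + (s (Suc n) - s n) * s n)"
      using Suc 1 s01 s_inc by (intro mult_left_mono add_mono mult_mono) auto
    also have "\<dots> = s (Suc (Suc n)) - s (Suc n)"
      by (simp add: sS[of "Suc n"] sS[of n] power2_eq_square field_simps)
    finally show ?case using 1 by simp
  qed
  have "Cauchy y"
    using y_le l by (intro Cauchy_dominated[of y s]) (auto simp: convergent_def)
  then obtain Y where Y: "y \<longlonglongrightarrow> Y"
    using complete by (auto simp: complete_def)
  have Y_eq: "Y = (1/2) *\<^sub>R ((e - T) + mul Y Y)"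
  proof (rule LIMSEQ_unique)
    show "(\<lambda>n. y (Suc n)) \<longlonglongrightarrow> Y" using Y by (rule LIMSEQ_Suc)
    show "(\<lambda>n. y (Suc n)) \<longlonglongrightarrow> (1/2) *\<^sub>R ((e - T) + mul Y Y)"
      unfolding yS by (intro tendsto_intros tendsto Y)
  qed
  \<comment> \<open>Neither \<open>e\<close> nor \<open>y n\<close> need lie in \<open>A\<close>. In
    the recursion for this combination all multiples of \<open>e\<close> cancel, and only
    \<open>T\<close>, a multiple of the previous term and its square remain.\<close>
  have mem: "(s n *\<^sub>R e) - y n \<in> A" for n
  proof (induction n)
    case 0
    show ?case by (simp add: y0 s0 subspace_0 A)
  next
    case (Suc n)
    define a where "a = s n *\<^sub>R e - y n"
    have y: "y n = s n *\<^sub>R e - a" by (simp add: a_def)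
    have "s (Suc n) *\<^sub>R e - y (Suc n) = (1/2) *\<^sub>R (T + (2 * s n) *\<^sub>R a - mul a a)"
      by (simp add: yS sS y diff_left diff_right scaleR_left scaleR_right e power2_eq_square
          scaleR_add_left add_divide_distrib algebra_simps flip: scaleR_2)
    then show ?case
      using Suc A T(1) unfolding a_def[symmetric]
      by (auto intro!: subspace_scale subspace_add subspace_diff)
  qed
  define S where "S = e - Y"
  have "(\<lambda>n. (s n *\<^sub>R e) - y n) \<longlonglongrightarrow> 1 *\<^sub>R e - Y"
    by (intro tendsto_intros l1 Y)
  then have "S \<in> A"
    using closed_sequentially[OF A(2) mem] by (simp add: S_def)
  moreover have "mul S S = T"
  proof -
    have "2 *\<^sub>R Y = 2 *\<^sub>R ((1/2) *\<^sub>R ((e - T) + mul Y Y))"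
      by (simp only: Y_eq[symmetric])
    then have "2 *\<^sub>R Y = (e - T) + mul Y Y" by simp
    then show ?thesis
      by (simp add: S_def diff_left diff_right e scaleR_2 algebra_simps)
  qed
  ultimately show ?thesis by blast
qed

section \<open>Bounded continuous functions\<close>

declare step_on.rep_eq [simp] chi_compl.rep_eq [simp] bc_scale.rep_eq [simp] bc_cnj.rep_eq [simp]
  scaleC_bcontfun.rep_eq [simp] bc_compose.rep_eq [simp] scaleC_complex_def [simp]

lemma complete_UNIV_bcontfun:
  "complete (UNIV :: ('a::topological_space \<Rightarrow>\<^sub>C 'b::complete_space) set)"
  unfolding complete_def
proof (intro allI impI, elim conjE)
  fix f :: "nat \<Rightarrow> 'a \<Rightarrow>\<^sub>C 'b"
  assume "Cauchy f"
  then have "uniformly_Cauchy_on UNIV (\<lambda>n. apply_bcontfun (f n))"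
    unfolding uniformly_Cauchy_on_def by (meson dist_fun_lt_imp_dist_val_lt metric_CauchyD)
  then have "uniformly_convergent_on UNIV (\<lambda>n. apply_bcontfun (f n))"
    by (rule Cauchy_uniformly_convergent)
  then obtain g where "uniform_limit UNIV (\<lambda>n. apply_bcontfun (f n)) g sequentially"
    unfolding uniformly_convergent_on_def by blast
  then show "\<exists>l\<in>UNIV. f \<longlonglongrightarrow> l"
    by (metis UNIV_I sequentially_bot uniform_limit_bcontfunE)
qed

lemma closed_imp_complete_bcontfun:
  "closed S \<Longrightarrow> complete (S :: ('a::topological_space \<Rightarrow>\<^sub>C 'b::complete_space) set)"
  using complete_closed_subset complete_UNIV_bcontfun by blast

lemma norm_bc_scale_le: "norm (bc_scale f g) \<le> norm f * norm g"
  by (rule norm_bound) (simp add: norm_scaleC mult_mono norm_bounded)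

text \<open>The subalgebra \<open>S\<close> shows that the intersected family is not empty, which
  keeps the intersection inside the carrier of \<open>K\<close>.\<close>

lemma generated_cstar:
  assumes "cstar_subalgebra K S" "G \<subseteq> S"
  shows "cstar_subalgebra K (alg_carrier (generated_cstar K G))"
    and "G \<subseteq> alg_carrier (generated_cstar K G)"
    and "alg_carrier (generated_cstar K G) \<subseteq> S"
proof -
  show "alg_carrier (generated_cstar K G) \<subseteq> S"
    using assms by (auto simp: generated_cstar_def)
  then show "cstar_subalgebra K (alg_carrier (generated_cstar K G))"
    using assms(1) unfolding cstar_subalgebra_def
    by (intro conjI) (auto simp: generated_cstar_def cstar_subalgebra_def csubspace_def)
qed (auto simp: generated_cstar_def)

section \<open>The algebra generated by the characteristic functions of the up-sets\<close>

lemma C_P_simps [simp]: "alg_mult C_P = bc_scale" "alg_star C_P = bc_cnj"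
  by (simp_all add: C_P_def generated_cstar_def Cb_complex_def)

lemma
  shows cstar_subalgebra_C_P: "cstar_subalgebra Cb_complex (alg_carrier C_P)"
    and C_P_gen: "range (\<lambda>a. step_on a 1) \<union> range chi_compl \<subseteq> alg_carrier C_P"
proof -
  have "cstar_subalgebra Cb_complex UNIV"
    by (simp add: cstar_subalgebra_def Cb_complex_def csubspace_def)
  from generated_cstar(1,2)[OF this subset_UNIV]
  show "cstar_subalgebra Cb_complex (alg_carrier C_P)"
    "range (\<lambda>a. step_on a 1) \<union> range chi_compl \<subseteq> alg_carrier C_P"
    unfolding C_P_def .
qed

lemma C_P_add: "f \<in> alg_carrier C_P \<Longrightarrow> g \<in> alg_carrier C_P \<Longrightarrow> f + g \<in> alg_carrier C_P"
  and C_P_scaleC: "f \<in> alg_carrier C_P \<Longrightarrow> c *\<^sub>C f \<in> alg_carrier C_P"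
  and C_P_diff: "f \<in> alg_carrier C_P \<Longrightarrow> g \<in> alg_carrier C_P \<Longrightarrow> f - g \<in> alg_carrier C_P"
  and C_P_mult: "f \<in> alg_carrier C_P \<Longrightarrow> g \<in> alg_carrier C_P \<Longrightarrow> bc_scale f g \<in> alg_carrier C_P"
  and C_P_cnj: "f \<in> alg_carrier C_P \<Longrightarrow> bc_cnj f \<in> alg_carrier C_P"
  and C_P_closed: "closed (alg_carrier C_P)"
  using cstar_subalgebra_C_P csubspace_diff[of "alg_carrier C_P" f g]
  by (auto simp: cstar_subalgebra_def csubspace_def Cb_complex_def)

lemma C_P_0: "0 \<in> alg_carrier C_P"
  using cstar_subalgebra_C_P by (auto simp: cstar_subalgebra_def csubspace_def)

lemma C_P_step_on: "step_on a 1 \<in> alg_carrier C_P"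
  and C_P_chi_compl: "chi_compl a \<in> alg_carrier C_P"
  by (rule subsetD[OF C_P_gen]; simp)+

text \<open>As \<open>bot\<close> lies below every point, \<open>step_on bot 1\<close> is the
  constant 1, the unit of the algebra.\<close>

lemmas C_P_1 = C_P_step_on[of bot]

text \<open>These are the indicators of clopen subsets of \<gamma>P: characters take only the values
  0 and 1 on them, and \<open>\<phi> e = 1\<close> says that \<open>\<phi>\<close> lies in the set
  of \<open>e\<close>.\<close>

definition idempotents :: "('p::poset_topology \<Rightarrow>\<^sub>C complex) set"
  where "idempotents = {e \<in> alg_carrier C_P. \<forall>u. apply_bcontfun e u = 0 \<or> apply_bcontfun e u = 1}"

lemma idempotents_step_on: "step_on a 1 \<in> idempotents"
  and idempotents_chi_compl: "chi_compl a \<in> idempotents"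
  by (auto simp: idempotents_def C_P_step_on C_P_chi_compl)

lemma idempotents_mult: "e \<in> idempotents \<Longrightarrow> e' \<in> idempotents \<Longrightarrow> bc_scale e e' \<in> idempotents"
  by (auto simp: idempotents_def C_P_mult) (metis mult_1)

lemma idempotents_C_P: "e \<in> idempotents \<Longrightarrow> e \<in> alg_carrier C_P"
  by (simp add: idempotents_def)

section \<open>Characters\<close>

lemma topspace_gammaP: "topspace gammaP = characters C_P"
  by (auto simp: gammaP_def gelfand_spectrum_def characters_def PiE_UNIV_domain
      topspace_product_topology PiE_def)

context
  fixes \<phi> :: "('p::poset_topology \<Rightarrow>\<^sub>C complex) \<Rightarrow> complex"
  assumes \<phi>: "\<phi> \<in> topspace gammaP"
begin

lemma char_add: "f \<in> alg_carrier C_P \<Longrightarrow> g \<in> alg_carrier C_P \<Longrightarrow> \<phi> (f + g) = \<phi> f + \<phi> g"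
  and char_scaleC: "f \<in> alg_carrier C_P \<Longrightarrow> \<phi> (c *\<^sub>C f) = c * \<phi> f"
  and char_mult: "f \<in> alg_carrier C_P \<Longrightarrow> g \<in> alg_carrier C_P \<Longrightarrow> \<phi> (bc_scale f g) = \<phi> f * \<phi> g"
  using \<phi> by (auto simp: topspace_gammaP characters_def)

lemma char_0: "\<phi> 0 = 0"
  using char_scaleC[OF C_P_0, of 0] by simp

lemma char_1: "\<phi> (step_on bot 1) = 1"
proof -
  obtain f where f: "f \<in> alg_carrier C_P" "\<phi> f \<noteq> 0"
    using \<phi> by (auto simp: topspace_gammaP characters_def)
  have "bc_scale (step_on bot 1) f = f"
    by (rule bcontfun_eqI) simp
  then show ?thesis
    using char_mult[OF C_P_1 f(1)] f(2) by simp
qed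

lemma char_diff: "f \<in> alg_carrier C_P \<Longrightarrow> g \<in> alg_carrier C_P \<Longrightarrow> \<phi> (f - g) = \<phi> f - \<phi> g"
  using char_add[of "f - g" g] by (simp add: C_P_diff)

lemma char_chi_compl: "\<phi> (chi_compl a) = 1 - \<phi> (step_on a 1)"
proof -
  have "chi_compl a = step_on bot 1 - step_on a 1"
    by (rule bcontfun_eqI) simp
  then show ?thesis
    by (simp add: char_diff char_1 C_P_step_on)
qed

lemma char_idempotent: "e \<in> idempotents \<Longrightarrow> \<phi> e = 0 \<or> \<phi> e = 1"
proof -
  assume e: "e \<in> idempotents"
  have "bc_scale e e = e"
    using e by (intro bcontfun_eqI) (auto simp: idempotents_def)
  then have "\<phi> e * \<phi> e = \<phi> e"
    using char_mult[of e e] e by (simp add: idempotents_C_P)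
  then show ?thesis by simp
qed

text \<open>If \<open>norm g < 1\<close> and \<open>\<phi> g = 1\<close>, the solution \<open>h\<close> of \<open>h = 1 + g h\<close> gives \<open>\<phi> h = 1 + \<phi> h\<close>.\<close>

lemma char_norm_le: assumes f: "f \<in> alg_carrier C_P" shows "cmod (\<phi> f) \<le> norm f"
proof (rule ccontr)
  assume less: "\<not> ?thesis"
  then have nz: "\<phi> f \<noteq> 0" by auto
  define g where "g = inverse (\<phi> f) *\<^sub>C f"
  have g: "g \<in> alg_carrier C_P" "\<phi> g = 1" "norm g < 1"
    using f nz less
    by (auto simp: g_def C_P_scaleC char_scaleC norm_scaleC norm_inverse inverse_less_1_iff
        mult.commute[of "inverse _"] divide_less_eq simp flip: divide_inverse)
  \<comment> \<open>The fixed point must lie in \<open>C_P\<close>, where \<open>\<phi>\<close> is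
    multiplicative; hence the contraction principle is applied on this closed set.\<close>
  have "\<exists>!h \<in> alg_carrier C_P. step_on bot 1 + bc_scale g h = h"
  proof (rule Banach_fix[where c = "norm g"])
    fix h h' :: "'p \<Rightarrow>\<^sub>C complex"
    have "bc_scale g h - bc_scale g h' = bc_scale g (h - h')"
      by (rule bcontfun_eqI) (simp add: algebra_simps)
    then show "dist (step_on bot 1 + bc_scale g h) (step_on bot 1 + bc_scale g h') \<le> norm g * dist h h'"
      using norm_bc_scale_le[of g "h - h'"] by (simp add: dist_norm)
  qed (use g C_P_0 in \<open>auto simp: closed_imp_complete_bcontfun C_P_closed C_P_1 C_P_add C_P_mult\<close>)
  then obtain h where h: "h \<in> alg_carrier C_P" "h = step_on bot 1 + bc_scale g h" by metis
  have "\<phi> h = 1 + \<phi> h"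
    by (subst h(2)) (simp add: h(1) g char_add char_mult char_1 C_P_1 C_P_mult)
  then show False by simp
qed

text \<open>Multiplication by \<open>e\<close> removes \<open>f - c\<close> where it is not
  controlled, and \<open>\<phi>\<close> does not notice because \<open>\<phi> e = 1\<close>; then
  \<open>char_norm_le\<close> applies.\<close>

lemma char_approx_le:
  assumes e: "e \<in> idempotents" "\<phi> e = 1" and f: "f \<in> alg_carrier C_P" and "0 \<le> r"
    and le: "\<And>u. apply_bcontfun e u = 1 \<Longrightarrow> cmod (apply_bcontfun f u - c) \<le> r"
  shows "cmod (\<phi> f - c) \<le> r"
proof -
  define g where "g = bc_scale e (f - c *\<^sub>C step_on bot 1)"
  have "g \<in> alg_carrier C_P" "\<phi> g = \<phi> f - c"
    using e f by (simp_all add: g_def C_P_mult C_P_diff C_P_scaleC C_P_1 idempotents_C_P char_mult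
        char_diff char_scaleC char_1)
  moreover have "norm g \<le> r"
  proof (rule norm_bound)
    fix u
    show "norm (apply_bcontfun g u) \<le> r"
      using e(1) le[of u] \<open>0 \<le> r\<close>
      by (cases "apply_bcontfun e u = 0") (auto simp: g_def idempotents_def)
  qed
  ultimately show ?thesis using char_norm_le[of g] by simp
qed

end

text \<open>The functions with this property at every character and for every \<epsilon> form a
  C*-subalgebra that contains the generators, hence all of \<open>C_P\<close>.\<close>

lemma char_approx_ex:
  assumes "f \<in> alg_carrier C_P" "\<phi> \<in> topspace gammaP" "\<epsilon> > 0"
  shows "\<exists>e\<in>idempotents. \<phi> e = 1 \<and> (\<forall>u. apply_bcontfun e u = 1 \<longrightarrow> cmod (apply_bcontfun f u - \<phi> f) < \<epsilon>)"
proof -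
  define good where "good f \<phi> \<epsilon> \<longleftrightarrow> (\<exists>e\<in>idempotents. \<phi> e = 1 \<and>
    (\<forall>u. apply_bcontfun e u = 1 \<longrightarrow> cmod (apply_bcontfun f u - \<phi> f) < \<epsilon>))"
    for f :: "'a \<Rightarrow>\<^sub>C complex" and \<phi> and \<epsilon> :: real
  define S where "S = {f \<in> alg_carrier C_P. \<forall>\<phi>\<in>topspace gammaP. \<forall>\<epsilon>>0. good f \<phi> \<epsilon>}"
  \<comment> \<open>Exactly one of the sets \<open>U\<^sub>a\<close> and \<open>V\<^sub>a\<close> is
    selected by the character, and both generators are constant on it.\<close>
  have idem: "good f \<phi> \<epsilon>" if "\<phi> \<in> topspace gammaP" "f \<in> {step_on a 1, chi_compl a}" "\<epsilon> > 0"
    for f \<phi> \<epsilon> a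
    unfolding good_def using that char_idempotent[OF that(1) idempotents_step_on, of a]
    by (intro bexI[of _ "if \<phi> (step_on a 1) = 1 then step_on a 1 else chi_compl a"])
      (auto simp: char_chi_compl idempotents_step_on idempotents_chi_compl split: if_splits)
  \<comment> \<open>Common step of all closure properties: the product of two idempotents represents
    the intersection of their sets, where both estimates hold.\<close>
  have combine: "good h \<phi> \<epsilon>"
    if \<phi>: "\<phi> \<in> topspace gammaP" and f: "f \<in> S" "g \<in> S" and "\<delta> > 0" 
      and h: "\<And>u. cmod (apply_bcontfun f u - \<phi> f) < \<delta> \<Longrightarrow>
        cmod (apply_bcontfun g u - \<phi> g) < \<delta> \<Longrightarrow> cmod (apply_bcontfun h u - \<phi> h) < \<epsilon>"
    for f g h \<phi> \<delta> \<epsilon>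
  proof -
    obtain e where e: "e \<in> idempotents" "\<phi> e = 1"
      "\<And>u. apply_bcontfun e u = 1 \<Longrightarrow> cmod (apply_bcontfun f u - \<phi> f) < \<delta>"
      using f(1) \<phi> \<open>\<delta> > 0\<close> unfolding S_def good_def by blast
    obtain e' where e': "e' \<in> idempotents" "\<phi> e' = 1"
      "\<And>u. apply_bcontfun e' u = 1 \<Longrightarrow> cmod (apply_bcontfun g u - \<phi> g) < \<delta>"
      using f(2) \<phi> \<open>\<delta> > 0\<close> unfolding S_def good_def by blast
    show ?thesis
      unfolding good_def
    proof (intro bexI[of _ "bc_scale e e'"] conjI allI impI)
      show "\<phi> (bc_scale e e') = 1"
        using e e' \<phi> by (simp add: char_mult idempotents_C_P)
      fix u assume "apply_bcontfun (bc_scale e e') u = 1"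
      then have "apply_bcontfun e u = 1" "apply_bcontfun e' u = 1"
        using e(1) e'(1) by (auto simp: idempotents_def dest: spec[of _ u])
      then show "cmod (apply_bcontfun h u - \<phi> h) < \<epsilon>" using e e' h by blast
    qed (use e e' in \<open>auto simp: idempotents_mult\<close>)
  qed
  have "cstar_subalgebra Cb_complex S"
    unfolding cstar_subalgebra_def
  proof (intro conjI ballI)
    show "S \<subseteq> alg_carrier Cb_complex" by (simp add: Cb_complex_def)
    show "csubspace S"
      unfolding csubspace_def
    proof (intro conjI ballI allI)
      have "good 0 \<phi> \<epsilon>" if "\<phi> \<in> topspace gammaP" "\<epsilon> > 0" for \<phi> :: "('a \<Rightarrow>\<^sub>C complex) \<Rightarrow> complex" and \<epsilon>
        unfolding good_def using that char_1[OF that(1)]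
        by (intro bexI[of _ "step_on bot 1"]) (auto simp: char_0 idempotents_step_on)
      then show "0 \<in> S" by (simp add: S_def C_P_0)
      fix f assume f: "f \<in> S"
      show "f + g \<in> S" if g: "g \<in> S" for g
      proof -
        have "good (f + g) \<phi> \<epsilon>" if "\<phi> \<in> topspace gammaP" "\<epsilon> > 0" for \<phi> \<epsilon>
        proof (rule combine[OF that(1) f g, of "\<epsilon> / 2"])
          fix u assume *: "cmod (apply_bcontfun f u - \<phi> f) < \<epsilon> / 2" "cmod (apply_bcontfun g u - \<phi> g) < \<epsilon> / 2"
          have eq: "apply_bcontfun (f + g) u - \<phi> (f + g) = (apply_bcontfun f u - \<phi> f) + (apply_bcontfun g u - \<phi> g)"
            using f g that by (simp add: S_def char_add)
          show "cmod (apply_bcontfun (f + g) u - \<phi> (f + g)) < \<epsilon>"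
            unfolding eq using * norm_triangle_ineq[of "apply_bcontfun f u - \<phi> f" "apply_bcontfun g u - \<phi> g"] by linarith
        qed (use that in simp)
        then show ?thesis using f g by (simp add: S_def C_P_add)
      qed
      show "c *\<^sub>C f \<in> S" for c
      proof -
        have "good (c *\<^sub>C f) \<phi> \<epsilon>" if "\<phi> \<in> topspace gammaP" "\<epsilon> > 0" for \<phi> \<epsilon>
        \<comment> \<open>The summand 1 covers \<open>c = 0\<close>.\<close>
        proof (rule combine[OF that(1) f f, of "\<epsilon> / (cmod c + 1)"])
          fix u assume *: "cmod (apply_bcontfun f u - \<phi> f) < \<epsilon> / (cmod c + 1)"
          have "apply_bcontfun (c *\<^sub>C f) u - \<phi> (c *\<^sub>C f) = c * (apply_bcontfun f u - \<phi> f)"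
            using f that by (simp add: S_def char_scaleC algebra_simps)
          then have "cmod (apply_bcontfun (c *\<^sub>C f) u - \<phi> (c *\<^sub>C f)) \<le> (cmod c + 1) * cmod (apply_bcontfun f u - \<phi> f)"
            by (simp add: norm_mult mult_right_mono)
          also have "\<dots> < (cmod c + 1) * (\<epsilon> / (cmod c + 1))"
            by (intro mult_strict_left_mono *) (simp add: add_nonneg_pos)
          also have "\<dots> = \<epsilon>"
            using norm_ge_zero[of c] by (simp add: add_nonneg_eq_0_iff)
          finally show "cmod (apply_bcontfun (c *\<^sub>C f) u - \<phi> (c *\<^sub>C f)) < \<epsilon>" .
        qed (use that in \<open>simp add: add_nonneg_pos\<close>)
        then show ?thesis using f by (simp add: S_def C_P_scaleC)
      qed
    qed
    show "closed S"
      unfolding closure_subset_eq[symmetric]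
    proof
      fix f assume f: "f \<in> closure S"
      have fC: "f \<in> alg_carrier C_P"
        using f closure_minimal[of S "alg_carrier C_P"] by (auto simp: S_def C_P_closed)
      have "good f \<phi> \<epsilon>" if "\<phi> \<in> topspace gammaP" "\<epsilon> > 0" for \<phi> \<epsilon>
      proof -
        obtain g where g: "g \<in> S" "dist g f < \<epsilon> / 3"
          using f \<open>\<epsilon> > 0\<close> by (metis closure_approachable divide_pos_pos zero_less_numeral)
        then have gC: "g \<in> alg_carrier C_P" by (simp add: S_def)
        show ?thesis
        proof (rule combine[OF that(1) g(1) g(1), of "\<epsilon> / 3"])
          fix u assume *: "cmod (apply_bcontfun g u - \<phi> g) < \<epsilon> / 3"
          have small: "cmod (\<phi> (f - g)) < \<epsilon> / 3" "cmod (apply_bcontfun (f - g) u) < \<epsilon> / 3"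
            using char_norm_le[OF that(1), of "f - g"] norm_bounded[of "f - g" u] g(2) gC fC
            by (simp_all add: dist_norm norm_minus_commute C_P_diff)
          have eq: "apply_bcontfun f u - \<phi> f =
              apply_bcontfun (f - g) u + (apply_bcontfun g u - \<phi> g) - \<phi> (f - g)"
            using that gC fC by (simp add: char_diff)
          show "cmod (apply_bcontfun f u - \<phi> f) < \<epsilon>"
            unfolding eq using small * norm_triangle_ineq[of "apply_bcontfun (f - g) u" "apply_bcontfun g u - \<phi> g"]
              norm_triangle_ineq4[of "apply_bcontfun (f - g) u + (apply_bcontfun g u - \<phi> g)" "\<phi> (f - g)"]
            by linarith
        qed (use that in simp)
      qed
      then show "f \<in> S" using fC by (simp add: S_def)
    qed
    fix f assume f: "f \<in> S"
    show "alg_mult Cb_complex f g \<in> S" if g: "g \<in> S" for g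
    proof -
      have "good (bc_scale f g) \<phi> \<epsilon>" if "\<phi> \<in> topspace gammaP" "\<epsilon> > 0" for \<phi> \<epsilon>
      \<comment> \<open>The error of a product is at most \<delta> times
        \<open>norm f + norm g\<close>; the extra 1 keeps the denominator positive and the final
        inequality strict.\<close>
      proof (rule combine[OF that(1) f g, of "\<epsilon> / (norm f + norm g + 1)"])
        define \<delta> where "\<delta> = \<epsilon> / (norm f + norm g + 1)"
        have pos: "norm f + norm g + 1 > 0" by (simp add: add_nonneg_pos)
        then have \<delta>: "\<delta> > 0" using that by (simp add: \<delta>_def)
        then show "\<epsilon> / (norm f + norm g + 1) > 0" by (simp add: \<delta>_def)
        fix u assume "cmod (apply_bcontfun f u - \<phi> f) < \<epsilon> / (norm f + norm g + 1)"
          "cmod (apply_bcontfun g u - \<phi> g) < \<epsilon> / (norm f + norm g + 1)"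
        then have *: "cmod (apply_bcontfun f u - \<phi> f) \<le> \<delta>" "cmod (apply_bcontfun g u - \<phi> g) \<le> \<delta>"
          by (simp_all add: \<delta>_def)
        have "apply_bcontfun (bc_scale f g) u - \<phi> (bc_scale f g) =
            (apply_bcontfun f u - \<phi> f) * apply_bcontfun g u + \<phi> f * (apply_bcontfun g u - \<phi> g)"
          using f g that by (simp add: S_def char_mult algebra_simps)
        also have "cmod \<dots> \<le> cmod (apply_bcontfun f u - \<phi> f) * cmod (apply_bcontfun g u) +
            cmod (\<phi> f) * cmod (apply_bcontfun g u - \<phi> g)"
          by (rule norm_triangle_le) (simp add: norm_mult)
        also have "\<dots> \<le> \<delta> * norm g + norm f * \<delta>"
          using f that \<delta> by (intro add_mono mult_mono * norm_bounded char_norm_le) (auto simp: S_def)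
        also have "\<dots> < \<delta> * (norm f + norm g + 1)"
          using \<delta> by (simp add: algebra_simps)
        also have "\<dots> = \<epsilon>" using pos by (simp add: \<delta>_def)
        finally show "cmod (apply_bcontfun (bc_scale f g) u - \<phi> (bc_scale f g)) < \<epsilon>" .
      qed
      then show ?thesis using f g by (simp add: S_def C_P_mult Cb_complex_def)
    qed
    show "alg_star Cb_complex f \<in> S"
    proof -
      have cmod_cnj_diff: "cmod (cnj a - cnj b) = cmod (a - b)" for a b
        by (metis complex_cnj_diff complex_mod_cnj)
      \<comment> \<open>Preservation of conjugates is not part of \<open>characters\<close>. It
        follows from approximation: where \<open>e\<close> is 1, the conjugate of \<open>f\<close>
        is near the conjugate of \<open>\<phi> f\<close>, so \<open>char_approx_le\<close> applies
        for every \<open>r\<close>.\<close>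
      have cnj: "\<phi> (bc_cnj f) = cnj (\<phi> f)" if "\<phi> \<in> topspace gammaP" for \<phi>
      proof -
        have "cmod (\<phi> (bc_cnj f) - cnj (\<phi> f)) \<le> 0 + r" if "r > 0" for r
        proof -
          obtain e where e: "e \<in> idempotents" "\<phi> e = 1"
            "\<And>u. apply_bcontfun e u = 1 \<Longrightarrow> cmod (apply_bcontfun f u - \<phi> f) < r"
            using f \<open>\<phi> \<in> topspace gammaP\<close> \<open>r > 0\<close> unfolding S_def good_def by blast
          have "f \<in> alg_carrier C_P" using f by (simp add: S_def)
          from char_approx_le[OF \<open>\<phi> \<in> topspace gammaP\<close> e(1,2) C_P_cnj[OF this]] show ?thesis
            using e(3) \<open>r > 0\<close> by (simp add: cmod_cnj_diff less_imp_le)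
        qed
        then have "cmod (\<phi> (bc_cnj f) - cnj (\<phi> f)) \<le> 0" by (rule field_le_epsilon)
        then show ?thesis by simp
      qed
      have "good (bc_cnj f) \<phi> \<epsilon>" if "\<phi> \<in> topspace gammaP" "\<epsilon> > 0" for \<phi> \<epsilon>
        using that by (intro combine[OF that(1) f f, of \<epsilon>]) (simp_all add: cnj cmod_cnj_diff)
      then show ?thesis using f by (simp add: S_def C_P_cnj Cb_complex_def)
    qed
  qed
  moreover have "range (\<lambda>a. step_on a 1) \<union> range chi_compl \<subseteq> S"
    using idem by (auto simp: S_def C_P_step_on C_P_chi_compl)
  ultimately have "alg_carrier C_P \<subseteq> S"
    unfolding C_P_def by (rule generated_cstar(3))
  then show ?thesis using assms by (auto simp: S_def good_def)
qed

section \<open>The compactification\<close>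

text \<open>A basic weak-* neighbourhood restricts finitely many coordinates. Each restriction
  follows from an idempotent, and the product of these idempotents takes care of all of them: the
  clopen sets form a base.\<close>

lemma gammaP_nbhd:
  assumes W: "openin gammaP W" and \<phi>: "\<phi> \<in> W"
  shows "\<exists>e\<in>idempotents. \<phi> e = 1 \<and> (\<forall>\<psi>\<in>topspace gammaP. \<psi> e = 1 \<longrightarrow> \<psi> \<in> W)"
proof -
  let ?X = "product_topology (\<lambda>_. euclidean) (alg_carrier C_P) :: (('a \<Rightarrow>\<^sub>C complex) \<Rightarrow> complex) topology"
  have \<phi>': "\<phi> \<in> topspace gammaP" using openin_subset[OF W] \<phi> by blast
  obtain Q where Q: "openin ?X Q" "W = Q \<inter> characters C_P"
    using W by (auto simp: gammaP_def gelfand_spectrum_def openin_subtopology)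
  then obtain U where U: "finite {f \<in> alg_carrier C_P. U f \<noteq> UNIV}"
    "\<And>f. f \<in> alg_carrier C_P \<Longrightarrow> open (U f)" "\<phi> \<in> PiE (alg_carrier C_P) U" "PiE (alg_carrier C_P) U \<subseteq> Q"
    using \<phi> by (fastforce simp: openin_product_topology_alt)
  have one: "\<exists>e\<in>idempotents. \<phi> e = 1 \<and> (\<forall>\<psi>\<in>topspace gammaP. \<psi> e = 1 \<longrightarrow> \<psi> f \<in> U f)"
    if f: "f \<in> alg_carrier C_P" for f
  proof -
    obtain r where r: "r > 0" "ball (\<phi> f) r \<subseteq> U f"
      using U(2)[OF f] U(3) f by (meson PiE_mem open_contains_ball)
    \<comment> \<open>Half the radius, because \<open>char_approx_le\<close> returns only a weak
      inequality and the ball is open.\<close>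
    obtain e where e: "e \<in> idempotents" "\<phi> e = 1"
      "\<And>u. apply_bcontfun e u = 1 \<Longrightarrow> cmod (apply_bcontfun f u - \<phi> f) < r / 2"
      using char_approx_ex[OF f \<phi>', of "r / 2"] r by auto
    have "\<psi> f \<in> U f" if "\<psi> \<in> topspace gammaP" "\<psi> e = 1" for \<psi>
    proof -
      have "cmod (\<psi> f - \<phi> f) \<le> r / 2"
        using e(3) r(1) by (intro char_approx_le[OF that(1) e(1) that(2) f]) (auto intro: less_imp_le)
      then show ?thesis using r by (auto simp: dist_norm norm_minus_commute)
    qed
    then show ?thesis using e by blast
  qed
  have "\<exists>e\<in>idempotents. \<phi> e = 1 \<and> (\<forall>\<psi>\<in>topspace gammaP. \<psi> e = 1 \<longrightarrow> (\<forall>f\<in>J. \<psi> f \<in> U f))"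
    if "finite J" "J \<subseteq> alg_carrier C_P" for J
    using that
  proof (induction J)
    case empty
    show ?case using idempotents_step_on char_1[OF \<phi>'] by blast
  next
    case (insert f J)
    then obtain e where e: "e \<in> idempotents" "\<phi> e = 1"
      "\<And>\<psi> f. \<psi> \<in> topspace gammaP \<Longrightarrow> \<psi> e = 1 \<Longrightarrow> f \<in> J \<Longrightarrow> \<psi> f \<in> U f" by auto
    obtain e' where e': "e' \<in> idempotents" "\<phi> e' = 1"
      "\<And>\<psi>. \<psi> \<in> topspace gammaP \<Longrightarrow> \<psi> e' = 1 \<Longrightarrow> \<psi> f \<in> U f"
      using one[of f] insert.prems by auto
    show ?case
    proof (intro bexI[of _ "bc_scale e e'"] conjI ballI impI)
      show "\<phi> (bc_scale e e') = 1"
        using e e' \<phi>' by (simp add: char_mult idempotents_C_P)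
      fix \<psi> g assume \<psi>: "\<psi> \<in> topspace gammaP" "\<psi> (bc_scale e e') = 1" and g: "g \<in> insert f J"
      then have "\<psi> e = 1" "\<psi> e' = 1"
        using char_idempotent[OF \<psi>(1) e(1)] char_idempotent[OF \<psi>(1) e'(1)] e(1) e'(1)
        by (auto simp: char_mult idempotents_C_P)
      then show "\<psi> g \<in> U g" using e e' \<psi> g by blast
    qed (use e e' in \<open>auto simp: idempotents_mult\<close>)
  qed
  from this[OF U(1)] obtain e where e: "e \<in> idempotents" "\<phi> e = 1"
    "\<And>\<psi> f. \<psi> \<in> topspace gammaP \<Longrightarrow> \<psi> e = 1 \<Longrightarrow> f \<in> alg_carrier C_P \<Longrightarrow> U f \<noteq> UNIV \<Longrightarrow> \<psi> f \<in> U f"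
    by auto
  have "\<psi> \<in> W" if \<psi>: "\<psi> \<in> topspace gammaP" "\<psi> e = 1" for \<psi>
  proof -
    have "\<psi> f \<in> U f" if "f \<in> alg_carrier C_P" for f
      using e(3)[OF \<psi> that] by blast
    moreover have "\<psi> \<in> extensional (alg_carrier C_P)"
      using \<psi>(1) by (simp add: topspace_gammaP characters_def)
    ultimately have "\<psi> \<in> PiE (alg_carrier C_P) U" by (simp add: PiE_iff)
    then show ?thesis using U(4) Q(2) \<psi>(1) by (auto simp: topspace_gammaP)
  qed
  then show ?thesis using e by blast
qed

lemma point_eval_apply [simp]: "f \<in> alg_carrier C_P \<Longrightarrow> point_eval u f = apply_bcontfun f u"
  by (simp add: point_eval_def)

lemma point_eval_in_gammaP [simp]: "point_eval u \<in> topspace gammaP"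
proof -
  have "\<exists>f\<in>alg_carrier C_P. point_eval u f \<noteq> 0"
    using C_P_1 by (intro bexI[of _ "step_on bot 1"]) auto
  then show ?thesis
    unfolding topspace_gammaP characters_def
    by (auto simp: point_eval_def C_P_add C_P_scaleC C_P_mult)
qed

text \<open>A neighbourhood of a character contains the set of an idempotent \<open>e\<close> with
  \<open>\<phi> e = 1\<close>. Such an \<open>e\<close> is not zero, so it equals 1 at some point of
  \<open>P\<close>.\<close>

lemma point_eval_dense:
  assumes "openin gammaP W" "W \<noteq> {}"
  obtains u where "point_eval u \<in> W"
proof -
  obtain \<phi> where \<phi>: "\<phi> \<in> W" using assms by blast
  then have \<phi>': "\<phi> \<in> topspace gammaP" using openin_subset[OF assms(1)] by blast
  obtain e where e: "e \<in> idempotents" "\<phi> e = 1"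
    "\<And>\<psi>. \<psi> \<in> topspace gammaP \<Longrightarrow> \<psi> e = 1 \<Longrightarrow> \<psi> \<in> W"
    using gammaP_nbhd[OF assms(1) \<phi>] by auto
  have "e \<noteq> 0" using e(2) char_0[OF \<phi>'] by auto
  then obtain u where "apply_bcontfun e u \<noteq> 0"
    by (metis bcontfun_eqI zero_bcontfun.rep_eq)
  then have "apply_bcontfun e u = 1" using e(1) by (auto simp: idempotents_def)
  then have "point_eval u \<in> W" using e by (simp add: idempotents_C_P)
  then show ?thesis by (rule that)
qed

text \<open>The form in which density is used: equations, norm bounds and complex linearity of
  operators are closed conditions and pass from \<open>P\<close> to \<gamma>P.\<close>

lemma continuous_map_closed_on_points:
  assumes g: "continuous_map gammaP euclidean g" and C: "closed C"
    and pts: "\<And>u. g (point_eval u) \<in> C" and \<phi>: "\<phi> \<in> topspace gammaP"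
  shows "g \<phi> \<in> C"
proof (rule ccontr)
  assume "g \<phi> \<notin> C"
  have "openin gammaP {\<psi> \<in> topspace gammaP. g \<psi> \<in> - C}"
    using openin_continuous_map_preimage[OF g, of "- C"] C by (simp add: open_Compl)
  moreover have "\<phi> \<in> {\<psi> \<in> topspace gammaP. g \<psi> \<in> - C}"
    using \<phi> \<open>g \<phi> \<notin> C\<close> by simp
  ultimately obtain u where "point_eval u \<in> {\<psi> \<in> topspace gammaP. g \<psi> \<in> - C}"
    using point_eval_dense by blast
  then show False using pts by simp
qed

lemma continuous_map_gelfand:
  assumes "f \<in> alg_carrier C_P"
  shows "continuous_map gammaP euclidean (\<lambda>\<phi>. \<phi> f)"
  unfolding gammaP_def gelfand_spectrum_def
  by (intro continuous_map_from_subtopology continuous_map_product_projection assms)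

lemma continuous_map_point_eval: "continuous_map euclidean gammaP point_eval"
  unfolding gammaP_def gelfand_spectrum_def
proof (rule continuous_map_into_subtopology)
  show "continuous_map euclidean (product_topology (\<lambda>_. euclidean) (alg_carrier C_P)) point_eval"
    unfolding continuous_map_componentwise
    by (auto simp: point_eval_def extensional_def)
  show "point_eval \<in> topspace euclidean \<rightarrow> characters C_P"
    using point_eval_in_gammaP by (auto simp: topspace_gammaP)
qed

section \<open>Extension to the compactification\<close>

lemma continuous_map_bilinear:
  assumes "bounded_bilinear h" "continuous_map X euclidean f" "continuous_map X euclidean g"
  shows "continuous_map X euclidean (\<lambda>x. h (f x) (g x))"
  using assms(2,3) by (simp add: continuous_map_atin bounded_bilinear.tendsto[OF assms(1)])

text \<open>Exactly the condition under which the choice in \<open>extend_gammaP\<close> picks an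
  extension.\<close>

definition extendable :: "('p::poset_topology \<Rightarrow>\<^sub>C 'e::real_normed_vector) \<Rightarrow> bool"
  where "extendable m \<longleftrightarrow> (\<exists>g. continuous_map gammaP euclidean g \<and>
    (\<forall>u. g (point_eval u) = apply_bcontfun m u))"

lemma
  assumes "extendable m"
  shows continuous_extend: "continuous_map gammaP euclidean (extend_gammaP m)"
    and extend_point: "extend_gammaP m (point_eval u) = apply_bcontfun m u"
  using someI_ex[OF assms[unfolded extendable_def]] by (auto simp: extend_gammaP_def)

text \<open>Uniqueness by density. It evaluates the choice on \<open>topspace gammaP\<close>,
  outside of which its values are arbitrary; the rules for sums, products and adjoints are obtained
  by exhibiting a continuous candidate.\<close>

lemma extend_eqI:
  assumes g: "continuous_map gammaP euclidean g" "\<And>u. g (point_eval u) = apply_bcontfun m u"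
    and \<phi>: "\<phi> \<in> topspace gammaP"
  shows "extend_gammaP m \<phi> = g \<phi>"
proof -
  have "extendable m" using g by (auto simp: extendable_def)
  then have "extend_gammaP m \<phi> - g \<phi> \<in> {0}"
    using continuous_map_closed_on_points[of "\<lambda>\<phi>. extend_gammaP m \<phi> - g \<phi>" "{0}", OF _ _ _ \<phi>] g
    by (simp add: continuous_map_diff continuous_extend extend_point)
  then show ?thesis by simp
qed

lemma extendableI:
  "continuous_map gammaP euclidean g \<Longrightarrow> (\<And>u. g (point_eval u) = apply_bcontfun m u) \<Longrightarrow> extendable m"
  by (auto simp: extendable_def)

lemma
  assumes "extendable m" "extendable n"
  shows extendable_add: "extendable (m + n)"
    and extend_add: "\<phi> \<in> topspace gammaP \<Longrightarrow> extend_gammaP (m + n) \<phi> = extend_gammaP m \<phi> + extend_gammaP n \<phi>"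
proof -
  have *: "continuous_map gammaP euclidean (\<lambda>\<phi>. extend_gammaP m \<phi> + extend_gammaP n \<phi>)"
    using assms by (intro continuous_map_add continuous_extend)
  show "extendable (m + n)" using assms by (intro extendableI[OF *]) (simp add: extend_point)
  show "extend_gammaP (m + n) \<phi> = extend_gammaP m \<phi> + extend_gammaP n \<phi>" if "\<phi> \<in> topspace gammaP"
    using assms by (intro extend_eqI[OF * _ that]) (simp add: extend_point)
qed

lemma
  assumes "extendable m" "f \<in> alg_carrier C_P"
  shows extendable_bc_scale: "extendable (bc_scale f m)"
    and extend_bc_scale: "\<phi> \<in> topspace gammaP \<Longrightarrow> extend_gammaP (bc_scale f m) \<phi> = \<phi> f *\<^sub>C extend_gammaP m \<phi>"
proof -
  have *: "continuous_map gammaP euclidean (\<lambda>\<phi>. \<phi> f *\<^sub>C extend_gammaP m \<phi>)"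
    using assms by (intro continuous_map_bilinear[OF bounded_bilinear_scaleC] continuous_extend
        continuous_map_gelfand)
  show "extendable (bc_scale f m)" using assms by (intro extendableI[OF *]) (simp add: extend_point)
  show "extend_gammaP (bc_scale f m) \<phi> = \<phi> f *\<^sub>C extend_gammaP m \<phi>" if "\<phi> \<in> topspace gammaP"
    using assms by (intro extend_eqI[OF * _ that]) (simp add: extend_point)
qed

lemma scaleC_eq_bc_scale: "c *\<^sub>C m = bc_scale (c *\<^sub>C step_on bot 1) m"
  by (rule bcontfun_eqI) simp

lemma
  assumes "extendable m"
  shows extendable_scaleC: "extendable (c *\<^sub>C m)"
    and extend_scaleC: "\<phi> \<in> topspace gammaP \<Longrightarrow> extend_gammaP (c *\<^sub>C m) \<phi> = c *\<^sub>C extend_gammaP m \<phi>"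
  unfolding scaleC_eq_bc_scale[of c m]
  using assms by (auto intro!: extendable_bc_scale
      simp: extend_bc_scale char_scaleC char_1 C_P_1 C_P_scaleC)

lemma extendable_step_on: "extendable (step_on a (s :: 'e::complex_normed_vector))"
proof (rule extendableI)
  show "continuous_map gammaP euclidean (\<lambda>\<phi>. \<phi> (step_on a 1) *\<^sub>C s)"
    by (intro continuous_map_bilinear[OF bounded_bilinear_scaleC] continuous_map_gelfand
        C_P_step_on) auto
qed (simp add: C_P_step_on)

lemma
  assumes "extendable m" "extendable n"
  shows extendable_compose: "extendable (m o\<^sub>C n)"
    and extend_compose: "\<phi> \<in> topspace gammaP \<Longrightarrow>
      extend_gammaP (m o\<^sub>C n) \<phi> = extend_gammaP m \<phi> o\<^sub>L extend_gammaP n \<phi>"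
proof -
  have *: "continuous_map gammaP euclidean (\<lambda>\<phi>. extend_gammaP m \<phi> o\<^sub>L extend_gammaP n \<phi>)"
    using assms by (intro continuous_map_bilinear[OF bounded_bilinear_blinfun_compose] continuous_extend)
  show "extendable (m o\<^sub>C n)" using assms by (intro extendableI[OF *]) (simp add: extend_point)
  show "extend_gammaP (m o\<^sub>C n) \<phi> = extend_gammaP m \<phi> o\<^sub>L extend_gammaP n \<phi>" if "\<phi> \<in> topspace gammaP"
    using assms by (intro extend_eqI[OF * _ that]) (simp add: extend_point)
qed

lemma norm_extend_le:
  assumes "extendable m" "\<phi> \<in> topspace gammaP" "\<And>u. norm (apply_bcontfun m u) \<le> r"
  shows "norm (extend_gammaP m \<phi>) \<le> r"
  using continuous_map_closed_on_points[of "extend_gammaP m" "cball 0 r" \<phi>] assms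
  by (simp add: continuous_extend extend_point)

text \<open>By density, extension is isometric. This is the norm clause of
  \<open>in_bounded_product\<close>.\<close>

lemma norm_le_iff_extend:
  assumes "extendable m"
  shows "norm m \<le> r \<longleftrightarrow> (\<forall>\<phi>\<in>topspace gammaP. norm (extend_gammaP m \<phi>) \<le> r)"
proof
  assume "norm m \<le> r"
  then show "\<forall>\<phi>\<in>topspace gammaP. norm (extend_gammaP m \<phi>) \<le> r"
    using norm_extend_le[OF assms] norm_bounded[of m] order_trans by blast
next
  assume *: "\<forall>\<phi>\<in>topspace gammaP. norm (extend_gammaP m \<phi>) \<le> r"
  show "norm m \<le> r"
    by (rule norm_bound) (use * extend_point[OF assms] point_eval_in_gammaP in metis)
qed

lemma extendable_diff: "extendable m \<Longrightarrow> extendable n \<Longrightarrow> extendable (m - n)"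
  for m n :: "'p::poset_topology \<Rightarrow>\<^sub>C 'e::complex_normed_vector"
  using extendable_add[OF _ extendable_scaleC[of n "-1"]] by (simp add: scaleC_minus_left)

lemma extend_diff:
  "extendable m \<Longrightarrow> extendable n \<Longrightarrow> \<phi> \<in> topspace gammaP \<Longrightarrow>
    extend_gammaP (m - n) \<phi> = extend_gammaP m \<phi> - extend_gammaP n \<phi>"
  for m n :: "'p::poset_topology \<Rightarrow>\<^sub>C 'e::complex_normed_vector"
  using extend_add[of "m - n" n \<phi>] by (simp add: extendable_diff)

text \<open>Since extension is isometric, the extensions of a convergent sequence are uniformly
  Cauchy on \<gamma>P; their uniform limit is continuous and restricts to the limit on
  \<open>P\<close>.\<close>

lemma closed_extendable:
  "closed (Collect extendable :: ('p::poset_topology \<Rightarrow>\<^sub>C 'e::{complex_normed_vector,banach}) set)"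
  unfolding closed_sequential_limits
proof (intro allI impI, elim conjE)
  fix f :: "nat \<Rightarrow> 'p \<Rightarrow>\<^sub>C 'e" and l
  assume f: "\<forall>n. f n \<in> Collect extendable" and lim: "f \<longlonglongrightarrow> l"
  have Cauchy: "\<exists>N. \<forall>m n \<phi>. N \<le> m \<longrightarrow> N \<le> n \<longrightarrow> \<phi> \<in> topspace gammaP \<longrightarrow>
      dist (extend_gammaP (f m) \<phi>) (extend_gammaP (f n) \<phi>) < r" if "r > 0" for r
  proof -
    obtain N where N: "\<And>m n. m \<ge> N \<Longrightarrow> n \<ge> N \<Longrightarrow> dist (f m) (f n) < r"
      using LIMSEQ_imp_Cauchy[OF lim] \<open>r > 0\<close> by (meson metric_CauchyD)
    have "dist (extend_gammaP (f m) \<phi>) (extend_gammaP (f n) \<phi>) < r"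
      if "N \<le> m" "N \<le> n" "\<phi> \<in> topspace gammaP" for m n \<phi>
      using norm_le_iff_extend[of "f m - f n" "norm (f m - f n)"] N[OF that(1,2)] f that(3)
      by (force simp: dist_norm extendable_diff extend_diff)
    then show ?thesis by blast
  qed
  have complete: "Met_TC.mcomplete TYPE('e)" by (simp add: complete_UNIV)
  have cont: "\<forall>\<^sub>F n in sequentially. continuous_map gammaP Met_TC.mtopology (extend_gammaP (f n))"
    using f by (simp add: continuous_extend)
  obtain g where g: "continuous_map gammaP euclidean g"
    "\<And>r. 0 < r \<Longrightarrow> \<forall>\<^sub>F n in sequentially. \<forall>\<phi>\<in>topspace gammaP. dist (extend_gammaP (f n) \<phi>) (g \<phi>) < r"
    using Met_TC.continuous_map_uniformly_Cauchy_limit[OF complete cont Cauchy]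
    unfolding mtopology_is_euclidean by blast
  have "g (point_eval u) = apply_bcontfun l u" for u
  proof (rule LIMSEQ_unique)
    show "(\<lambda>n. apply_bcontfun (f n) u) \<longlonglongrightarrow> g (point_eval u)"
    proof (rule tendstoI)
      fix r :: real assume "r > 0"
      from g(2)[OF this]
      show "\<forall>\<^sub>F n in sequentially. dist (apply_bcontfun (f n) u) (g (point_eval u)) < r"
      proof eventually_elim
        case (elim n)
        then have "dist (extend_gammaP (f n) (point_eval u)) (g (point_eval u)) < r" by simp
        then show ?case using f by (simp add: extend_point)
      qed
    qed
    show "(\<lambda>n. apply_bcontfun (f n) u) \<longlonglongrightarrow> apply_bcontfun l u"
      using tendsto_bcontfun_uniform_limit[OF lim] by (rule tendsto_uniform_limitI) simp
  qed
  then show "l \<in> Collect extendable" using g(1) by (auto intro: extendableI)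
qed

section \<open>Modules over the functions on the compactification\<close>

text \<open>The properties shared by \<open>tro_total F\<close> and the carriers of both algebras,
  so that gluing is carried out once.\<close>

definition C_P_module :: "('p::poset_topology \<Rightarrow>\<^sub>C 'e::complex_normed_vector) set \<Rightarrow> bool"
  where "C_P_module S \<longleftrightarrow> csubspace S \<and> closed S \<and> S \<subseteq> Collect extendable \<and>
    (\<forall>f\<in>alg_carrier C_P. \<forall>m\<in>S. bc_scale f m \<in> S)"

text \<open>Compactness and the clopen base reduce membership in a closed module to membership at every
  point: local approximants are glued by \<open>s \<mapsto> e s' + (1 - e) s\<close>.\<close>

lemma C_P_module_local_global:
  assumes S: "C_P_module S" and cpt: "compact_space (gammaP :: (('p::poset_topology \<Rightarrow>\<^sub>C complex) \<Rightarrow> complex) topology)"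
    and x: "extendable (x :: 'p \<Rightarrow>\<^sub>C 'e::complex_normed_vector)"
    and loc: "\<And>\<phi>. \<phi> \<in> topspace gammaP \<Longrightarrow> extend_gammaP x \<phi> \<in> (\<lambda>m. extend_gammaP m \<phi>) ` S"
  shows "x \<in> S"
proof -
  have "\<exists>s\<in>S. dist s x < r" if "r > 0" for r
  proof -
    define Q where "Q \<phi> s e \<longleftrightarrow> s \<in> S \<and> e \<in> idempotents \<and> \<phi> e = 1 \<and>
        (\<forall>u. apply_bcontfun e u = 1 \<longrightarrow> norm (apply_bcontfun (s - x) u) \<le> r / 2)"
      for \<phi> :: "('p \<Rightarrow>\<^sub>C complex) \<Rightarrow> complex" and s e
    have "\<exists>s e. Q \<phi> s e" if \<phi>: "\<phi> \<in> topspace gammaP" for \<phi>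
    proof -
      obtain s where s: "s \<in> S" "extend_gammaP s \<phi> = extend_gammaP x \<phi>"
        using loc[OF \<phi>] by auto
      then have ext: "extendable s" "extendable (s - x)"
        using S x by (auto simp: C_P_module_def extendable_diff)
      let ?W = "{\<psi> \<in> topspace gammaP. extend_gammaP (s - x) \<psi> \<in> ball 0 (r / 2)}"
      have "openin gammaP ?W"
        by (intro openin_continuous_map_preimage[OF continuous_extend[OF ext(2)]]) simp
      moreover have "\<phi> \<in> ?W"
        using \<phi> s \<open>r > 0\<close> ext x by (simp add: extend_diff)
      ultimately obtain e where e: "e \<in> idempotents" "\<phi> e = 1"
        "\<And>\<psi>. \<psi> \<in> topspace gammaP \<Longrightarrow> \<psi> e = 1 \<Longrightarrow> \<psi> \<in> ?W"
        using gammaP_nbhd[of ?W \<phi>] by blast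
      have "norm (apply_bcontfun (s - x) u) \<le> r / 2" if "apply_bcontfun e u = 1" for u
        using e(3)[of "point_eval u"] that e(1) extend_point[OF ext(2), of u]
        by (simp add: idempotents_C_P)
      then show ?thesis using s e unfolding Q_def by blast
    qed
    then obtain s e where "\<And>\<phi>. \<phi> \<in> topspace gammaP \<Longrightarrow> Q \<phi> (s \<phi>) (e \<phi>)"
      by metis
    then have s: "\<And>\<phi>. \<phi> \<in> topspace gammaP \<Longrightarrow> s \<phi> \<in> S"
      and e: "\<And>\<phi>. \<phi> \<in> topspace gammaP \<Longrightarrow> e \<phi> \<in> idempotents" "\<And>\<phi>. \<phi> \<in> topspace gammaP \<Longrightarrow> \<phi> (e \<phi>) = 1"
      and near: "\<And>\<phi> u. \<phi> \<in> topspace gammaP \<Longrightarrow> apply_bcontfun (e \<phi>) u = 1 \<Longrightarrow>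
        norm (apply_bcontfun (s \<phi> - x) u) \<le> r / 2"
      by (auto simp: Q_def)
    \<comment> \<open>Openness is immediate for the condition that the value is not 0; since the
      values are 0 or 1, the set is also where \<open>e \<phi>\<close> is 1.\<close>
    define U where "U \<phi> = {\<psi> \<in> topspace gammaP. \<psi> (e \<phi>) \<in> - {0}}" for \<phi>
    have "openin gammaP (U \<phi>)" if "\<phi> \<in> topspace gammaP" for \<phi>
      unfolding U_def using e(1)[OF that]
      by (intro openin_continuous_map_preimage[OF continuous_map_gelfand])
        (simp_all add: idempotents_C_P open_Compl)
    moreover have "topspace gammaP \<subseteq> \<Union> (U ` topspace gammaP)"
      using e(2) by (fastforce simp: U_def)
    ultimately obtain \<F> where "finite \<F>" "\<F> \<subseteq> U ` topspace gammaP" "topspace gammaP \<subseteq> \<Union> \<F>"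
      using compactinD[OF cpt[unfolded compact_space_def], of "U ` topspace gammaP"] by blast
    then obtain J where J: "finite J" "J \<subseteq> topspace gammaP" "topspace gammaP \<subseteq> \<Union> (U ` J)"
      using finite_subset_image[of \<F> U "topspace gammaP"] by blast
    have "\<exists>t\<in>S. \<forall>u. (\<exists>\<phi>\<in>J. apply_bcontfun (e \<phi>) u = 1) \<longrightarrow> norm (apply_bcontfun (t - x) u) \<le> r / 2"
      using J(1,2)
    proof (induction J)
      case empty
      then show ?case using S by (auto simp: C_P_module_def csubspace_def)
    next
      case (insert \<phi> J)
      then obtain t where t: "t \<in> S"
        "\<And>u \<phi>. \<phi> \<in> J \<Longrightarrow> apply_bcontfun (e \<phi>) u = 1 \<Longrightarrow> norm (apply_bcontfun (t - x) u) \<le> r / 2"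
        by auto
      have \<phi>: "\<phi> \<in> topspace gammaP" using insert.prems by simp
      let ?t = "bc_scale (e \<phi>) (s \<phi>) + (t - bc_scale (e \<phi>) t)"
      have "?t \<in> S"
        using S t(1) s[OF \<phi>] idempotents_C_P[OF e(1)[OF \<phi>]]
        by (auto simp: C_P_module_def csubspace_def csubspace_diff)
      moreover have "norm (apply_bcontfun (?t - x) u) \<le> r / 2"
        if "\<psi> \<in> insert \<phi> J" "apply_bcontfun (e \<psi>) u = 1" for u \<psi>
      proof -
        have "apply_bcontfun (e \<phi>) u = 0 \<or> apply_bcontfun (e \<phi>) u = 1"
          using e(1)[OF \<phi>] by (auto simp: idempotents_def)
        then show ?thesis
          using near[OF \<phi>, of u] t(2)[of \<psi> u] that by auto
      qed
      ultimately show ?case by blast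
    qed
    then obtain t where t: "t \<in> S"
      "\<And>u \<phi>. \<phi> \<in> J \<Longrightarrow> apply_bcontfun (e \<phi>) u = 1 \<Longrightarrow> norm (apply_bcontfun (t - x) u) \<le> r / 2"
      by blast
    have "norm (t - x) \<le> r / 2"
    proof (rule norm_bound)
      fix u
      have "point_eval u \<in> \<Union> (U ` J)"
        using J(3) by (rule subsetD) simp
      then obtain \<phi> where \<phi>: "\<phi> \<in> J" "point_eval u (e \<phi>) \<noteq> 0"
        by (auto simp: U_def)
      then have "apply_bcontfun (e \<phi>) u = 1"
        using e(1)[OF subsetD[OF J(2) \<phi>(1)]] by (auto simp: idempotents_def)
      then show "norm (apply_bcontfun (t - x) u) \<le> r / 2" by (rule t(2)[OF \<phi>(1)])
    qed
    then show ?thesis using t(1) \<open>r > 0\<close> by (intro bexI[of _ t]) (auto simp: dist_norm)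
  qed
  then have "x \<in> closure S" by (simp add: closure_approachable)
  then show ?thesis using S by (simp add: C_P_module_def)
qed

text \<open>By continuity the norm of the extension stays below the bound on a clopen neighbourhood
  of \<open>\<phi>\<close>; cutting \<open>m\<close> off outside of it keeps the value at
  \<open>\<phi>\<close>.\<close>

lemma C_P_module_lift:
  assumes S: "C_P_module S" and m: "m \<in> S" and \<phi>: "\<phi> \<in> topspace gammaP" and "\<epsilon> > 0"
  shows "\<exists>n\<in>S. extend_gammaP n \<phi> = extend_gammaP m \<phi> \<and> norm n \<le> norm (extend_gammaP m \<phi>) + \<epsilon>"
proof -
  have ext: "extendable m" using S m by (auto simp: C_P_module_def)
  let ?r = "norm (extend_gammaP m \<phi>) + \<epsilon>"
  let ?W = "{\<psi> \<in> topspace gammaP. extend_gammaP m \<psi> \<in> ball 0 ?r}"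
  have "openin gammaP ?W"
    by (intro openin_continuous_map_preimage[OF continuous_extend[OF ext]]) simp
  moreover have "\<phi> \<in> ?W" using \<phi> \<open>\<epsilon> > 0\<close> by simp
  ultimately obtain e where e: "e \<in> idempotents" "\<phi> e = 1"
    "\<And>\<psi>. \<psi> \<in> topspace gammaP \<Longrightarrow> \<psi> e = 1 \<Longrightarrow> \<psi> \<in> ?W"
    using gammaP_nbhd[of ?W \<phi>] by blast
  have eC: "e \<in> alg_carrier C_P" using e(1) by (rule idempotents_C_P)
  have "norm (bc_scale e m) \<le> ?r"
  proof (rule norm_bound)
    fix u
    consider "apply_bcontfun e u = 0" | "apply_bcontfun e u = 1"
      using e(1) by (auto simp: idempotents_def)
    then show "norm (apply_bcontfun (bc_scale e m) u) \<le> ?r"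
    proof cases
      case 2
      then show ?thesis
        using e(3)[of "point_eval u"] eC extend_point[OF ext, of u] by simp
    qed (use \<open>\<epsilon> > 0\<close> in \<open>simp add: add_nonneg_nonneg\<close>)
  qed
  moreover have "extend_gammaP (bc_scale e m) \<phi> = extend_gammaP m \<phi>"
    using extend_bc_scale[OF ext eC \<phi>] e(2) by simp
  moreover have "bc_scale e m \<in> S" using S eC m by (simp add: C_P_module_def)
  ultimately show ?thesis by blast
qed

lemma csubspace_fibre:
  fixes S :: "('p::poset_topology \<Rightarrow>\<^sub>C 'e::complex_normed_vector) set"
  assumes S: "C_P_module S" and \<phi>: "\<phi> \<in> topspace gammaP"
  shows "csubspace ((\<lambda>m. extend_gammaP m \<phi>) ` S)"
  unfolding csubspace_def
proof (intro conjI ballI allI)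
  have S': "csubspace S" and ext: "\<And>m. m \<in> S \<Longrightarrow> extendable m"
    using S by (auto simp: C_P_module_def)
  then have S0: "0 \<in> S" by (simp add: csubspace_def)
  then have "extend_gammaP (0 :: 'p \<Rightarrow>\<^sub>C 'e) \<phi> = 0"
    using extend_scaleC[OF ext \<phi>, of 0 0] by simp
  then show "0 \<in> (\<lambda>m. extend_gammaP m \<phi>) ` S" using S0 by force
  show "x + y \<in> (\<lambda>m. extend_gammaP m \<phi>) ` S"
    if "x \<in> (\<lambda>m. extend_gammaP m \<phi>) ` S" "y \<in> (\<lambda>m. extend_gammaP m \<phi>) ` S" for x y
    using that S' extend_add[OF ext ext \<phi>] by (auto simp: csubspace_def image_iff) metis
  show "c *\<^sub>C x \<in> (\<lambda>m. extend_gammaP m \<phi>) ` S" if "x \<in> (\<lambda>m. extend_gammaP m \<phi>) ` S" for c x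
    using that S' extend_scaleC[OF ext \<phi>] by (auto simp: csubspace_def image_iff) metis
qed

text \<open>As for quotient maps of Banach spaces: points near the fibre are reached by a series of lifts
  of geometrically decreasing norm.\<close>

lemma closed_fibre:
  fixes S :: "('p::poset_topology \<Rightarrow>\<^sub>C 'e::{complex_normed_vector,banach}) set"
  assumes S: "C_P_module S" and \<phi>: "\<phi> \<in> topspace gammaP"
  shows "closed ((\<lambda>m. extend_gammaP m \<phi>) ` S)"
  unfolding closure_subset_eq[symmetric]
proof
  let ?N = "(\<lambda>m. extend_gammaP m \<phi>) ` S"
  have S': "csubspace S" "closed S" and ext: "\<And>m. m \<in> S \<Longrightarrow> extendable m"
    using S by (auto simp: C_P_module_def)
  fix y assume y: "y \<in> closure ?N"
  define P where "P n x \<longleftrightarrow> x \<in> S \<and> dist (extend_gammaP x \<phi>) y < (1/2) ^ n" for n :: nat and x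
  have step: "\<exists>x'. P (Suc n) x' \<and> norm (x' - x) \<le> 2 * (1/2) ^ n" if x: "P n x" for n x
  proof -
    have pos: "(1/2::real) ^ Suc n > 0" by simp
    then obtain t where t: "t \<in> S" "dist (extend_gammaP t \<phi>) y < (1/2) ^ Suc n"
      using y unfolding closure_approachable by blast
    \<comment> \<open>The distances of the two values to \<open>y\<close> are below
      \<open>(1/2) ^ n\<close> and half of it. The tolerance of the lift adds another half, which
      gives the factor 2 in \<open>step\<close>.\<close>
    have d: "norm (extend_gammaP (t - x) \<phi>) < (3/2) * (1/2) ^ n"
      using x t dist_triangle2[of "extend_gammaP t \<phi>" "extend_gammaP x \<phi>" y] \<phi>
      by (simp add: P_def extend_diff ext dist_norm)
    have "t - x \<in> S" using x t S' by (simp add: P_def csubspace_diff)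
    \<comment> \<open>The section \<open>t\<close> may be far from \<open>x\<close> in norm;
      \<open>x + n'\<close> has the same value as \<open>t\<close> at \<open>\<phi>\<close> and
      stays near \<open>x\<close>.\<close>
    from C_P_module_lift[OF S this \<phi> pos] obtain n' where n': "n' \<in> S"
      "extend_gammaP n' \<phi> = extend_gammaP (t - x) \<phi>" "norm n' \<le> norm (extend_gammaP (t - x) \<phi>) + (1/2) ^ Suc n"
      by blast
    have xS: "x \<in> S" using x by (simp add: P_def)
    have "extend_gammaP (x + n') \<phi> = extend_gammaP t \<phi>"
      using xS t(1) n' \<phi> by (simp add: extend_add extend_diff ext)
    moreover have "x + n' \<in> S" using xS n'(1) S' by (simp add: csubspace_def)
    ultimately have "P (Suc n) (x + n')" using t by (simp add: P_def)
    then show ?thesis using n'(3) d by (intro exI[of _ "x + n'"]) simp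
  qed
  have "\<exists>x. P 0 x"
    using y unfolding closure_approachable P_def by (auto dest: spec[of _ 1])
  then obtain X where X: "\<And>n. P n (X n)" "\<And>n. norm (X (Suc n) - X n) \<le> 2 * (1/2) ^ n"
    using dependent_nat_choice[of P "\<lambda>n x x'. norm (x' - x) \<le> 2 * (1/2) ^ n"] step by metis
  have lim0: "(\<lambda>n. (1/2::real) ^ n) \<longlonglongrightarrow> 0" by (rule LIMSEQ_power_zero) simp
  have "Cauchy X"
  \<comment> \<open>The increments of this sequence are exactly
    \<open>2 * (1/2) ^ n\<close>.\<close>
  proof (rule Cauchy_dominated[where s = "\<lambda>n. - 4 * (1/2) ^ n"])
    show "convergent (\<lambda>n. - 4 * (1/2::real) ^ n)"
      by (rule convergentI[of _ "- 4 * 0"]) (intro tendsto_intros lim0)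
  qed (use X(2) in simp)
  then obtain x where x: "X \<longlonglongrightarrow> x"
    using complete_UNIV_bcontfun unfolding complete_def by (metis UNIV_I)
  have xS: "x \<in> S"
    using closed_sequentially[OF S'(2) _ x] X(1) by (auto simp: P_def)
  have "(\<lambda>n. extend_gammaP (X n) \<phi>) \<longlonglongrightarrow> extend_gammaP x \<phi>"
  proof (rule metric_tendsto_imp_tendsto[OF x], rule always_eventually, rule allI)
    fix n
    have "X n \<in> S" using X(1) by (simp add: P_def)
    then show "dist (extend_gammaP (X n) \<phi>) (extend_gammaP x \<phi>) \<le> dist (X n) x"
      using norm_le_iff_extend[of "X n - x" "norm (X n - x)"] xS \<phi>
      by (force simp: dist_norm extendable_diff extend_diff ext)
  qed
  moreover have "(\<lambda>n. extend_gammaP (X n) \<phi>) \<longlonglongrightarrow> y"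
  proof (rule tendsto_dist_iff[THEN iffD2], rule tendsto_sandwich[OF _ _ tendsto_const lim0])
  qed (use X(1) in \<open>auto simp: P_def intro!: always_eventually less_imp_le\<close>)
  ultimately have "y = extend_gammaP x \<phi>" by (rule LIMSEQ_unique[symmetric])
  then show "y \<in> ?N" using xS by blast
qed

section \<open>Operator-valued functions\<close>

lemma closed_pointwise:
  assumes "closed C"
  shows "closed {f :: 'a::topological_space \<Rightarrow>\<^sub>C 'b::metric_space. \<forall>x. apply_bcontfun f x \<in> C}"
  unfolding closed_sequential_limits
proof (intro allI impI, elim conjE)
  fix f :: "nat \<Rightarrow> 'a \<Rightarrow>\<^sub>C 'b" and l
  assume f: "\<forall>n. f n \<in> {f. \<forall>x. apply_bcontfun f x \<in> C}" and lim: "f \<longlonglongrightarrow> l"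
  have "apply_bcontfun l x \<in> C" for x
  proof (rule closed_sequentially[OF assms])
    show "(\<lambda>n. apply_bcontfun (f n) x) \<longlonglongrightarrow> apply_bcontfun l x"
      using tendsto_bcontfun_uniform_limit[OF lim] by (rule tendsto_uniform_limitI) simp
  qed (use f in simp)
  then show "l \<in> {f. \<forall>x. apply_bcontfun f x \<in> C}" by simp
qed

lemma bounded_ops_add: "S \<in> bounded_ops \<Longrightarrow> T \<in> bounded_ops \<Longrightarrow> S + T \<in> bounded_ops"
  and bounded_ops_scaleC: "S \<in> bounded_ops \<Longrightarrow> c *\<^sub>C S \<in> bounded_ops"
  and bounded_ops_0: "0 \<in> bounded_ops"
  using csubspace_bounded_ops by (auto simp: csubspace_def)

lemma Cb_opsD: "f \<in> Cb_ops \<Longrightarrow> apply_bcontfun f u \<in> bounded_ops"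
  by (simp add: Cb_ops_def)

lemma Cb_ops_add: "f \<in> Cb_ops \<Longrightarrow> g \<in> Cb_ops \<Longrightarrow> f + g \<in> Cb_ops"
  and Cb_ops_scaleC: "f \<in> Cb_ops \<Longrightarrow> c *\<^sub>C f \<in> Cb_ops"
  and Cb_ops_0: "0 \<in> Cb_ops"
  by (simp_all add: Cb_ops_def bounded_ops_add bounded_ops_scaleC bounded_ops_0)

lemma closed_Cb_ops: "closed Cb_ops"
  unfolding Cb_ops_def by (rule closed_pointwise[OF closed_bounded_ops])

text \<open>\<open>bc_adj\<close> goes through \<open>Bcontfun\<close> and has a meaning only for
  bounded continuous functions; both properties hold because \<open>adj\<close> is isometric and
  continuous on \<open>bounded_ops\<close>.\<close>

lemma apply_bc_adj:
  assumes f: "f \<in> Cb_ops"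
  shows "apply_bcontfun (bc_adj f) u = adj (apply_bcontfun f u)"
proof -
  have "continuous_on UNIV (\<lambda>u. adj (apply_bcontfun f u))"
    using f by (intro continuous_on_compose2[OF continuous_on_adj]) (auto simp: Cb_ops_def)
  moreover have "norm (adj (apply_bcontfun f u)) \<le> norm f" for u
    by (simp add: norm_adj Cb_opsD[OF f] norm_bounded)
  ultimately have "(\<lambda>u. adj (apply_bcontfun f u)) \<in> bcontfun"
    by (rule bcontfun_normI)
  then show ?thesis
    unfolding bc_adj_def by (simp add: Bcontfun_inverse)
qed

lemma bc_adj_Cb_ops: "f \<in> Cb_ops \<Longrightarrow> bc_adj f \<in> Cb_ops"
  by (subst Cb_ops_def) (simp add: apply_bc_adj Cb_opsD)

lemma compose_Cb_ops: "f \<in> Cb_ops \<Longrightarrow> g \<in> Cb_ops \<Longrightarrow> f o\<^sub>C g \<in> Cb_ops"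
  by (simp add: Cb_ops_def bounded_ops_compose)

lemma bc_adj_adj: "f \<in> Cb_ops \<Longrightarrow> bc_adj (bc_adj f) = f"
  by (rule bcontfun_eqI) (simp add: apply_bc_adj bc_adj_Cb_ops adj_adj Cb_opsD)

lemma bc_adj_compose: "f \<in> Cb_ops \<Longrightarrow> g \<in> Cb_ops \<Longrightarrow> bc_adj (f o\<^sub>C g) = bc_adj g o\<^sub>C bc_adj f"
  by (rule bcontfun_eqI) (simp add: apply_bc_adj compose_Cb_ops adj_compose Cb_opsD)

lemma bc_adj_scaleC: "f \<in> Cb_ops \<Longrightarrow> bc_adj (c *\<^sub>C f) = cnj c *\<^sub>C bc_adj f"
  by (intro bcontfun_eqI) (simp add: apply_bc_adj adj_scaleC Cb_opsD Cb_ops_scaleC)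

lemma norm_bc_adj: assumes "f \<in> Cb_ops" shows "norm (bc_adj f) = norm f"
  by (intro antisym norm_bound)
    (use assms norm_bounded[of f] norm_bounded[of "bc_adj f"] in
      \<open>auto simp: apply_bc_adj norm_adj Cb_opsD intro: order_trans\<close>)

lemma norm_bc_compose_le: "norm (f o\<^sub>C g) \<le> norm f * norm g"
  by (rule norm_bound)
    (simp add: order_trans[OF norm_blinfun_compose] mult_mono norm_bounded)

lemma norm_sq_bc_adj: assumes f: "f \<in> Cb_ops" shows "norm (bc_adj f o\<^sub>C f) = (norm f)\<^sup>2"
proof (rule antisym)
  show "norm (bc_adj f o\<^sub>C f) \<le> (norm f)\<^sup>2"
    using norm_bc_compose_le[of "bc_adj f" f] by (simp add: norm_bc_adj f power2_eq_square)
  have "norm f \<le> sqrt (norm (bc_adj f o\<^sub>C f))"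
  proof (rule norm_bound)
    fix u
    have "(norm (apply_bcontfun f u))\<^sup>2 = norm (apply_bcontfun (bc_adj f o\<^sub>C f) u)"
      by (simp add: apply_bc_adj f norm_adj_compose Cb_opsD)
    also have "\<dots> \<le> norm (bc_adj f o\<^sub>C f)" by (rule norm_bounded)
    finally show "norm (apply_bcontfun f u) \<le> sqrt (norm (bc_adj f o\<^sub>C f))"
      by (rule real_le_rsqrt)
  qed
  then have "(norm f)\<^sup>2 \<le> (sqrt (norm (bc_adj f o\<^sub>C f)))\<^sup>2" by (intro power_mono) auto
  then show "(norm f)\<^sup>2 \<le> norm (bc_adj f o\<^sub>C f)" by simp
qed

lemma norm_sq_bc_adj': "f \<in> Cb_ops \<Longrightarrow> norm (f o\<^sub>C bc_adj f) = (norm f)\<^sup>2"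
  using norm_sq_bc_adj[of "bc_adj f"] by (simp add: bc_adj_adj bc_adj_Cb_ops norm_bc_adj)

lemma bounded_bilinear_bc_compose: "bounded_bilinear (o\<^sub>C)"
proof
  show "\<exists>K. \<forall>a b. norm (a o\<^sub>C b) \<le> norm a * norm b * K"
    by (rule exI[of _ 1]) (simp add: norm_bc_compose_le)
qed (auto intro!: bcontfun_eqI blinfun_eqI simp: blinfun.add_left blinfun.add_right
    blinfun.scaleR_left blinfun.scaleR_right)

lemma
  shows bc_compose_assoc: "(f o\<^sub>C g) o\<^sub>C h = f o\<^sub>C (g o\<^sub>C h)"
    and bc_compose_scaleC_left: "(c *\<^sub>C f') o\<^sub>C g = c *\<^sub>C (f' o\<^sub>C g)"
  by (auto intro!: bcontfun_eqI blinfun_eqI)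

lemma bc_compose_scaleC_right: "f \<in> Cb_ops \<Longrightarrow> f o\<^sub>C (c *\<^sub>C g) = c *\<^sub>C (f o\<^sub>C g)"
  by (auto intro!: bcontfun_eqI blinfun_eqI simp: bounded_ops_apply Cb_opsD)

lemma
  shows blinfun_compose_scaleC_left: "(c *\<^sub>C S') o\<^sub>L T = c *\<^sub>C (S' o\<^sub>L T)"
    and blinfun_compose_assoc': "(S o\<^sub>L T) o\<^sub>L R = S o\<^sub>L (T o\<^sub>L R)"
  by (auto intro!: blinfun_eqI)

lemma blinfun_compose_scaleC_right: "S \<in> bounded_ops \<Longrightarrow> S o\<^sub>L (c *\<^sub>C T) = c *\<^sub>C (S o\<^sub>L T)"
  by (auto intro!: blinfun_eqI simp: bounded_ops_apply)

lemmas bc_compose_add =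
  bounded_bilinear.add_left[OF bounded_bilinear_bc_compose]
  bounded_bilinear.add_right[OF bounded_bilinear_bc_compose]

lemmas blinfun_compose_add =
  bounded_bilinear.add_left[OF bounded_bilinear_blinfun_compose]
  bounded_bilinear.add_right[OF bounded_bilinear_blinfun_compose]

lemma extend_bounded_ops:
  assumes "f \<in> Cb_ops" "extendable f" "\<phi> \<in> topspace gammaP"
  shows "extend_gammaP f \<phi> \<in> bounded_ops"
  using continuous_map_closed_on_points[of "extend_gammaP f", OF _ closed_bounded_ops] assms continuous_extend[OF assms(2)]
  by (simp add: extend_point Cb_opsD)

text \<open>The adjoint is continuous only on \<open>bounded_ops\<close>, so the extension must
  first be seen to take its values in this closed set.\<close>

lemma
  assumes f: "f \<in> Cb_ops" "extendable f"
  shows extendable_bc_adj: "extendable (bc_adj f)"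
    and extend_bc_adj: "\<phi> \<in> topspace gammaP \<Longrightarrow> extend_gammaP (bc_adj f) \<phi> = adj (extend_gammaP f \<phi>)"
proof -
  have "continuous_map gammaP (top_of_set bounded_ops) (extend_gammaP f)"
    using f by (auto intro!: continuous_map_into_subtopology continuous_extend extend_bounded_ops)
  then have "continuous_map gammaP euclidean (adj \<circ> extend_gammaP f)"
    by (rule continuous_map_compose) (simp add: continuous_on_adj)
  then have *: "continuous_map gammaP euclidean (\<lambda>\<phi>. adj (extend_gammaP f \<phi>))"
    by (simp add: comp_def)
  show "extendable (bc_adj f)"
    using f by (intro extendableI[OF *]) (simp add: extend_point apply_bc_adj)
  show "extend_gammaP (bc_adj f) \<phi> = adj (extend_gammaP f \<phi>)" if "\<phi> \<in> topspace gammaP"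
    using f by (intro extend_eqI[OF * _ that]) (simp add: extend_point apply_bc_adj)
qed

text \<open>An upper bound for everything generated: it meets the closure conditions that define M,
  A and B, whose elements therefore extend to \<gamma>P.\<close>

definition extendable_ops ::
    "('p::poset_topology \<Rightarrow>\<^sub>C ('a::chilbert_space \<Rightarrow>\<^sub>L 'b::chilbert_space)) set"
  where "extendable_ops = Cb_ops \<inter> Collect extendable"

lemma extendable_0: "extendable 0"
  by (rule extendableI[of "\<lambda>_. 0"]) auto

lemma csubspace_extendable_ops: "csubspace extendable_ops"
  by (simp add: extendable_ops_def csubspace_def extendable_add extendable_scaleC extendable_0
      Cb_ops_add Cb_ops_scaleC Cb_ops_0)

lemma closed_extendable_ops: "closed extendable_ops"
  unfolding extendable_ops_def by (intro closed_Int closed_Cb_ops closed_extendable)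

lemma step_on_extendable_ops: "s \<in> bounded_ops \<Longrightarrow> step_on a s \<in> extendable_ops"
  by (auto simp: extendable_ops_def Cb_ops_def extendable_step_on bounded_ops_0)

lemma compose_extendable_ops:
  "f \<in> extendable_ops \<Longrightarrow> g \<in> extendable_ops \<Longrightarrow> f o\<^sub>C g \<in> extendable_ops"
  by (simp add: extendable_ops_def compose_Cb_ops extendable_compose)

lemma bc_adj_extendable_ops: "f \<in> extendable_ops \<Longrightarrow> bc_adj f \<in> extendable_ops"
  by (simp add: extendable_ops_def bc_adj_Cb_ops extendable_bc_adj)

lemma bc_scale_extendable_ops:
  "f \<in> alg_carrier C_P \<Longrightarrow> m \<in> extendable_ops \<Longrightarrow> bc_scale f m \<in> extendable_ops"
  by (auto simp: extendable_ops_def Cb_ops_def extendable_bc_scale bounded_ops_scaleC)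

section \<open>Positive elements\<close>

lemma closed_self_adjoint: "closed {T \<in> bounded_ops. adj T = T}"
  unfolding closed_sequential_limits
proof (intro allI impI, elim conjE)
  fix f :: "nat \<Rightarrow> 'a \<Rightarrow>\<^sub>L 'a" and l
  assume f: "\<forall>n. f n \<in> {T \<in> bounded_ops. adj T = T}" and lim: "f \<longlonglongrightarrow> l"
  have l: "l \<in> bounded_ops"
    using closed_sequentially[OF closed_bounded_ops _ lim] f by simp
  have "(\<lambda>n. adj (f n)) \<longlonglongrightarrow> adj l"
    using f by (intro continuous_on_tendsto_compose[OF continuous_on_adj lim l]) simp
  moreover have "adj (f n) = f n" for n using f by simp
  ultimately have "f \<longlonglongrightarrow> adj l" by (simp only:)
  then have "adj l = l" using lim by (rule LIMSEQ_unique)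
  then show "l \<in> {T \<in> bounded_ops. adj T = T}" using l by simp
qed

text \<open>\<open>alg_positive\<close> asks for a factor inside the algebra, whereas
  \<open>m\<close> maps between different spaces. The root is taken in the self-adjoint part of
  \<open>A\<close>, a real subspace only, where a square \<open>S o\<^sub>L S\<close> is also
  \<open>adj S o\<^sub>L S\<close>.\<close>

lemma positive_ops_root:
  fixes m :: "'a::chilbert_space \<Rightarrow>\<^sub>L 'b::chilbert_space"
  assumes A: "csubspace A" "closed A" "A \<subseteq> bounded_ops" "\<And>x y. x \<in> A \<Longrightarrow> y \<in> A \<Longrightarrow> x o\<^sub>L y \<in> A"
    and m: "m \<in> bounded_ops" "m o\<^sub>L adj m \<in> A"
  shows "\<exists>y\<in>A. m o\<^sub>L adj m = adj y o\<^sub>L y"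
proof (cases "m = 0")
  case True
  then show ?thesis using A(1) by (intro bexI[of _ 0]) (auto simp: csubspace_def)
next
  case False
  \<comment> \<open>Normalises \<open>m\<close> to norm 1, as the iteration requires, and is undone
    at the end; \<open>c\<close> is real, so it passes through adjoints.\<close>
  define c where "c = complex_of_real (inverse (norm m))"
  have c: "c \<noteq> 0" "cnj c = c" "cmod c * norm m = 1" using False by (auto simp: c_def norm_inverse)
  have cc: "inverse c * inverse c * (c * c) = 1" using c(1) by (simp add: field_simps)
  define m' where "m' = c *\<^sub>C m"
  have m': "m' \<in> bounded_ops" "norm m' \<le> 1"
    using c m by (auto simp: m'_def norm_scaleC bounded_ops_scaleC)
  have T: "m' o\<^sub>L adj m' = (c * c) *\<^sub>C (m o\<^sub>L adj m)"
    using m(1) c(2) by (simp add: m'_def adj_scaleC blinfun_compose_scaleC_left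
        blinfun_compose_scaleC_right scaleC_scaleC)
  have "\<exists>S\<in>A \<inter> {T \<in> bounded_ops. adj T = T}. S o\<^sub>L S = m' o\<^sub>L adj m'"
  proof (rule square_root_exists[where mul = "(o\<^sub>L)" and e = id_blinfun])
    show "subspace (A \<inter> {T \<in> bounded_ops. adj T = T})"
    proof (rule csubspace_imp_subspace[of A, THEN subspace_inter])
      show "subspace {T \<in> bounded_ops. adj T = (T :: 'b \<Rightarrow>\<^sub>L 'b)}"
        by (auto simp: subspace_def bounded_ops_0 bounded_ops_add adj_add scaleR_scaleC
            bounded_ops_scaleC adj_scaleC)
    qed fact
    show "closed (A \<inter> {T \<in> bounded_ops. adj T = T})"
      by (intro closed_Int A closed_self_adjoint)
    show "x o\<^sub>L x \<in> A \<inter> {T \<in> bounded_ops. adj T = T}"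
      if "x \<in> A \<inter> {T \<in> bounded_ops. adj T = T}" for x
      using that A by (auto simp: bounded_ops_compose adj_compose)
    have "m' o\<^sub>L adj m' \<in> A" using A(1) m(2) by (simp add: T csubspace_def)
    then show "m' o\<^sub>L adj m' \<in> A \<inter> {T \<in> bounded_ops. adj T = T}"
      using m' by (auto simp: bounded_ops_compose adj_compose adj_adj)
    show "norm (id_blinfun - (m' o\<^sub>L adj m')) \<le> 1"
      using m' by (rule norm_id_diff_compose_adj)
  qed (auto simp: complete_UNIV bounded_bilinear_blinfun_compose norm_blinfun_compose
      intro!: blinfun_eqI)
  then obtain S where S: "S \<in> A" "S \<in> bounded_ops" "adj S = S" "S o\<^sub>L S = m' o\<^sub>L adj m'" by blast
  have "adj (inverse c *\<^sub>C S) o\<^sub>L (inverse c *\<^sub>C S) = (inverse c * inverse c) *\<^sub>C (S o\<^sub>L S)"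
    using S c(2) by (simp add: adj_scaleC blinfun_compose_scaleC_left
        blinfun_compose_scaleC_right scaleC_scaleC)
  also have "\<dots> = m o\<^sub>L adj m"
    by (simp add: S(4) T scaleC_scaleC cc)
  finally show ?thesis
    using S(1) A(1) by (intro bexI[of _ "inverse c *\<^sub>C S"]) (auto simp: csubspace_def)
qed

text \<open>The root is found by an iteration in the function space itself, not point by point,
  since only this keeps it in the closed algebra \<open>A\<close>.\<close>

lemma positive_Cb_ops_root:
  fixes m :: "'p::topological_space \<Rightarrow>\<^sub>C ('a::chilbert_space \<Rightarrow>\<^sub>L 'b::chilbert_space)"
  assumes A: "csubspace A" "closed A" "A \<subseteq> Cb_ops" "\<And>x y. x \<in> A \<Longrightarrow> y \<in> A \<Longrightarrow> x o\<^sub>C y \<in> A"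
    and m: "m \<in> Cb_ops" "m o\<^sub>C bc_adj m \<in> A"
  shows "\<exists>y\<in>A. m o\<^sub>C bc_adj m = bc_adj y o\<^sub>C y"
proof (cases "m = 0")
  case True
  have "apply_bcontfun m u o\<^sub>L adj (apply_bcontfun m u) = 0" for u
    using True by (auto intro!: blinfun_eqI)
  moreover have "(0 :: 'b \<Rightarrow>\<^sub>L 'b) = adj 0 o\<^sub>L 0" by (auto intro!: blinfun_eqI)
  ultimately have "m o\<^sub>C bc_adj m = bc_adj 0 o\<^sub>C 0"
    using m by (intro bcontfun_eqI) (simp add: apply_bc_adj Cb_ops_0)
  then show ?thesis using A(1) by (intro bexI[of _ 0]) (auto simp: csubspace_def)
next
  case False
  define c where "c = complex_of_real (inverse (norm m))"
  have c: "c \<noteq> 0" "cnj c = c" "cmod c * norm m = 1" using False by (auto simp: c_def norm_inverse)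
  have cc: "inverse c * inverse c * (c * c) = 1" using c(1) by (simp add: field_simps)
  define m' where "m' = c *\<^sub>C m"
  have m': "m' \<in> Cb_ops" "norm m' \<le> 1"
    using c m by (auto simp: m'_def norm_scaleC Cb_ops_scaleC)
  have T: "m' o\<^sub>C bc_adj m' = (c * c) *\<^sub>C (m o\<^sub>C bc_adj m)"
    using m(1) c(2) by (simp add: m'_def bc_adj_scaleC bc_compose_scaleC_left
        bc_compose_scaleC_right scaleC_scaleC)
  let ?B = "A \<inter> {f. \<forall>u. apply_bcontfun f u \<in> {T \<in> bounded_ops. adj T = T}}"
  have "\<exists>S\<in>?B. S o\<^sub>C S = m' o\<^sub>C bc_adj m'"
  proof (rule square_root_exists[where mul = "(o\<^sub>C)" and e = "const_bcontfun id_blinfun"])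
    show "subspace ?B"
    proof (rule csubspace_imp_subspace[of A, THEN subspace_inter])
      show "subspace {f :: 'p \<Rightarrow>\<^sub>C ('b \<Rightarrow>\<^sub>L 'b). \<forall>u. apply_bcontfun f u \<in> {T \<in> bounded_ops. adj T = T}}"
        by (auto simp: subspace_def bounded_ops_0 bounded_ops_add adj_add scaleR_scaleC
            bounded_ops_scaleC adj_scaleC)
    qed fact
    show "closed ?B"
      by (intro closed_Int A closed_pointwise closed_self_adjoint)
    show "x o\<^sub>C x \<in> ?B" if "x \<in> ?B" for x
      using that A by (auto simp: bounded_ops_compose adj_compose)
    have "m' o\<^sub>C bc_adj m' \<in> A" using A(1) m(2) by (simp add: T csubspace_def)
    then show "m' o\<^sub>C bc_adj m' \<in> ?B"
      using m' by (auto simp: apply_bc_adj Cb_opsD bounded_ops_compose adj_compose adj_adj)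
    show "norm (const_bcontfun id_blinfun - (m' o\<^sub>C bc_adj m')) \<le> 1"
    proof (rule norm_bound)
      fix u
      have "norm (apply_bcontfun m' u) \<le> 1" using m'(2) norm_bounded[of m' u] by linarith
      then show "norm (apply_bcontfun (const_bcontfun id_blinfun - (m' o\<^sub>C bc_adj m')) u) \<le> 1"
        using m' norm_id_diff_compose_adj[of "apply_bcontfun m' u"]
        by (simp add: apply_bc_adj Cb_opsD)
    qed
  qed (auto simp: complete_UNIV_bcontfun bounded_bilinear_bc_compose norm_bc_compose_le
      intro!: bcontfun_eqI blinfun_eqI)
  then obtain S where S: "S \<in> A" "S \<in> Cb_ops" "\<And>u. adj (apply_bcontfun S u) = apply_bcontfun S u"
    "S o\<^sub>C S = m' o\<^sub>C bc_adj m'" by (auto simp: Cb_ops_def)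
  then have adjS: "bc_adj S = S" by (intro bcontfun_eqI) (simp add: apply_bc_adj)
  have "bc_adj (inverse c *\<^sub>C S) o\<^sub>C (inverse c *\<^sub>C S) = (inverse c * inverse c) *\<^sub>C (S o\<^sub>C S)"
    using S adjS c(2) by (simp add: bc_adj_scaleC bc_compose_scaleC_left
        bc_compose_scaleC_right scaleC_scaleC)
  also have "\<dots> = m o\<^sub>C bc_adj m"
    by (simp add: S(4) T scaleC_scaleC cc)
  finally show ?thesis
    using S(1) A(1) by (intro bexI[of _ "inverse c *\<^sub>C S"]) (auto simp: csubspace_def)
qed

section \<open>Ternary rings of operators as Hilbert bimodules\<close>

lemma closed_cspan_superset: "X \<subseteq> closed_cspan X"
  and csubspace_closed_cspan: "csubspace (closed_cspan X)"
  and closed_closed_cspan: "closed (closed_cspan X)"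
  and closed_cspan_minimal: "X \<subseteq> S \<Longrightarrow> csubspace S \<Longrightarrow> closed S \<Longrightarrow> closed_cspan X \<subseteq> S"
  by (auto simp: closed_cspan_def csubspace_def)

lemma TRO_D:
  assumes "TRO N"
  shows "N \<subseteq> bounded_ops" "csubspace N" "closed N"
    "m \<in> N \<Longrightarrow> n \<in> N \<Longrightarrow> r \<in> N \<Longrightarrow> m o\<^sub>L adj n o\<^sub>L r \<in> N"
    "m \<in> N \<Longrightarrow> m \<in> bounded_ops"
  using assms unfolding TRO_def by blast+

lemma left_alg_bounded_ops: "TRO N \<Longrightarrow> left_alg N \<subseteq> bounded_ops"
  unfolding left_alg_def
  by (intro closed_cspan_minimal csubspace_bounded_ops closed_bounded_ops)
    (auto intro!: bounded_ops_compose dest: TRO_D(5))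

lemma right_alg_bounded_ops: "TRO N \<Longrightarrow> right_alg N \<subseteq> bounded_ops"
  unfolding right_alg_def
  by (intro closed_cspan_minimal csubspace_bounded_ops closed_bounded_ops)
    (auto intro!: bounded_ops_compose dest: TRO_D(5))

lemma left_alg_mem: "m \<in> N \<Longrightarrow> n \<in> N \<Longrightarrow> m o\<^sub>L adj n \<in> left_alg N"
  unfolding left_alg_def by (rule subsetD[OF closed_cspan_superset]) blast

lemma right_alg_mem: "m \<in> N \<Longrightarrow> n \<in> N \<Longrightarrow> adj m o\<^sub>L n \<in> right_alg N"
  unfolding right_alg_def by (rule subsetD[OF closed_cspan_superset]) blast

text \<open>The operators that map \<open>N\<close> into itself by left composition form a closed
  subspace, and closure under ternary products puts the generators into it.\<close>

lemma left_alg_act: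
  assumes N: "TRO N" and "a \<in> left_alg N" "m \<in> N"
  shows "a o\<^sub>L m \<in> N"
proof -
  let ?S = "\<Inter>m\<in>N. (\<lambda>a. a o\<^sub>L m) -` N"
  have "left_alg N \<subseteq> ?S"
    unfolding left_alg_def
  proof (rule closed_cspan_minimal)
    show "csubspace ?S"
      using TRO_D(2)[OF N]
      by (auto simp: csubspace_def blinfun_compose_add blinfun_compose_scaleC_left
          bounded_bilinear.zero_left[OF bounded_bilinear_blinfun_compose])
    show "closed ?S"
      by (intro closed_INT ballI closed_vimage TRO_D N linear_continuous_on
          bounded_bilinear.bounded_linear_left[OF bounded_bilinear_blinfun_compose])
  qed (use TRO_D(4)[OF N] in auto)
  then show ?thesis using assms by auto
qed

lemma right_alg_act:
  assumes N: "TRO N" and "b \<in> right_alg N" "m \<in> N"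
  shows "m o\<^sub>L b \<in> N"
proof -
  let ?S = "\<Inter>m\<in>N. (\<lambda>b. m o\<^sub>L b) -` N"
  have "right_alg N \<subseteq> ?S"
    unfolding right_alg_def
  proof (rule closed_cspan_minimal)
    show "csubspace ?S"
      using TRO_D(2,5)[OF N]
      by (auto simp: csubspace_def blinfun_compose_add blinfun_compose_scaleC_right
          bounded_bilinear.zero_right[OF bounded_bilinear_blinfun_compose])
    show "closed ?S"
      by (intro closed_INT ballI closed_vimage TRO_D N linear_continuous_on
          bounded_bilinear.bounded_linear_right[OF bounded_bilinear_blinfun_compose])
  qed (use TRO_D(4)[OF N] in \<open>auto simp: blinfun_compose_assoc'\<close>)
  then show ?thesis using assms by auto
qed

lemma tro_bimod_simps [simp]:
  "bm_carrier (tro_bimod N) = N" "bm_lact (tro_bimod N) = (o\<^sub>L)" "bm_ract (tro_bimod N) = (o\<^sub>L)"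
  "bm_lip (tro_bimod N) = (\<lambda>m n. m o\<^sub>L adj n)" "bm_rip (tro_bimod N) = (\<lambda>m n. adj m o\<^sub>L n)"
  by (simp_all add: tro_bimod_def)

lemma left_hilbert_module_tro:
  assumes N: "TRO N"
    and A: "cstar_algebra \<lparr>alg_carrier = left_alg N, alg_mult = (o\<^sub>L), alg_star = adj\<rparr>"
  shows "left_hilbert_module \<lparr>alg_carrier = left_alg N, alg_mult = (o\<^sub>L), alg_star = adj\<rparr> (tro_bimod N)"
proof -
  have bop: "\<And>m. m \<in> N \<Longrightarrow> m \<in> bounded_ops" "\<And>a. a \<in> left_alg N \<Longrightarrow> a \<in> bounded_ops"
    using TRO_D(5)[OF N] left_alg_bounded_ops[OF N] by auto
  have "\<exists>y\<in>left_alg N. m o\<^sub>L adj m = adj y o\<^sub>L y" if "m \<in> N" for m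
  proof (rule positive_ops_root)
    show "csubspace (left_alg N)" "closed (left_alg N)"
      by (simp_all add: left_alg_def csubspace_closed_cspan closed_closed_cspan)
    show "x o\<^sub>L y \<in> left_alg N" if "x \<in> left_alg N" "y \<in> left_alg N" for x y
      using cstar_algebra.alg_mult_closed[OF A, of x y] that by simp
  qed (use that bop left_alg_mem in auto)
  then show ?thesis
    by (intro left_hilbert_module.intro left_hilbert_module_axioms.intro A)
      (auto simp: TRO_D[OF N] complete_eq_closed left_alg_act[OF N] left_alg_mem alg_positive_def
        blinfun_compose_add blinfun_compose_scaleC_left blinfun_compose_scaleC_right bop
        blinfun_compose_assoc' adj_compose adj_adj norm_compose_adj)
qed

lemma right_hilbert_module_tro:
  assumes N: "TRO N"
    and B: "cstar_algebra \<lparr>alg_carrier = right_alg N, alg_mult = (o\<^sub>L), alg_star = adj\<rparr>"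
  shows "right_hilbert_module \<lparr>alg_carrier = right_alg N, alg_mult = (o\<^sub>L), alg_star = adj\<rparr> (tro_bimod N)"
proof -
  have bop: "\<And>m. m \<in> N \<Longrightarrow> m \<in> bounded_ops" "\<And>b. b \<in> right_alg N \<Longrightarrow> b \<in> bounded_ops"
    using TRO_D(5)[OF N] right_alg_bounded_ops[OF N] by auto
  \<comment> \<open>The root lemma treats products of the form \<open>m o\<^sub>L adj m\<close>;
    here it is applied to \<open>adj m\<close>.\<close>
  have "\<exists>y\<in>right_alg N. adj m o\<^sub>L adj (adj m) = adj y o\<^sub>L y" if "m \<in> N" for m
  proof (rule positive_ops_root)
    show "csubspace (right_alg N)" "closed (right_alg N)"
      by (simp_all add: right_alg_def csubspace_closed_cspan closed_closed_cspan)
    show "x o\<^sub>L y \<in> right_alg N" if "x \<in> right_alg N" "y \<in> right_alg N" for x y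
      using cstar_algebra.alg_mult_closed[OF B, of x y] that by simp
  qed (use that bop right_alg_mem in \<open>auto simp: adj_adj\<close>)
  then show ?thesis
    by (intro right_hilbert_module.intro right_hilbert_module_axioms.intro B)
      (auto simp: TRO_D[OF N] complete_eq_closed right_alg_act[OF N] right_alg_mem alg_positive_def
        blinfun_compose_add blinfun_compose_scaleC_left blinfun_compose_scaleC_right bop
        blinfun_compose_assoc' adj_compose adj_adj norm_adj_compose)
qed

lemma hilbert_bimodule_tro:
  assumes "TRO N"
    and "cstar_algebra \<lparr>alg_carrier = left_alg N, alg_mult = (o\<^sub>L), alg_star = adj\<rparr>"
    and "cstar_algebra \<lparr>alg_carrier = right_alg N, alg_mult = (o\<^sub>L), alg_star = adj\<rparr>"
  shows "hilbert_bimodule \<lparr>alg_carrier = left_alg N, alg_mult = (o\<^sub>L), alg_star = adj\<rparr>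
    \<lparr>alg_carrier = right_alg N, alg_mult = (o\<^sub>L), alg_star = adj\<rparr> (tro_bimod N)"
  using assms
  by (intro hilbert_bimodule.intro hilbert_bimodule_axioms.intro left_hilbert_module_tro
      right_hilbert_module_tro) (auto simp: blinfun_compose_assoc')

section \<open>The algebras of sections\<close>

lemma alg_field_of_simps [simp]:
  "af_base (alg_field_of D E) = gammaP"
  "alg_mult (af_total (alg_field_of D E)) = (o\<^sub>C)"
  "alg_star (af_total (alg_field_of D E)) = bc_adj"
  "af_fibre (alg_field_of D E) v = \<lparr>alg_carrier = E v, alg_mult = (o\<^sub>L), alg_star = adj\<rparr>"
  "af_proj (alg_field_of D E) v a = extend_gammaP a v"
  by (simp_all add: alg_field_of_def generated_cstar_def)

context
  fixes D :: "'p::poset_topology \<Rightarrow> ('h::chilbert_space \<Rightarrow>\<^sub>L 'h) set" and E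
  assumes field: "continuous_field_cstar (alg_field_of D E)"
    and D: "\<And>u. D u \<subseteq> bounded_ops"
begin

lemma compact_gammaP: "compact_space (gammaP :: (('p \<Rightarrow>\<^sub>C complex) \<Rightarrow> complex) topology)"
  using continuous_field_cstar.base_compact[OF field] by simp

lemma
  shows alg_total_extendable_ops: "alg_carrier (af_total (alg_field_of D E)) \<subseteq> extendable_ops"
    and alg_total_subalgebra: "cstar_subalgebra \<lparr>alg_carrier = Cb_ops, alg_mult = (o\<^sub>C), alg_star = bc_adj\<rparr>
      (alg_carrier (af_total (alg_field_of D E)))"
proof -
  have 1: "cstar_subalgebra \<lparr>alg_carrier = Cb_ops, alg_mult = (o\<^sub>C), alg_star = bc_adj\<rparr>
      (extendable_ops :: ('p \<Rightarrow>\<^sub>C ('h \<Rightarrow>\<^sub>L 'h)) set)"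
    unfolding cstar_subalgebra_def
    by (auto simp: csubspace_extendable_ops closed_extendable_ops compose_extendable_ops
        bc_adj_extendable_ops) (simp add: extendable_ops_def)
  have 2: "{step_on u a |u a. a \<in> D u} \<subseteq> extendable_ops"
    using D by (auto intro!: step_on_extendable_ops)
  show "alg_carrier (af_total (alg_field_of D E)) \<subseteq> extendable_ops"
    "cstar_subalgebra \<lparr>alg_carrier = Cb_ops, alg_mult = (o\<^sub>C), alg_star = bc_adj\<rparr>
      (alg_carrier (af_total (alg_field_of D E)))"
    using generated_cstar[OF 1 2] by (simp_all add: alg_field_of_def)
qed

lemma alg_total_extendable: "a \<in> alg_carrier (af_total (alg_field_of D E)) \<Longrightarrow> extendable a"
  and alg_total_Cb_ops: "a \<in> alg_carrier (af_total (alg_field_of D E)) \<Longrightarrow> a \<in> Cb_ops"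
  using alg_total_extendable_ops by (auto simp: extendable_ops_def)

lemma alg_total_closed:
  "csubspace (alg_carrier (af_total (alg_field_of D E)))"
  "closed (alg_carrier (af_total (alg_field_of D E)))"
  "a \<in> alg_carrier (af_total (alg_field_of D E)) \<Longrightarrow> b \<in> alg_carrier (af_total (alg_field_of D E)) \<Longrightarrow>
    a o\<^sub>C b \<in> alg_carrier (af_total (alg_field_of D E))"
  using alg_total_subalgebra by (auto simp: cstar_subalgebra_def)

text \<open>The algebra is generated without reference to \<open>C_P\<close>. The action of
  C(\<gamma>P) in the field axioms provides an element with the right values on \<gamma>P, and
  comparison at point evaluations identifies it with \<open>bc_scale f a\<close>.\<close>

lemma C_P_module_alg_total: "C_P_module (alg_carrier (af_total (alg_field_of D E)))"
  unfolding C_P_module_def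
proof (intro conjI ballI alg_total_closed)
  show "alg_carrier (af_total (alg_field_of D E)) \<subseteq> Collect extendable"
    using alg_total_extendable by blast
  fix f a assume f: "f \<in> alg_carrier (C_P :: ('p \<Rightarrow>\<^sub>C complex) star_alg)"
    and a: "a \<in> alg_carrier (af_total (alg_field_of D E))"
  obtain b where b: "b \<in> alg_carrier (af_total (alg_field_of D E))"
    "\<And>\<phi>. \<phi> \<in> topspace gammaP \<Longrightarrow> extend_gammaP b \<phi> = \<phi> f *\<^sub>C extend_gammaP a \<phi>"
    using continuous_field_cstar.functions_act[OF field] continuous_map_gelfand[OF f] a
    unfolding continuous_functions_act_def alg_field_of_simps by metis
  have "bc_scale f a = b"
    using b(2)[of "point_eval _"] f
    by (intro bcontfun_eqI) (simp add: extend_point alg_total_extendable a b(1))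
  then show "bc_scale f a \<in> alg_carrier (af_total (alg_field_of D E))" using b(1) by simp
qed

lemma alg_total_fibre:
  "\<phi> \<in> topspace gammaP \<Longrightarrow>
    (\<lambda>a. extend_gammaP a \<phi>) ` alg_carrier (af_total (alg_field_of D E)) = E \<phi>"
  using continuous_field_cstar.proj_surj[OF field, of \<phi>] by simp

text \<open>Membership test by values: the surjectivity axiom says that the fibres of the module are
  exactly the sets \<open>E \<phi>\<close>.\<close>

lemma alg_totalI:
  "extendable a \<Longrightarrow> (\<And>\<phi>. \<phi> \<in> topspace gammaP \<Longrightarrow> extend_gammaP a \<phi> \<in> E \<phi>) \<Longrightarrow>
    a \<in> alg_carrier (af_total (alg_field_of D E))"
  by (rule C_P_module_local_global[OF C_P_module_alg_total compact_gammaP]) (simp_all add: alg_total_fibre)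

end

section \<open>The field of bimodules\<close>

text \<open>Names the condition under the intersection in \<open>tro_total\<close>, so that
  \<open>tro_total F\<close> can be treated as its least solution.\<close>

definition tro_closed ::
    "('p::poset_topology \<Rightarrow> ('h1::chilbert_space \<Rightarrow>\<^sub>L 'h2::chilbert_space) set) \<Rightarrow>
     ('p \<Rightarrow>\<^sub>C ('h1 \<Rightarrow>\<^sub>L 'h2)) set \<Rightarrow> bool"
  where "tro_closed F S \<longleftrightarrow> S \<subseteq> Cb_ops \<and> csubspace S \<and> closed S \<and>
    (\<forall>a. \<forall>s\<in>F a. step_on a s \<in> S) \<and>
    (\<forall>m\<in>S. \<forall>n\<in>S. \<forall>r\<in>S. m o\<^sub>C bc_adj n o\<^sub>C r \<in> S) \<and>
    (\<forall>f\<in>alg_carrier C_P. \<forall>m\<in>S. bc_scale f m \<in> S)"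

text \<open>\<open>extendable_ops\<close> is itself a solution. Hence the intersected family is not
  empty, its intersection is again a solution, and all its elements extend.\<close>

lemma
  assumes "\<And>u. F u \<subseteq> bounded_ops"
  shows tro_total_extendable_ops: "tro_total F \<subseteq> extendable_ops"
    and tro_closed_tro_total: "tro_closed F (tro_total F)"
proof -
  have "tro_closed F extendable_ops"
    unfolding tro_closed_def using assms
    by (auto intro: step_on_extendable_ops compose_extendable_ops bc_adj_extendable_ops
        bc_scale_extendable_ops csubspace_extendable_ops closed_extendable_ops)
      (simp add: extendable_ops_def)
  then show sub: "tro_total F \<subseteq> extendable_ops"
    unfolding tro_total_def tro_closed_def by blast
  have "tro_total F = \<Inter> {S. tro_closed F S}"
    unfolding tro_total_def tro_closed_def ..
  moreover have "csubspace (\<Inter> {S. tro_closed F S})"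
    by (auto simp: csubspace_def tro_closed_def)
  moreover have "closed (\<Inter> {S. tro_closed F S})"
    by (intro closed_Inter) (auto simp: tro_closed_def)
  ultimately show "tro_closed F (tro_total F)"
    using sub unfolding tro_closed_def[of F "tro_total F"]
    by (auto simp: extendable_ops_def) (auto simp: tro_closed_def)
qed

lemma tro_field_simps [simp]:
  "bf_base (tro_field F) = gammaP"
  "bm_carrier (bf_total (tro_field F)) = tro_total F"
  "bm_lact (bf_total (tro_field F)) = (o\<^sub>C)"
  "bm_ract (bf_total (tro_field F)) = (o\<^sub>C)"
  "bm_lip (bf_total (tro_field F)) = (\<lambda>m n. m o\<^sub>C bc_adj n)"
  "bm_rip (bf_total (tro_field F)) = (\<lambda>m n. bc_adj m o\<^sub>C n)"
  "bf_fibre (tro_field F) v = tro_bimod (tro_fibre F v)"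
  "bf_proj (tro_field F) v m = extend_gammaP m v"
  by (simp_all add: tro_field_def)

context
  fixes F :: "'p::poset_topology \<Rightarrow> ('h1::chilbert_space \<Rightarrow>\<^sub>L 'h2::chilbert_space) set"
  assumes TRO: "\<And>u. TRO (F u)"
begin

lemma tro_total_extendable: "m \<in> tro_total F \<Longrightarrow> extendable m"
  and tro_total_Cb_ops: "m \<in> tro_total F \<Longrightarrow> m \<in> Cb_ops"
  using tro_total_extendable_ops[of F, OF TRO_D(1)[OF TRO]] by (auto simp: extendable_ops_def)

lemma C_P_module_tro_total: "C_P_module (tro_total F)"
  using tro_closed_tro_total[of F, OF TRO_D(1)[OF TRO]] tro_total_extendable
  by (auto simp: tro_closed_def C_P_module_def)

text \<open>Evaluation respects sums, scalars and ternary products; the clause with content is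
  closedness, which is \<open>closed_fibre\<close>.\<close>

lemma TRO_tro_fibre:
  assumes \<phi>: "\<phi> \<in> topspace gammaP"
  shows "TRO (tro_fibre F \<phi>)"
  unfolding TRO_def
proof (intro conjI ballI)
  show "tro_fibre F \<phi> \<subseteq> bounded_ops"
    using \<phi> by (auto simp: tro_fibre_def extend_bounded_ops tro_total_extendable tro_total_Cb_ops)
  show "csubspace (tro_fibre F \<phi>)"
    unfolding tro_fibre_def by (rule csubspace_fibre[OF C_P_module_tro_total \<phi>])
  show "closed (tro_fibre F \<phi>)"
    unfolding tro_fibre_def by (rule closed_fibre[OF C_P_module_tro_total \<phi>])
  fix x y z assume "x \<in> tro_fibre F \<phi>" "y \<in> tro_fibre F \<phi>" "z \<in> tro_fibre F \<phi>"
  then obtain m n r where mem: "m \<in> tro_total F" "n \<in> tro_total F" "r \<in> tro_total F"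
    and xyz: "x = extend_gammaP m \<phi>" "y = extend_gammaP n \<phi>" "z = extend_gammaP r \<phi>"
    by (auto simp: tro_fibre_def)
  have "m o\<^sub>C bc_adj n o\<^sub>C r \<in> tro_total F"
    using tro_closed_tro_total[of F, OF TRO_D(1)[OF TRO]] mem by (simp add: tro_closed_def)
  moreover have "extend_gammaP (m o\<^sub>C bc_adj n o\<^sub>C r) \<phi> = x o\<^sub>L adj y o\<^sub>L z"
    using mem \<phi> by (simp add: xyz extend_compose extendable_compose extendable_bc_adj extend_bc_adj
        tro_total_extendable tro_total_Cb_ops)
  ultimately show "x o\<^sub>L adj y o\<^sub>L z \<in> tro_fibre F \<phi>"
    unfolding tro_fibre_def by (metis image_eqI)
qed

lemma tro_fibre_mem: "m \<in> tro_total F \<Longrightarrow> extend_gammaP m \<phi> \<in> tro_fibre F \<phi>"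
  by (simp add: tro_fibre_def)

context
  assumes compact: "compact_space (gammaP :: (('p \<Rightarrow>\<^sub>C complex) \<Rightarrow> complex) topology)"
begin

lemma tro_totalI:
  "extendable m \<Longrightarrow> (\<And>\<phi>. \<phi> \<in> topspace gammaP \<Longrightarrow> extend_gammaP m \<phi> \<in> tro_fibre F \<phi>) \<Longrightarrow>
    m \<in> tro_total F"
  unfolding tro_fibre_def by (rule C_P_module_local_global[OF C_P_module_tro_total compact])

text \<open>Instead of placing the restriction of \<open>f\<close> to \<open>P\<close> in
  \<open>C_P\<close>, the product is tested fibrewise: at each \<open>\<phi>\<close> it is a scalar
  multiple of an element of the fibre.\<close>

lemma tro_functions_act:
  "continuous_functions_act gammaP (tro_total F) (\<lambda>\<phi> m. extend_gammaP m \<phi>)"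
  unfolding continuous_functions_act_def
proof (intro allI impI ballI)
  fix f :: "(('p \<Rightarrow>\<^sub>C complex) \<Rightarrow> complex) \<Rightarrow> complex" and m
  assume f: "continuous_map gammaP euclidean f" and m: "m \<in> tro_total F"
  have "continuous_on UNIV (\<lambda>u. f (point_eval u))"
    using continuous_map_compose[OF continuous_map_point_eval f] by (simp add: comp_def)
  moreover have "compact (f ` topspace gammaP)"
    using image_compactin[OF compact[unfolded compact_space_def] f] by simp
  then have "bounded (range (\<lambda>u. f (point_eval u)))"
    by (rule bounded_subset[OF compact_imp_bounded]) auto
  ultimately have "(\<lambda>u. f (point_eval u)) \<in> bcontfun"
    by (simp add: bcontfun_def)
  then obtain k where k: "\<And>u. apply_bcontfun k u = f (point_eval u)"
    by (metis bcontfunE)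
  have *: "continuous_map gammaP euclidean (\<lambda>\<phi>. f \<phi> *\<^sub>C extend_gammaP m \<phi>)"
    using f m by (intro continuous_map_bilinear[OF bounded_bilinear_scaleC] continuous_extend
        tro_total_extendable)
  have pts: "f (point_eval u) *\<^sub>C extend_gammaP m (point_eval u) = apply_bcontfun (bc_scale k m) u" for u
    using m by (simp add: k extend_point tro_total_extendable)
  have ext: "extend_gammaP (bc_scale k m) \<phi> = f \<phi> *\<^sub>C extend_gammaP m \<phi>"
    if "\<phi> \<in> topspace gammaP" for \<phi>
    by (rule extend_eqI[OF * pts that])
  have "bc_scale k m \<in> tro_total F"
  proof (rule tro_totalI)
    show "extendable (bc_scale k m)" by (rule extendableI[OF * pts])
    show "extend_gammaP (bc_scale k m) \<phi> \<in> tro_fibre F \<phi>" if "\<phi> \<in> topspace gammaP" for \<phi>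
      using TRO_D(2)[OF TRO_tro_fibre[OF that]] tro_fibre_mem[OF m]
      by (simp add: ext that csubspace_def)
  qed
  then show "\<exists>n\<in>tro_total F. \<forall>\<phi>\<in>topspace gammaP. extend_gammaP n \<phi> = f \<phi> *\<^sub>C extend_gammaP m \<phi>"
    using ext by blast
qed

end

end

text \<open>The axioms with content are that the action and the inner product stay in M and A, which
  is tested on fibres, and positivity, which needs a root inside A. The identities hold pointwise on
  \<open>P\<close>.\<close>

lemma left_hilbert_module_total:
  assumes TRO: "\<And>u. TRO (F u)" and field: "continuous_field_cstar (left_field F)"
  shows "left_hilbert_module (af_total (left_field F)) (bf_total (tro_field F))"
proof -
  have D: "left_alg (F u) \<subseteq> bounded_ops" for u by (rule left_alg_bounded_ops[OF TRO])
  note field' = field[unfolded left_field_def]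
  let ?A = "alg_carrier (af_total (left_field F))"
  have simps [simp]: "alg_mult (af_total (left_field F)) = (o\<^sub>C)" "alg_star (af_total (left_field F)) = bc_adj"
    by (simp_all add: left_field_def)
  have cpt: "compact_space (gammaP :: (('a \<Rightarrow>\<^sub>C complex) \<Rightarrow> complex) topology)"
    by (rule compact_gammaP[OF field' D])
  have A: "a \<in> Cb_ops" "extendable a" if "a \<in> ?A" for a
    using that alg_total_Cb_ops[OF field' D] alg_total_extendable[OF field' D]
    by (auto simp: left_field_def)
  have M: "m \<in> Cb_ops" "extendable m" if "m \<in> tro_total F" for m
    using that tro_total_Cb_ops[of F, OF TRO] tro_total_extendable[of F, OF TRO] by auto
  have act: "a o\<^sub>C m \<in> tro_total F" if a: "a \<in> ?A" and m: "m \<in> tro_total F" for a m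
  proof (rule tro_totalI[of F, OF TRO cpt])
    show "extendable (a o\<^sub>C m)" using A M a m by (simp add: extendable_compose)
    fix \<phi> :: "('a \<Rightarrow>\<^sub>C complex) \<Rightarrow> complex" assume \<phi>: "\<phi> \<in> topspace gammaP"
    have "extend_gammaP a \<phi> \<in> left_alg (tro_fibre F \<phi>)"
      using alg_total_fibre[OF field' D \<phi>] a by (auto simp: left_field_def)
    then show "extend_gammaP (a o\<^sub>C m) \<phi> \<in> tro_fibre F \<phi>"
      using left_alg_act[OF TRO_tro_fibre[of F, OF TRO \<phi>]] tro_fibre_mem[of F, OF TRO m] A M a m \<phi>
      by (simp add: extend_compose)
  qed
  have lip: "m o\<^sub>C bc_adj n \<in> ?A" if m: "m \<in> tro_total F" and n: "n \<in> tro_total F" for m n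
    unfolding left_field_def
  proof (rule alg_totalI[OF field' D])
    show "extendable (m o\<^sub>C bc_adj n)" using M m n by (simp add: extendable_compose extendable_bc_adj)
    show "extend_gammaP (m o\<^sub>C bc_adj n) \<phi> \<in> left_alg (tro_fibre F \<phi>)" if "\<phi> \<in> topspace gammaP" for \<phi>
      using M m n that tro_fibre_mem[of F, OF TRO]
      by (simp add: extend_compose extendable_bc_adj extend_bc_adj left_alg_mem)
  qed
  have "\<exists>y\<in>?A. m o\<^sub>C bc_adj m = bc_adj y o\<^sub>C y" if "m \<in> tro_total F" for m
    using alg_total_closed[OF field' D] A M[OF that] lip[OF that that]
    by (intro positive_Cb_ops_root) (auto simp: left_field_def)
  then show ?thesis
    using C_P_module_tro_total[of F, OF TRO]
    by (intro left_hilbert_module.intro left_hilbert_module_axioms.intro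
        continuous_field_cstar.total_cstar[OF field])
      (auto simp: C_P_module_def closed_imp_complete_bcontfun act lip alg_positive_def
        bc_compose_add bc_compose_scaleC_left bc_compose_scaleC_right A M
        bc_compose_assoc bc_adj_compose bc_adj_Cb_ops bc_adj_adj norm_sq_bc_adj')
qed

lemma right_hilbert_module_total:
  assumes TRO: "\<And>u. TRO (F u)" and field: "continuous_field_cstar (right_field F)"
  shows "right_hilbert_module (af_total (right_field F)) (bf_total (tro_field F))"
proof -
  have D: "right_alg (F u) \<subseteq> bounded_ops" for u by (rule right_alg_bounded_ops[OF TRO])
  note field' = field[unfolded right_field_def]
  let ?B = "alg_carrier (af_total (right_field F))"
  have simps [simp]: "alg_mult (af_total (right_field F)) = (o\<^sub>C)" "alg_star (af_total (right_field F)) = bc_adj"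
    by (simp_all add: right_field_def)
  have cpt: "compact_space (gammaP :: (('a \<Rightarrow>\<^sub>C complex) \<Rightarrow> complex) topology)"
    by (rule compact_gammaP[OF field' D])
  have B: "b \<in> Cb_ops" "extendable b" if "b \<in> ?B" for b
    using that alg_total_Cb_ops[OF field' D] alg_total_extendable[OF field' D]
    by (auto simp: right_field_def)
  have M: "m \<in> Cb_ops" "extendable m" if "m \<in> tro_total F" for m
    using that tro_total_Cb_ops[of F, OF TRO] tro_total_extendable[of F, OF TRO] by auto
  have act: "m o\<^sub>C b \<in> tro_total F" if b: "b \<in> ?B" and m: "m \<in> tro_total F" for b m
  proof (rule tro_totalI[of F, OF TRO cpt])
    show "extendable (m o\<^sub>C b)" using B M b m by (simp add: extendable_compose)
    fix \<phi> :: "('a \<Rightarrow>\<^sub>C complex) \<Rightarrow> complex" assume \<phi>: "\<phi> \<in> topspace gammaP"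
    have "extend_gammaP b \<phi> \<in> right_alg (tro_fibre F \<phi>)"
      using alg_total_fibre[OF field' D \<phi>] b by (auto simp: right_field_def)
    then show "extend_gammaP (m o\<^sub>C b) \<phi> \<in> tro_fibre F \<phi>"
      using right_alg_act[OF TRO_tro_fibre[of F, OF TRO \<phi>]] tro_fibre_mem[of F, OF TRO m] B M b m \<phi>
      by (simp add: extend_compose)
  qed
  have rip: "bc_adj m o\<^sub>C n \<in> ?B" if m: "m \<in> tro_total F" and n: "n \<in> tro_total F" for m n
    unfolding right_field_def
  proof (rule alg_totalI[OF field' D])
    show "extendable (bc_adj m o\<^sub>C n)" using M m n by (simp add: extendable_compose extendable_bc_adj)
    show "extend_gammaP (bc_adj m o\<^sub>C n) \<phi> \<in> right_alg (tro_fibre F \<phi>)" if "\<phi> \<in> topspace gammaP" for \<phi>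
      using M m n that tro_fibre_mem[of F, OF TRO]
      by (simp add: extend_compose extendable_bc_adj extend_bc_adj right_alg_mem)
  qed
  have "\<exists>y\<in>?B. bc_adj m o\<^sub>C bc_adj (bc_adj m) = bc_adj y o\<^sub>C y" if "m \<in> tro_total F" for m
    using alg_total_closed[OF field' D] B M[OF that] rip[OF that that]
    by (intro positive_Cb_ops_root) (auto simp: right_field_def bc_adj_adj bc_adj_Cb_ops)
  then show ?thesis
    using C_P_module_tro_total[of F, OF TRO]
    by (intro right_hilbert_module.intro right_hilbert_module_axioms.intro
        continuous_field_cstar.total_cstar[OF field])
      (auto simp: C_P_module_def closed_imp_complete_bcontfun act rip alg_positive_def
        bc_compose_add bc_compose_scaleC_left bc_compose_scaleC_right B M
        bc_compose_assoc bc_adj_compose bc_adj_Cb_ops bc_adj_adj norm_sq_bc_adj)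
qed

theorem theorem3p8:
  fixes F :: "'p::poset_topology \<Rightarrow> ('h1::chilbert_space \<Rightarrow>\<^sub>L 'h2::chilbert_space) set"
  assumes "\<And>u. TRO (F u)"
    and "\<And>u w. u \<le> w \<Longrightarrow> F u \<subseteq> F w"
    and "continuous_field_cstar (left_field F)"
    and "continuous_field_cstar (right_field F)"
  shows "continuous_field_bimodules (left_field F) (right_field F) (tro_field F)"
proof -
  note TRO = assms(1)
  note L = assms(3)[unfolded left_field_def] and R = assms(4)[unfolded right_field_def]
  have DL: "left_alg (F u) \<subseteq> bounded_ops" and DR: "right_alg (F u) \<subseteq> bounded_ops" for u
    by (rule left_alg_bounded_ops[OF TRO], rule right_alg_bounded_ops[OF TRO])
  have M: "m \<in> Cb_ops" "extendable m" if "m \<in> tro_total F" for m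
    using that tro_total_Cb_ops[of F, OF TRO] tro_total_extendable[of F, OF TRO] by auto
  have A: "extendable a" if "a \<in> alg_carrier (af_total (left_field F))" for a
    using that alg_total_extendable[OF L DL] by (simp add: left_field_def)
  have B: "extendable b" if "b \<in> alg_carrier (af_total (right_field F))" for b
    using that alg_total_extendable[OF R DR] by (simp add: right_field_def)
  have simps [simp]: "af_base (left_field F) = gammaP" "af_base (right_field F) = gammaP"
    "\<And>v a. af_proj (left_field F) v a = extend_gammaP a v"
    "\<And>v b. af_proj (right_field F) v b = extend_gammaP b v"
    by (simp_all add: left_field_def right_field_def)
  show ?thesis
  proof (intro continuous_field_bimodules.intro continuous_field_bimodules_axioms.intro assms(3,4))
    show "hilbert_bimodule (af_total (left_field F)) (af_total (right_field F)) (bf_total (tro_field F))"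
      using left_hilbert_module_total[OF TRO assms(3)] right_hilbert_module_total[OF TRO assms(4)]
      by (intro hilbert_bimodule.intro hilbert_bimodule_axioms.intro)
        (auto simp: bc_compose_assoc)
    \<comment> \<open>The fields over \<gamma>P supply that the algebras of a fibre are C*-algebras;
      the rest depends only on the fibre being a ternary ring of operators.\<close>
    show "hilbert_bimodule (af_fibre (left_field F) t) (af_fibre (right_field F) t) (bf_fibre (tro_field F) t)"
      if "t \<in> topspace (bf_base (tro_field F))" for t
      using that continuous_field_cstar.fibre_cstar[OF L, of t]
        continuous_field_cstar.fibre_cstar[OF R, of t] TRO_tro_fibre[of F, OF TRO, of t]
      by (simp add: left_field_def right_field_def hilbert_bimodule_tro)
    show "in_bounded_product (topspace (bf_base (tro_field F))) (bm_carrier (bf_total (tro_field F)))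
        (\<lambda>t. bm_carrier (bf_fibre (tro_field F) t)) (bf_proj (tro_field F))"
      by (simp add: in_bounded_product_def tro_fibre_mem[of F, OF TRO] M extend_add extend_scaleC
          norm_le_iff_extend)
    show "continuous_functions_act (bf_base (tro_field F)) (bm_carrier (bf_total (tro_field F)))
        (bf_proj (tro_field F))"
      using tro_functions_act[of F, OF TRO compact_gammaP[OF L DL]] by (simp add: tro_field_def)
  qed (auto simp: tro_fibre_def A B M extend_compose extendable_bc_adj extend_bc_adj)
qed

end
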